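(* Let $G=(V,E)$ be a finite graph. We have $\xi_*^{\mathrm{col}}(G)=\xi_f(G)\le\chi_q(G)$ and $\xi_\infty^{\mathrm{col}}(G)=\xi_{tr}(G)\le\chi_{qc}(G)$.
   Context: Synchronous correlations. For finite sets $A,S$ and $\Gamma=A^2\times S^2$, $C_q(\Gamma)$ is the set of $P\in\mathbb{R}^\Gamma$ of the form $P(a,b|s,t)=\psi^*(E_s^a\otimes F_t^b)\psi$ for some $d\in\mathbb{N}$, unit vector $\psi\in\mathbb{C}^d\otimes\mathbb{C}^d$, and families $\{E_s^a\}_{a\in A}$, $\{F_t^b\}_{b\in A}$ ($s,t\in S$) of $d\times d$ Hermitian positive semidefinite matrices each summing to $I$. $C_{qc}(\Gamma)$ is the set of $P$ of the form $P(a,b|s,t)=\psi^*(X_s^aY_t^b)\psi$ with $\psi$ a unit vector in a separable Hilbert space $H$ and $\{X_s^a\}_a$, $\{Y_t^b\}_b$ families of positive semidefinite bounded operators on $H$, each family summing to $I$, with $X_s^aY_t^b=Y_t^bX_s^a$ for all $a,b,s,t$. $P$ is synchronous if $P(a,b|s,s)=0$ for all $s$ and $a\ne b$; $C_{q,s}(\Gamma)$ and $C_{qc,s}(\Gamma)$ are the sets of synchronous elements of $C_q(\Gamma)$ and $C_{qc}(\Gamma)$. With $[k]=\{1,\dots,k\}$, $\chi_q(G)$ (resp. $\chi_{qc}(G)$) is the smallest $k\in\mathbb{N}$ for which there is $P=(P(a,b|i,j))$ in $C_{q,s}([k]^2\times V^2)$ (resp. $C_{qc,s}([k]^2\times V^2)$)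 with $P(a,a|i,j)=0$ for all $a\in[k]$, $\{i,j\}\in E$. The projective rank is $$\xi_f(G)=\inf\Big\{\frac dr:\ d,r\in\mathbb{N},\ (X_i)_{i\in V}\ d\times d\text{ Hermitian},\ \operatorname{Tr}(X_i)=r,\ X_i^2=X_i\ (i\in V),\ X_iX_j=0\ (\{i,j\}\in E)\Big\}.$$ The tracial rank is $$\xi_{tr}(G)=\inf\big\{\lambda:\ \mathcal{A}\text{ a unital }C^*\text{-algebra with tracial state }\tau,\ X_i\in\mathcal{A}\text{ projectors with }\tau(X_i)=1/\lambda\ (i\in V),\ X_iX_j=0\ (\{i,j\}\in E)\big\}.$$ Let $\mathbf{x}=(x_i:i\in V)$ be noncommuting variables, $\mathbb{R}\langle\mathbf{x}\rangle$ the real noncommutative polynomials with involution $*$ reversing words and fixing the variables. A linear functional $L$ on $\mathbb{R}\langle\mathbf{x}\rangle$ is symmetric if $L(w)=L(w^* )$ and tracial if $L(ww')=L(w'w)$ for all words $w,w'$, and positive if $L(p^*p)\ge0$ for all $p$. $M(L)=(L(w^*w'))$ is its moment matrix indexed by all words. Let $\mathcal{H}_G=\{x_i-x_i^2:i\in V\}\cup\{x_ix_j:\{i,j\}\in E\}$ and $\mathcal{I}(\mathcal{H}_G)=\{ph:p\in\mathbb{R}\langle\mathbf{x}\rangle,h\in\mathcal{H}_G\}$. Then $$\xi_\infty^{\mathrm{col}}(G)=\inf\big\{L(1):L\in\mathbb{R}\langle\mathbf{x}\rangle^*\text{ tracial, symmetric, positive},\ L(x_i)=1\ (i\in V),\ L=0\text{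 on }\mathcal{I}(\mathcal{H}_G)\big\},$$ and $\xi_*^{\mathrm{col}}(G)$ is obtained by adding the constraint $\operatorname{rank}(M(L))<\infty$. *)

theory Defs
  imports
    "HOL-Library.Poly_Mapping"
    "HOL-Library.Equipollence"
    "HOL-Library.Extended_Real"
    "HOL-Library.Nonpos_Ints"
    "HOL-Algebra.Module"
    "Jordan_Normal_Form.Schur_Decomposition"
begin

definition finite_graph :: "'v set \<Rightarrow> 'v set set \<Rightarrow> bool" where
  "finite_graph V E \<longleftrightarrow> finite V \<and> (\<forall>e\<in>E. e \<subseteq> V \<and> card e = 2)"


section \<open>Quantum correlations\<close>

definition psd_mat :: "nat \<Rightarrow> complex mat \<Rightarrow> bool" where
  "psd_mat d M \<longleftrightarrow> M \<in> carrier_mat d d \<and> mat_adjoint M = M \<and>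
     (\<forall>v\<in>carrier_vec d. (M *\<^sub>v v) \<bullet>c v \<in> \<real>\<^sub>\<ge>\<^sub>0)"

definition povm_mat :: "nat \<Rightarrow> 'a set \<Rightarrow> ('a \<Rightarrow> complex mat) \<Rightarrow> bool" where
  "povm_mat d A F \<longleftrightarrow> (\<forall>a\<in>A. psd_mat d (F a)) \<and>
     mat d d (\<lambda>ij. \<Sum>a\<in>A. F a $$ ij) = 1\<^sub>m d"

definition tensor_mat :: "complex mat \<Rightarrow> complex mat \<Rightarrow> complex mat" where
  "tensor_mat M N = mat (dim_row M * dim_row N) (dim_col M * dim_col N)
     (\<lambda>(i, j). M $$ (i div dim_row N, j div dim_col N) * N $$ (i mod dim_row N, j mod dim_col N))"

text \<open>A correlation is a function \<open>P a b s t\<close>, standing for $P(a,b|s,t)$. Only its values for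
  \<open>a, b \<in> A\<close> and \<open>s, t \<in> S\<close> are constrained.\<close>

definition C_q :: "'a set \<Rightarrow> 's set \<Rightarrow> ('a \<Rightarrow> 'a \<Rightarrow> 's \<Rightarrow> 's \<Rightarrow> real) set" where
  "C_q A S = {P. \<exists>d \<psi> X Y. \<psi> \<in> carrier_vec (d * d) \<and> \<psi> \<bullet>c \<psi> = 1 \<and>
     (\<forall>s\<in>S. povm_mat d A (X s)) \<and> (\<forall>t\<in>S. povm_mat d A (Y t)) \<and>
     (\<forall>a\<in>A. \<forall>b\<in>A. \<forall>s\<in>S. \<forall>t\<in>S.
        complex_of_real (P a b s t) = (tensor_mat (X s a) (Y t b) *\<^sub>v \<psi>) \<bullet>c \<psi>)}"

definition synchronous :: "'a set \<Rightarrow> 's set \<Rightarrow> ('a \<Rightarrow> 'a \<Rightarrow> 's \<Rightarrow> 's \<Rightarrow> real) \<Rightarrow> bool" where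
  "synchronous A S P \<longleftrightarrow> (\<forall>s\<in>S. \<forall>a\<in>A. \<forall>b\<in>A. a \<noteq> b \<longrightarrow> P a b s s = 0)"

definition C_qs :: "'a set \<Rightarrow> 's set \<Rightarrow> ('a \<Rightarrow> 'a \<Rightarrow> 's \<Rightarrow> 's \<Rightarrow> real) set" where
  "C_qs A S = {P \<in> C_q A S. synchronous A S P}"


section \<open>Complex Hilbert spaces and commuting-operator correlations\<close>

definition complex_ring :: "complex ring" where
  "complex_ring = \<lparr>carrier = UNIV, monoid.mult = (*), one = 1, zero = 0, add = (+)\<rparr>"

text \<open>As usual for \<open>module\<close> records, the fields \<open>mult\<close> and \<open>one\<close> of a Hilbert space
  carry no meaning. The inner product is conjugate-linear in the first argument.\<close>

record 'u inner_space = "(complex, 'u) module" +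
  ip :: "'u \<Rightarrow> 'u \<Rightarrow> complex"

definition hnorm :: "'u inner_space \<Rightarrow> 'u \<Rightarrow> real" where
  "hnorm H x = sqrt (Re (ip H x x))"

locale separable_hilbert_space = module complex_ring H for H :: "'u inner_space" (structure) +
  assumes ip_add_right: "\<lbrakk>x \<in> carrier H; y \<in> carrier H; z \<in> carrier H\<rbrakk>
      \<Longrightarrow> ip H x (y \<oplus> z) = ip H x y + ip H x z"
    and ip_smult_right: "\<lbrakk>x \<in> carrier H; y \<in> carrier H\<rbrakk> \<Longrightarrow> ip H x (c \<odot> y) = c * ip H x y"
    and ip_commute: "\<lbrakk>x \<in> carrier H; y \<in> carrier H\<rbrakk> \<Longrightarrow> ip H y x = cnj (ip H x y)"
    and ip_nonneg: "x \<in> carrier H \<Longrightarrow> ip H x x \<in> \<real>\<^sub>\<ge>\<^sub>0"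
    and ip_definite: "\<lbrakk>x \<in> carrier H; ip H x x = 0\<rbrakk> \<Longrightarrow> x = \<zero>"
    and complete: "\<lbrakk>\<And>n. s n \<in> carrier H;
        \<And>e. e > 0 \<Longrightarrow> \<exists>N. \<forall>m\<ge>N. \<forall>n\<ge>N. hnorm H (s m \<ominus> s n) < e\<rbrakk>
      \<Longrightarrow> \<exists>x\<in>carrier H. (\<lambda>n::nat. hnorm H (s n \<ominus> x)) \<longlonglongrightarrow> 0"
    and separable: "\<exists>D. countable D \<and> D \<subseteq> carrier H \<and>
        (\<forall>x\<in>carrier H. \<forall>e>0. \<exists>y\<in>D. hnorm H (x \<ominus> y) < e)"

definition bounded_op :: "'u inner_space \<Rightarrow> ('u \<Rightarrow> 'u) \<Rightarrow> bool" where
  "bounded_op H T \<longleftrightarrow> T \<in> carrier H \<rightarrow> carrier H \<and>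
     (\<forall>x\<in>carrier H. \<forall>y\<in>carrier H. T (x \<oplus>\<^bsub>H\<^esub> y) = T x \<oplus>\<^bsub>H\<^esub> T y) \<and>
     (\<forall>c. \<forall>x\<in>carrier H. T (c \<odot>\<^bsub>H\<^esub> x) = c \<odot>\<^bsub>H\<^esub> T x) \<and>
     (\<exists>K. \<forall>x\<in>carrier H. hnorm H (T x) \<le> K * hnorm H x)"

definition psd_op :: "'u inner_space \<Rightarrow> ('u \<Rightarrow> 'u) \<Rightarrow> bool" where
  "psd_op H T \<longleftrightarrow> bounded_op H T \<and> (\<forall>x\<in>carrier H. ip H x (T x) \<in> \<real>\<^sub>\<ge>\<^sub>0)"

definition povm_op :: "'u inner_space \<Rightarrow> 'a set \<Rightarrow> ('a \<Rightarrow> 'u \<Rightarrow> 'u) \<Rightarrow> bool" where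
  "povm_op H A F \<longleftrightarrow> (\<forall>a\<in>A. psd_op H (F a)) \<and>
     (\<forall>x\<in>carrier H. (\<Oplus>\<^bsub>H\<^esub>a\<in>A. F a x) = x)"

text \<open>HOL cannot quantify over types inside a formula. The carrier sets of the Hilbert spaces, and
  of the C*-algebras below, are therefore arbitrary subsets of a universe type \<open>'u\<close>, passed
  as an \<open>itself\<close> argument. A nonzero separable Hilbert space has exactly continuum many
  elements, so every universe of at least that cardinality contains copies of all of them. C*-algebras
  may be larger, but the universe \<open>'u\<close> is arbitrary too, and the finitely many projectors
  in the definition of the tracial rank generate a separable C*-subalgebra, of cardinality at
  most the continuum.\<close>

definition C_qc ::
  "'u itself \<Rightarrow> 'a set \<Rightarrow> 's set \<Rightarrow> ('a \<Rightarrow> 'a \<Rightarrow> 's \<Rightarrow> 's \<Rightarrow> real) set" where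
  "C_qc U A S = {P. \<exists>(H :: 'u inner_space) \<psi> X Y. separable_hilbert_space H \<and>
     \<psi> \<in> carrier H \<and> hnorm H \<psi> = 1 \<and>
     (\<forall>s\<in>S. povm_op H A (X s)) \<and> (\<forall>t\<in>S. povm_op H A (Y t)) \<and>
     (\<forall>a\<in>A. \<forall>b\<in>A. \<forall>s\<in>S. \<forall>t\<in>S. \<forall>x\<in>carrier H. X s a (Y t b x) = Y t b (X s a x)) \<and>
     (\<forall>a\<in>A. \<forall>b\<in>A. \<forall>s\<in>S. \<forall>t\<in>S.
        complex_of_real (P a b s t) = ip H \<psi> (X s a (Y t b \<psi>)))}"

definition C_qcs ::
  "'u itself \<Rightarrow> 'a set \<Rightarrow> 's set \<Rightarrow> ('a \<Rightarrow> 'a \<Rightarrow> 's \<Rightarrow> 's \<Rightarrow> real) set" where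
  "C_qcs U A S = {P \<in> C_qc U A S. synchronous A S P}"


section \<open>Quantum chromatic numbers\<close>

definition proper_correlation ::
  "nat \<Rightarrow> 'v set set \<Rightarrow> (nat \<Rightarrow> nat \<Rightarrow> 'v \<Rightarrow> 'v \<Rightarrow> real) \<Rightarrow> bool" where
  "proper_correlation k E P \<longleftrightarrow> (\<forall>a\<in>{1..k}. \<forall>i j. {i, j} \<in> E \<longrightarrow> P a a i j = 0)"

definition chi_q :: "'v set \<Rightarrow> 'v set set \<Rightarrow> nat" where
  "chi_q V E = (LEAST k. \<exists>P\<in>C_qs {1..k} V. proper_correlation k E P)"

definition chi_qc :: "'u itself \<Rightarrow> 'v set \<Rightarrow> 'v set set \<Rightarrow> nat" where
  "chi_qc U V E = (LEAST k. \<exists>P\<in>C_qcs U {1..k} V. proper_correlation k E P)"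


section \<open>Projective rank\<close>

definition trace_mat :: "complex mat \<Rightarrow> complex" where
  "trace_mat M = (\<Sum>i<dim_row M. M $$ (i, i))"

text \<open>The bounds \<open>d \<ge> 1\<close> and \<open>r \<ge> 1\<close> keep \<open>d / r\<close> meaningful (in HOL
  \<open>d / 0 = 0\<close>); \<open>\<lambda> > 0\<close> plays the same role in the tracial rank.\<close>

definition xi_f :: "'v set \<Rightarrow> 'v set set \<Rightarrow> ereal" where
  "xi_f V E = Inf {ereal (real d / real r) | d r. d \<ge> 1 \<and> r \<ge> 1 \<and>
     (\<exists>X. (\<forall>i\<in>V. X i \<in> carrier_mat d d \<and> mat_adjoint (X i) = X i \<and>
              trace_mat (X i) = of_nat r \<and> X i * X i = X i) \<and>
          (\<forall>i j. {i, j} \<in> E \<longrightarrow> X i * X j = 0\<^sub>m d d))}"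


section \<open>Tracial rank\<close>

record 'u star_algebra = "(complex, 'u) module" +
  star :: "'u \<Rightarrow> 'u"
  nrm :: "'u \<Rightarrow> real"

locale unital_cstar_algebra =
  ring A + module complex_ring A for A :: "'u star_algebra" (structure) +
  assumes smult_mult_left: "\<lbrakk>x \<in> carrier A; y \<in> carrier A\<rbrakk> \<Longrightarrow> (c \<odot> x) \<otimes> y = c \<odot> (x \<otimes> y)"
    and smult_mult_right: "\<lbrakk>x \<in> carrier A; y \<in> carrier A\<rbrakk> \<Longrightarrow> x \<otimes> (c \<odot> y) = c \<odot> (x \<otimes> y)"
    and star_closed: "x \<in> carrier A \<Longrightarrow> star A x \<in> carrier A"
    and star_star: "x \<in> carrier A \<Longrightarrow> star A (star A x) = x"
    and star_add: "\<lbrakk>x \<in> carrier A; y \<in> carrier A\<rbrakk> \<Longrightarrow> star A (x \<oplus> y) = star A x \<oplus> star A y"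
    and star_smult: "x \<in> carrier A \<Longrightarrow> star A (c \<odot> x) = cnj c \<odot> star A x"
    and star_mult: "\<lbrakk>x \<in> carrier A; y \<in> carrier A\<rbrakk> \<Longrightarrow> star A (x \<otimes> y) = star A y \<otimes> star A x"
    and nrm_eq_0_iff: "x \<in> carrier A \<Longrightarrow> nrm A x = 0 \<longleftrightarrow> x = \<zero>"
    and nrm_triangle: "\<lbrakk>x \<in> carrier A; y \<in> carrier A\<rbrakk> \<Longrightarrow> nrm A (x \<oplus> y) \<le> nrm A x + nrm A y"
    and nrm_smult: "x \<in> carrier A \<Longrightarrow> nrm A (c \<odot> x) = cmod c * nrm A x"
    and nrm_mult: "\<lbrakk>x \<in> carrier A; y \<in> carrier A\<rbrakk> \<Longrightarrow> nrm A (x \<otimes> y) \<le> nrm A x * nrm A y"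
    and cstar_identity: "x \<in> carrier A \<Longrightarrow> nrm A (star A x \<otimes> x) = (nrm A x)\<^sup>2"
    and complete: "\<lbrakk>\<And>n. s n \<in> carrier A;
        \<And>e. e > 0 \<Longrightarrow> \<exists>N. \<forall>m\<ge>N. \<forall>n\<ge>N. nrm A (s m \<ominus> s n) < e\<rbrakk>
      \<Longrightarrow> \<exists>x\<in>carrier A. (\<lambda>n::nat. nrm A (s n \<ominus> x)) \<longlonglongrightarrow> 0"

definition tracial_state :: "'u star_algebra \<Rightarrow> ('u \<Rightarrow> complex) \<Rightarrow> bool" where
  "tracial_state A \<tau> \<longleftrightarrow>
     (\<forall>x\<in>carrier A. \<forall>y\<in>carrier A. \<tau> (x \<oplus>\<^bsub>A\<^esub> y) = \<tau> x + \<tau> y) \<and>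
     (\<forall>c. \<forall>x\<in>carrier A. \<tau> (c \<odot>\<^bsub>A\<^esub> x) = c * \<tau> x) \<and>
     (\<forall>x\<in>carrier A. \<tau> (star A x \<otimes>\<^bsub>A\<^esub> x) \<in> \<real>\<^sub>\<ge>\<^sub>0) \<and>
     \<tau> \<one>\<^bsub>A\<^esub> = 1 \<and>
     (\<forall>x\<in>carrier A. \<forall>y\<in>carrier A. \<tau> (x \<otimes>\<^bsub>A\<^esub> y) = \<tau> (y \<otimes>\<^bsub>A\<^esub> x))"

definition projector :: "'u star_algebra \<Rightarrow> 'u \<Rightarrow> bool" where
  "projector A x \<longleftrightarrow> x \<in> carrier A \<and> star A x = x \<and> x \<otimes>\<^bsub>A\<^esub> x = x"

definition xi_tr :: "'u itself \<Rightarrow> 'v set \<Rightarrow> 'v set set \<Rightarrow> ereal" where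
  "xi_tr U V E = Inf {ereal l | l. l > 0 \<and>
     (\<exists>(A :: 'u star_algebra) \<tau> X. unital_cstar_algebra A \<and> tracial_state A \<tau> \<and>
        (\<forall>i\<in>V. projector A (X i) \<and> \<tau> (X i) = complex_of_real (1 / l)) \<and>
        (\<forall>i j. {i, j} \<in> E \<longrightarrow> X i \<otimes>\<^bsub>A\<^esub> X j = \<zero>\<^bsub>A\<^esub>))}"


section \<open>Noncommutative polynomials\<close>

text \<open>The free algebra is the monoid algebra of the free monoid: the product of
  \<open>poly_mapping\<close> convolves along the addition of the index type, so words carry
  concatenation as their addition.\<close>

datatype 'v nc_word = NC_Word (letters: "'v list")

instantiation nc_word :: (type) monoid_add
begin

definition zero_nc_word :: "'v nc_word" where
  "zero_nc_word = NC_Word []"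

definition plus_nc_word :: "'v nc_word \<Rightarrow> 'v nc_word \<Rightarrow> 'v nc_word" where
  "plus_nc_word u w = NC_Word (letters u @ letters w)"

instance
  by standard (simp_all add: zero_nc_word_def plus_nc_word_def)

end

type_synonym 'v nc_poly = "'v nc_word \<Rightarrow>\<^sub>0 real"

definition word_rev :: "'v nc_word \<Rightarrow> 'v nc_word" where
  "word_rev w = NC_Word (rev (letters w))"

lemma word_rev_word_rev [simp]: "word_rev (word_rev w) = w"
  by (simp add: word_rev_def)

lemma inj_word_rev: "inj word_rev"
  by (metis injI word_rev_word_rev)

definition nc_star :: "'v nc_poly \<Rightarrow> 'v nc_poly" where
  "nc_star p = Poly_Mapping.map_key word_rev p"

lemma lookup_nc_star: "Poly_Mapping.lookup (nc_star p) w = Poly_Mapping.lookup p (word_rev w)"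
  by (simp add: nc_star_def map_key.rep_eq inj_word_rev)

definition words :: "'v set \<Rightarrow> 'v nc_word set" where
  "words V = {w. set (letters w) \<subseteq> V}"

definition nc_polys :: "'v set \<Rightarrow> 'v nc_poly set" where
  "nc_polys V = {p. Poly_Mapping.keys p \<subseteq> words V}"

definition nc_const :: "real \<Rightarrow> 'v nc_poly" where
  "nc_const c = Poly_Mapping.single 0 c"

definition nc_mono :: "'v nc_word \<Rightarrow> 'v nc_poly" where
  "nc_mono w = Poly_Mapping.single w 1"

definition nc_var :: "'v \<Rightarrow> 'v nc_poly" where
  "nc_var i = nc_mono (NC_Word [i])"

definition nc_functional :: "'v set \<Rightarrow> ('v nc_poly \<Rightarrow> real) \<Rightarrow> bool" where
  "nc_functional V L \<longleftrightarrow>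
     (\<forall>p\<in>nc_polys V. \<forall>q\<in>nc_polys V. L (p + q) = L p + L q) \<and>
     (\<forall>c. \<forall>p\<in>nc_polys V. L (nc_const c * p) = c * L p)"

definition symmetric_functional :: "'v set \<Rightarrow> ('v nc_poly \<Rightarrow> real) \<Rightarrow> bool" where
  "symmetric_functional V L \<longleftrightarrow> (\<forall>w\<in>words V. L (nc_mono w) = L (nc_mono (word_rev w)))"

definition tracial_functional :: "'v set \<Rightarrow> ('v nc_poly \<Rightarrow> real) \<Rightarrow> bool" where
  "tracial_functional V L \<longleftrightarrow>
     (\<forall>u\<in>words V. \<forall>w\<in>words V. L (nc_mono (u + w)) = L (nc_mono (w + u)))"

definition positive_functional :: "'v set \<Rightarrow> ('v nc_poly \<Rightarrow> real) \<Rightarrow> bool" where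
  "positive_functional V L \<longleftrightarrow> (\<forall>p\<in>nc_polys V. L (nc_star p * p) \<ge> 0)"

definition H_G :: "'v set \<Rightarrow> 'v set set \<Rightarrow> 'v nc_poly set" where
  "H_G V E = {nc_var i - nc_var i * nc_var i | i. i \<in> V} \<union>
             {nc_var i * nc_var j | i j. {i, j} \<in> E}"

definition I_H :: "'v set \<Rightarrow> 'v set set \<Rightarrow> 'v nc_poly set" where
  "I_H V E = {p * h | p h. p \<in> nc_polys V \<and> h \<in> H_G V E}"

definition moment_matrix :: "('v nc_poly \<Rightarrow> real) \<Rightarrow> 'v nc_word \<Rightarrow> 'v nc_word \<Rightarrow> real" where
  "moment_matrix L u w = L (nc_mono (word_rev u + w))"

text \<open>A matrix with rows and columns indexed by an arbitrary (infinite) set \<open>I\<close> has finite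
  rank if finitely many of its columns span its column space.\<close>

definition finite_rank :: "'i set \<Rightarrow> ('i \<Rightarrow> 'i \<Rightarrow> real) \<Rightarrow> bool" where
  "finite_rank I M \<longleftrightarrow> (\<exists>B. finite B \<and> B \<subseteq> I \<and>
     (\<forall>w\<in>I. \<exists>c. \<forall>u\<in>I. M u w = (\<Sum>b\<in>B. c b * M u b)))"

definition col_feasible :: "'v set \<Rightarrow> 'v set set \<Rightarrow> ('v nc_poly \<Rightarrow> real) \<Rightarrow> bool" where
  "col_feasible V E L \<longleftrightarrow> nc_functional V L \<and> tracial_functional V L \<and>
     symmetric_functional V L \<and> positive_functional V L \<and>
     (\<forall>i\<in>V. L (nc_var i) = 1) \<and> (\<forall>p\<in>I_H V E. L p = 0)"

definition xi_col_inf :: "'v set \<Rightarrow> 'v set set \<Rightarrow> ereal" where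
  "xi_col_inf V E = Inf {ereal (L 1) | L. col_feasible V E L}"

definition xi_col_star :: "'v set \<Rightarrow> 'v set set \<Rightarrow> ereal" where
  "xi_col_star V E =
     Inf {ereal (L 1) | L. col_feasible V E L \<and> finite_rank (words V) (moment_matrix L)}"

end

theory Submission
  imports Defs "Jordan_Normal_Form.Spectral_Radius" "HOL-Analysis.Abstract_Topology_2"
begin

text \<open>Feasible functionals correspond to tracial moments of words. Matrices, or projectors in a
  C*-algebra with a tracial state, yield such moments by evaluating words.

  Conversely, moments turn the free complex algebra into a semi-inner product space on which the
  variables act by left multiplication as projections. The operator seminorm of left multiplication
  is a C*-seminorm, and its completion is a C*-algebra with the required tracial state. If the
  moment matrix has finite rank, then the space is finite-dimensional, and the trace is a weighted
  sum of matrix traces over invariant blocks. Rounding the weights down to multiples of \<open>1 / N\<close> and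
  repeating the blocks gives projection matrices of size \<open>D \<le> N L(1)\<close> whose traces are at least
  \<open>r = N - O(1)\<close>. Passing to subprojections makes all traces equal to \<open>r\<close> and keeps orthogonality, so
  \<open>\<xi>\<^sub>f \<le> D / r\<close>, which tends to \<open>L(1)\<close>.

  For a synchronous correlation with \<open>k\<close> outputs, \<open>X\<^sub>s\<^sup>a \<psi> = Y\<^sub>s\<^sup>a \<psi>\<close>, so moving operators through \<open>Y\<close>
  shows that \<open>w \<mapsto> \<Sum>a. \<langle>\<psi>, w(X\<^sup>a) \<psi>\<rangle>\<close> is tracial. It is feasible with value \<open>k\<close> at the empty word.\<close>

section \<open>Semi-inner products\<close>

text \<open>Weights: on a finite-dimensional GNS space the trace weights its blocks by positive
  reals that may be irrational, so in general it is not the normalized trace of a matrix model. Only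
  an infimum is wanted, and rounding costs at most the dimension of the space, whatever the
  denominator \<open>N\<close>. Null vectors: positive functionals need not be faithful. Relations
  are therefore proved under inner products only, and elements are identified at a single place, the
  final C*-algebra, where the equations must be literal. Ideals: \<open>I_H\<close> contains only
  left multiples of the relations, so they apply at the end of a word. Traciality rotates them to
  any position. In the synchronous case the end of a word is next to \<psi>, the only vector at
  which the \<open>X\<close> are shown to be idempotent. Degenerate cases: without vertices
  \<open>L 1\<close> may be 0 and cannot serve as a normalizing factor. The chromatic numbers are
  defined by \<open>LEAST\<close>, which says something only once some number of colours is known to
  work; one colour per vertex does.\<close>

lemma hermitian_of_real_diagonal:
  fixes B :: "'c \<Rightarrow> 'c \<Rightarrow> complex"
  assumes C: "x \<in> C" "y \<in> C"
    and pl: "\<And>x y. \<lbrakk>x \<in> C; y \<in> C\<rbrakk> \<Longrightarrow> pl x y \<in> C"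
    and sm: "\<And>c x. x \<in> C \<Longrightarrow> sm c x \<in> C"
    and add_right: "\<And>x y z. \<lbrakk>x \<in> C; y \<in> C; z \<in> C\<rbrakk> \<Longrightarrow> B x (pl y z) = B x y + B x z"
    and add_left: "\<And>x y z. \<lbrakk>x \<in> C; y \<in> C; z \<in> C\<rbrakk> \<Longrightarrow> B (pl y z) x = B y x + B z x"
    and smult_right: "\<And>c x y. \<lbrakk>x \<in> C; y \<in> C\<rbrakk> \<Longrightarrow> B x (sm c y) = c * B x y"
    and smult_left: "\<And>c x y. \<lbrakk>x \<in> C; y \<in> C\<rbrakk> \<Longrightarrow> B (sm c x) y = cnj c * B x y"
    and diag: "\<And>x. x \<in> C \<Longrightarrow> Im (B x x) = 0"
  shows "B y x = cnj (B x y)"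
proof -
  \<comment> \<open>Polarization: the diagonal at x + y makes the imaginary parts of
    \<open>B x y\<close> and \<open>B y x\<close> opposite, the diagonal at x + iy makes their real
    parts equal.\<close>
  have "Im (B (pl x y) (pl x y)) = 0" "Im (B (pl x (sm \<i> y)) (pl x (sm \<i> y))) = 0"
    using C pl sm diag by blast+
  then have "Im (B x y) + Im (B y x) = 0" "Re (B x y) - Re (B y x) = 0"
    using C by (simp_all add: add_right add_left smult_right smult_left pl sm diag)
  then show ?thesis
    by (simp add: complex_eq_iff)
qed

text \<open>The seminorm may have a kernel, and vectors are only compared through their inner products.
  Linear combinations and basis expansions are therefore stated as identities between complex
  numbers.\<close>

locale semi_inner =
  fixes C :: "'c set" and pl :: "'c \<Rightarrow> 'c \<Rightarrow> 'c" and sm :: "complex \<Rightarrow> 'c \<Rightarrow> 'c"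
    and ip :: "'c \<Rightarrow> 'c \<Rightarrow> complex"
  assumes nonempty: "C \<noteq> {}"
    and pl_closed: "\<lbrakk>x \<in> C; y \<in> C\<rbrakk> \<Longrightarrow> pl x y \<in> C"
    and sm_closed: "x \<in> C \<Longrightarrow> sm c x \<in> C"
    and ip_add_right: "\<lbrakk>x \<in> C; y \<in> C; z \<in> C\<rbrakk> \<Longrightarrow> ip x (pl y z) = ip x y + ip x z"
    and ip_smult_right: "\<lbrakk>x \<in> C; y \<in> C\<rbrakk> \<Longrightarrow> ip x (sm c y) = c * ip x y"
    and ip_commute: "\<lbrakk>x \<in> C; y \<in> C\<rbrakk> \<Longrightarrow> ip y x = cnj (ip x y)"
    and ip_nonneg: "x \<in> C \<Longrightarrow> Re (ip x x) \<ge> 0"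
begin

lemma cnj_ip: "\<lbrakk>x \<in> C; y \<in> C\<rbrakk> \<Longrightarrow> cnj (ip x y) = ip y x"
  by (simp add: ip_commute[of x y])

lemma ip_mult_swap: "\<lbrakk>x \<in> C; y \<in> C\<rbrakk> \<Longrightarrow> ip x y * ip y x = of_real ((cmod (ip x y))\<^sup>2)"
  by (simp only: complex_norm_square cnj_ip)

lemma ip_add_left: "\<lbrakk>x \<in> C; y \<in> C; z \<in> C\<rbrakk> \<Longrightarrow> ip (pl y z) x = ip y x + ip z x"
  by (metis complex_cnj_add ip_add_right ip_commute pl_closed)

lemma ip_smult_left: "\<lbrakk>x \<in> C; y \<in> C\<rbrakk> \<Longrightarrow> ip (sm c x) y = cnj c * ip x y"
  by (metis complex_cnj_mult ip_smult_right ip_commute sm_closed)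

lemma ip_self_real: "x \<in> C \<Longrightarrow> ip x x = of_real (Re (ip x x))"
  using ip_commute[of x x] by (simp add: complex_eq_iff)

lemmas ip_expand = ip_add_left ip_add_right ip_smult_left ip_smult_right pl_closed sm_closed

lemma cauchy_schwarz:
  assumes "x \<in> C" "y \<in> C"
  shows "(cmod (ip x y))\<^sup>2 \<le> Re (ip x x) * Re (ip y y)"
proof -
  define a b d where "a = Re (ip x x)" and "b = ip x y" and "d = Re (ip y y)"
  have quad: "a - 2 * t * (cmod b)\<^sup>2 + t\<^sup>2 * (cmod b)\<^sup>2 * d \<ge> 0" for t :: real
  proof -
    \<comment> \<open>The factor \<open>cnj b\<close> cancels the phase of \<open>b\<close>, so both
      cross terms become real and a real parameter \<open>t\<close> suffices.\<close>
    let ?s = "- of_real t * cnj b"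
    have "Re (ip (pl x (sm ?s y)) (pl x (sm ?s y))) \<ge> 0"
      using assms by (intro ip_nonneg) (auto simp: pl_closed sm_closed)
    moreover have "ip (pl x (sm ?s y)) (pl x (sm ?s y))
        = ip x x + ?s * b + cnj ?s * cnj b + cnj ?s * ?s * ip y y"
      using assms ip_commute[OF assms] by (simp add: ip_expand b_def algebra_simps)
    moreover have "ip y y = of_real d"
      using ip_self_real[OF assms(2)] by (simp add: d_def)
    moreover have "ip x x = of_real a"
      using ip_self_real[OF assms(1)] by (simp add: a_def)
    ultimately have "0 \<le> Re (of_real a + ?s * b + cnj ?s * cnj b + cnj ?s * ?s * of_real d)"
      by metis
    then show ?thesis
      unfolding cmod_power2 by (simp add: power2_eq_square algebra_simps)
  qed
  have ad: "a \<ge> 0" "d \<ge> 0"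
    using assms ip_nonneg by (auto simp: a_def d_def)
  show ?thesis
  proof (cases "d = 0")
    case True
    have "b = 0"
    proof (rule ccontr)
      assume "b \<noteq> 0"
      then have "(cmod b)\<^sup>2 > 0" by simp
      \<comment> \<open>For d = 0 the quadratic is affine in \<open>t\<close>; at this
        \<open>t\<close> its value would be -1.\<close>
      then have "2 * ((a + 1) / (2 * (cmod b)\<^sup>2)) * (cmod b)\<^sup>2 = a + 1" by simp
      with quad[of "(a + 1) / (2 * (cmod b)\<^sup>2)"] True show False by simp
    qed
    then show ?thesis using ad by (simp add: b_def a_def d_def)
  next
    case False
    then have "d > 0" using ad by simp
    with quad[of "1 / d"] have "a - (cmod b)\<^sup>2 / d \<ge> 0"
      by (simp add: power2_eq_square field_simps)
    then have "(cmod b)\<^sup>2 \<le> a * d" using \<open>d > 0\<close> by (simp add: field_simps)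
    then show ?thesis by (simp add: b_def a_def d_def)
  qed
qed

text \<open>Substitute for definiteness: a vector of norm zero is invisible to every inner product,
  so statements made through inner products need no quotient space.\<close>

lemma ip_null:
  assumes "x \<in> C" "y \<in> C" "Re (ip y y) = 0"
  shows "ip x y = 0" "ip y x = 0"
proof -
  show "ip x y = 0" using cauchy_schwarz[OF assms(1,2)] assms(3) by simp
  then show "ip y x = 0" using ip_commute[OF assms(1,2)] by simp
qed

definition hn :: "'c \<Rightarrow> real" where
  "hn x = sqrt (Re (ip x x))"

lemma hn_nonneg: "x \<in> C \<Longrightarrow> hn x \<ge> 0"
  by (simp add: hn_def ip_nonneg)

lemma hn_power2: "x \<in> C \<Longrightarrow> (hn x)\<^sup>2 = Re (ip x x)"
  by (simp add: hn_def ip_nonneg)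

lemma cmod_ip_le: "x \<in> C \<Longrightarrow> y \<in> C \<Longrightarrow> cmod (ip x y) \<le> hn x * hn y"
  using cauchy_schwarz[of x y]
  by (simp add: hn_def real_sqrt_mult[symmetric] real_le_rsqrt)

lemma hn_triangle:
  assumes "x \<in> C" "y \<in> C"
  shows "hn (pl x y) \<le> hn x + hn y"
proof (rule power2_le_imp_le)
  have "Re (ip x y) \<le> hn x * hn y" "Re (ip y x) \<le> hn x * hn y"
    using cmod_ip_le[OF assms] cmod_ip_le[OF assms(2,1)] complex_Re_le_cmod order_trans
    by (metis mult.commute)+
  then show "(hn (pl x y))\<^sup>2 \<le> (hn x + hn y)\<^sup>2"
    using assms by (simp add: hn_power2 ip_expand power2_sum)
qed (use assms hn_nonneg in auto)

lemma hn_smult: "x \<in> C \<Longrightarrow> hn (sm c x) = cmod c * hn x"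
proof -
  assume x: "x \<in> C"
  then have "ip (sm c x) (sm c x) = of_real ((cmod c)\<^sup>2) * ip x x"
    by (simp add: ip_expand complex_norm_square mult_ac del: of_real_power)
  then show ?thesis by (simp add: hn_def real_sqrt_mult)
qed

section \<open>Subspaces, Gram-Schmidt and eigenbases up to null vectors\<close>

definition subspace :: "'c set \<Rightarrow> bool" where
  "subspace S \<longleftrightarrow> S \<noteq> {} \<and> S \<subseteq> C \<and> (\<forall>x\<in>S. \<forall>y\<in>S. pl x y \<in> S) \<and> (\<forall>c. \<forall>x\<in>S. sm c x \<in> S)"

lemma subspace_C: "subspace C"
  by (simp add: subspace_def nonempty pl_closed sm_closed)

text \<open>No vector space laws are assumed for \<open>pl\<close> and \<open>sm\<close>, so there
  are no finite sums in \<open>C\<close>. What is produced is an element that every functional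
  \<open>ip x\<close> sees as the sum. A multiple by 0 plays the role of the zero vector.\<close>

lemma lincomb_in:
  fixes v :: "'k \<Rightarrow> 'c" and c :: "'k \<Rightarrow> complex"
  assumes S: "subspace S" and "finite K" "\<And>k. k \<in> K \<Longrightarrow> v k \<in> S"
  shows "\<exists>y\<in>S. \<forall>x\<in>C. ip x y = (\<Sum>k\<in>K. c k * ip x (v k))"
  using assms(2,3)
proof (induction K rule: finite_induct)
  case empty
  obtain s where "s \<in> S" "s \<in> C" using S by (auto simp: subspace_def)
  then show ?case
    using S by (intro bexI[of _ "sm 0 s"]) (auto simp: subspace_def ip_smult_right)
next
  case (insert k K)
  then obtain y where y: "y \<in> S" "\<forall>x\<in>C. ip x y = (\<Sum>k\<in>K. c k * ip x (v k))"
    by auto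
  then have "y \<in> C" "v k \<in> S" "v k \<in> C" using S insert.prems by (auto simp: subspace_def)
  then show ?case
    using y insert.hyps S
    by (intro bexI[of _ "pl (sm (c k) (v k)) y"])
      (auto simp: subspace_def ip_add_right ip_smult_right sm_closed)
qed

lemma lincomb:
  fixes v :: "'k \<Rightarrow> 'c" and c :: "'k \<Rightarrow> complex"
  assumes "finite K" "\<And>k. k \<in> K \<Longrightarrow> v k \<in> C"
  obtains y where "y \<in> C" "\<And>x. x \<in> C \<Longrightarrow> ip x y = (\<Sum>k\<in>K. c k * ip x (v k))"
    "\<And>x. x \<in> C \<Longrightarrow> ip y x = (\<Sum>k\<in>K. cnj (c k) * ip (v k) x)"
proof -
  obtain y where y: "y \<in> C" "\<And>x. x \<in> C \<Longrightarrow> ip x y = (\<Sum>k\<in>K. c k * ip x (v k))"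
    using lincomb_in[OF subspace_C assms(1), of v c] assms(2) by blast
  moreover have "ip y x = (\<Sum>k\<in>K. cnj (c k) * ip (v k) x)" if "x \<in> C" for x
  proof -
    have "ip y x = cnj (\<Sum>k\<in>K. c k * ip x (v k))"
      using y that ip_commute by metis
    also have "\<dots> = (\<Sum>k\<in>K. cnj (c k) * ip (v k) x)"
      using that assms(2) by (simp add: cnj_ip)
    finally show ?thesis .
  qed
  ultimately show ?thesis using that by blast
qed

text \<open>The double sum is the squared norm of the combination. This is the source of the
  positivity clause of \<open>tracial_moments\<close> in the matrix, C*-algebra and synchronous
  models.\<close>

lemma gram_nonneg:
  fixes v :: "'k \<Rightarrow> 'c" and c :: "'k \<Rightarrow> real"
  assumes "finite K" "\<And>k. k \<in> K \<Longrightarrow> v k \<in> C"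
  shows "0 \<le> (\<Sum>k\<in>K. \<Sum>l\<in>K. c k * c l * Re (ip (v k) (v l)))"
proof -
  obtain y where y: "y \<in> C"
    "\<And>x. x \<in> C \<Longrightarrow> ip x y = (\<Sum>l\<in>K. of_real (c l) * ip x (v l))"
    "\<And>x. x \<in> C \<Longrightarrow> ip y x = (\<Sum>k\<in>K. cnj (of_real (c k)) * ip (v k) x)"
    using lincomb[of K v "\<lambda>k. of_real (c k)"] assms by blast
  have "ip y y = (\<Sum>k\<in>K. of_real (c k) * ip (v k) y)"
    using y(1) y(3)[of y] by simp
  also have "\<dots> = (\<Sum>k\<in>K. of_real (c k) * (\<Sum>l\<in>K. of_real (c l) * ip (v k) (v l)))"
    using y(2) assms(2) by simp
  finally have "Re (ip y y) = (\<Sum>k\<in>K. \<Sum>l\<in>K. c k * c l * Re (ip (v k) (v l)))"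
    by (simp add: sum_distrib_left mult.assoc)
  then show ?thesis using ip_nonneg[OF y(1)] by simp
qed

definition orthonormal :: "nat \<Rightarrow> (nat \<Rightarrow> 'c) \<Rightarrow> bool" where
  "orthonormal n g \<longleftrightarrow> (\<forall>i<n. g i \<in> C) \<and>
     (\<forall>i<n. \<forall>j<n. ip (g i) (g j) = (if i = j then 1 else 0))"

text \<open>For orthonormal \<open>g\<close> this says that \<open>y\<close> lies in the span of
  \<open>g\<close> up to a null vector.\<close>

definition expands :: "nat \<Rightarrow> (nat \<Rightarrow> 'c) \<Rightarrow> 'c \<Rightarrow> bool" where
  "expands n g y \<longleftrightarrow> (\<forall>x\<in>C. ip x y = (\<Sum>k<n. ip x (g k) * ip (g k) y))"

text \<open>The normalization shared by Gram-Schmidt and by the enlargement of a family of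
  eigenvectors.\<close>

lemma orthonormal_extend:
  assumes S: "subspace S" and g: "orthonormal n g" "\<And>k. k < n \<Longrightarrow> g k \<in> S"
    and y: "y \<in> S" and perp: "\<And>k. k < n \<Longrightarrow> ip (g k) y = 0" and pos: "Re (ip y y) \<noteq> 0"
  defines "u \<equiv> sm (of_real (1 / sqrt (Re (ip y y)))) y"
  shows "orthonormal (Suc n) (g(n := u))" "u \<in> S"
proof -
  have yC: "y \<in> C" using S y by (auto simp: subspace_def)
  show uS: "u \<in> S" using S y by (auto simp: subspace_def u_def)
  have uC: "u \<in> C" using S uS by (auto simp: subspace_def)
  have gt: "Re (ip y y) > 0" using ip_nonneg[OF yC] pos by linarith
  have "ip u u = of_real (1 / sqrt (Re (ip y y)) * (1 / sqrt (Re (ip y y)))) * ip y y"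
    using yC by (simp only: u_def ip_expand of_real_mult complex_cnj_complex_of_real mult_ac)
  also have "\<dots> = of_real (1 / sqrt (Re (ip y y)) * (1 / sqrt (Re (ip y y))) * Re (ip y y))"
    by (subst ip_self_real[OF yC]) simp
  also have "1 / sqrt (Re (ip y y)) * (1 / sqrt (Re (ip y y))) * Re (ip y y) = 1"
    using gt by (simp add: field_simps)
  finally have uu: "ip u u = 1" by simp
  have gu: "ip (g k) u = 0" if "k < n" for k
    using that perp yC g(1) by (simp add: u_def ip_expand orthonormal_def)
  have ug: "ip u (g k) = 0" if "k < n" for k
    using gu[OF that] ip_commute[of "g k" u] uC that g(1) by (simp add: orthonormal_def)
  show "orthonormal (Suc n) (g(n := u))"
    using g uC uu gu ug by (auto simp: orthonormal_def less_Suc_eq)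
qed

lemma residual:
  assumes g: "orthonormal n g" "\<And>k. k < n \<Longrightarrow> g k \<in> S" and S: "subspace S" and "b \<in> S"
  obtains y where "y \<in> S" "\<And>x. x \<in> C \<Longrightarrow> ip x y = ip x b - (\<Sum>k<n. ip (g k) b * ip x (g k))"
    "\<And>k. k < n \<Longrightarrow> ip (g k) y = 0"
proof -
  have bC: "b \<in> C" using assms by (auto simp: subspace_def)
  obtain p where p: "p \<in> S" "\<And>x. x \<in> C \<Longrightarrow> ip x p = (\<Sum>k<n. ip (g k) b * ip x (g k))"
    using lincomb_in[OF S, of "{..<n}" g "\<lambda>k. ip (g k) b"] g by auto
  have pC: "p \<in> C" using p S by (auto simp: subspace_def)
  define y where "y = pl b (sm (-1) p)"
  have y: "ip x y = ip x b - (\<Sum>k<n. ip (g k) b * ip x (g k))" if "x \<in> C" for x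
    using that p bC pC by (simp add: y_def ip_expand)
  have "ip (g k) y = 0" if "k < n" for k
  proof -
    have "(\<Sum>j<n. ip (g j) b * ip (g k) (g j)) = (\<Sum>j<n. if k = j then ip (g j) b else 0)"
      using that g(1) by (intro sum.cong) (auto simp: orthonormal_def)
    also have "\<dots> = ip (g k) b" using that by simp
    finally show ?thesis using y[of "g k"] that g(1) by (simp add: orthonormal_def)
  qed
  moreover have "y \<in> S" using S p(1) assms(4) by (auto simp: y_def subspace_def)
  ultimately show ?thesis using y that by blast
qed

text \<open>The residual of a new vector is either null, and then the vector is already expanded, or
  it is normalized and appended. The family stays in \<open>S\<close>, which allows bases of an
  orthogonal complement or of the range of a projection.\<close>

lemma gram_schmidt_in:
  assumes S: "subspace S" and "finite B" "B \<subseteq> S"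
  shows "\<exists>n g. orthonormal n g \<and> (\<forall>k<n. g k \<in> S) \<and> (\<forall>b\<in>B. expands n g b)"
  using assms(2,3)
proof (induction B rule: finite_induct)
  case empty
  show ?case by (rule exI[of _ 0]) (auto simp: orthonormal_def)
next
  case (insert b B)
  then obtain n g where g: "orthonormal n g" "\<And>k. k < n \<Longrightarrow> g k \<in> S"
    "\<And>b. b \<in> B \<Longrightarrow> expands n g b" by auto
  have b: "b \<in> S" and BC: "B \<subseteq> C" using insert.prems S by (auto simp: subspace_def)
  obtain y where y: "y \<in> S" "\<And>x. x \<in> C \<Longrightarrow> ip x y = ip x b - (\<Sum>k<n. ip (g k) b * ip x (g k))"
    "\<And>k. k < n \<Longrightarrow> ip (g k) y = 0"
    using residual[OF g(1,2) S b] by blast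
  have yC: "y \<in> C" and bC: "b \<in> C" using y b S by (auto simp: subspace_def)
  show ?case
  proof (cases "Re (ip y y) = 0")
    case True
    then have "expands n g b"
      using y(2) ip_null(1)[OF _ yC True] by (force simp: expands_def mult.commute)
    then show ?thesis using g by blast
  next
    case False
    define r where "r = Re (ip y y)"
    define u where "u = sm (of_real (1 / sqrt r)) y"
    have ext: "orthonormal (Suc n) (g(n := u))" "u \<in> S"
      using orthonormal_extend[OF S g(1,2) y(1,3) False] by (auto simp: u_def r_def)
    have uC: "u \<in> C" using ext(2) S by (auto simp: subspace_def)
    have gC: "g k \<in> C" if "k < n" for k using that g(1) by (auto simp: orthonormal_def)
    have exp: "expands (Suc n) (g(n := u)) z
        \<longleftrightarrow> (\<forall>x\<in>C. ip x z = (\<Sum>k<n. ip x (g k) * ip (g k) z) + ip x u * ip u z)" for z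
      by (simp add: expands_def)
    \<comment> \<open>Vectors already expanded by \<open>g\<close> are orthogonal to
      \<open>u\<close>, so the extra term of the longer expansion vanishes for them.\<close>
    have "ip u z = 0" if "z \<in> B" for z
    proof -
      have "ip u z = (\<Sum>k<n. ip u (g k) * ip (g k) z)"
        using g(3)[OF that] uC by (simp add: expands_def)
      also have "\<dots> = 0"
      proof (rule sum.neutral, safe)
        fix k assume "k < n"
        then show "ip u (g k) * ip (g k) z = 0"
          using y(3)[of k] ip_commute[OF gC yC, of k] yC gC by (simp add: u_def ip_expand)
      qed
      finally show ?thesis .
    qed
    then have "expands (Suc n) (g(n := u)) z" if "z \<in> B" for z
      using g(3)[OF that] that unfolding exp by (auto simp: expands_def)
    moreover have "expands (Suc n) (g(n := u)) b"
      unfolding exp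
    proof
      fix x assume x: "x \<in> C"
      \<comment> \<open>The difference between \<open>b\<close> and its residual \<open>y\<close> is
        a combination of \<open>g\<close>, to which \<open>y\<close> is orthogonal.\<close>
      have yb: "ip y b = ip y y"
      proof -
        have "ip y y = ip y b - (\<Sum>k<n. ip (g k) b * ip y (g k))" using y(2) yC .
        moreover have "ip y (g k) = 0" if "k < n" for k
          using y(3)[OF that] ip_commute[OF gC[OF that] yC] by simp
        ultimately show ?thesis by simp
      qed
      have rpos: "r > 0" using ip_nonneg[OF yC] False by (simp add: r_def)
      have "ip x u * ip u b = of_real (1 / sqrt r * (1 / sqrt r)) * (ip x y * ip y b)"
        using x yC bC by (simp only: u_def ip_expand of_real_mult complex_cnj_complex_of_real mult_ac)
      also have "1 / sqrt r * (1 / sqrt r) = 1 / r" using rpos by simp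
      also have "ip y b = of_real r" using yb ip_self_real[OF yC] by (simp add: r_def)
      finally have "ip x u * ip u b = ip x y" using rpos by simp
      then show "ip x b = (\<Sum>k<n. ip x (g k) * ip (g k) b) + ip x u * ip u b"
        using y(2)[OF x] by (simp add: mult.commute)
    qed
    ultimately show ?thesis
      using ext g(2)
      by (intro exI[of _ "Suc n"] exI[of _ "g(n := u)"]) (auto simp: less_Suc_eq simp del: fun_upd_apply, auto)
  qed
qed

definition onb :: "nat \<Rightarrow> (nat \<Rightarrow> 'c) \<Rightarrow> bool" where
  "onb n g \<longleftrightarrow> orthonormal n g \<and> (\<forall>y\<in>C. expands n g y)"

lemma onb_closed: "onb n g \<Longrightarrow> k < n \<Longrightarrow> g k \<in> C"
  by (simp add: onb_def orthonormal_def)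

lemma parseval: "onb n g \<Longrightarrow> x \<in> C \<Longrightarrow> y \<in> C \<Longrightarrow> ip x y = (\<Sum>k<n. ip x (g k) * ip (g k) y)"
  by (simp add: onb_def expands_def)

lemma bessel:
  assumes "orthonormal n g" "x \<in> C"
  shows "(\<Sum>k<n. (cmod (ip (g k) x))\<^sup>2) \<le> Re (ip x x)"
proof -
  have gC: "k < n \<Longrightarrow> g k \<in> C" for k using assms by (auto simp: orthonormal_def)
  obtain y where y: "y \<in> C" "\<And>z. z \<in> C \<Longrightarrow> ip z y = ip z x - (\<Sum>k<n. ip (g k) x * ip z (g k))"
    "\<And>k. k < n \<Longrightarrow> ip (g k) y = 0"
    using residual[OF assms(1) gC subspace_C assms(2)] by blast
  have "ip y (g k) = 0" if "k < n" for k
    using y(3)[OF that] ip_commute[OF gC[OF that] y(1)] by simp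
  then have "ip y y = ip y x" using y(2)[OF y(1)] by simp
  also have "ip y x = cnj (ip x y)" using ip_commute assms y by blast
  finally have "Re (ip y y) = Re (ip x y)" by simp
  also have "ip x y = ip x x - (\<Sum>k<n. of_real ((cmod (ip (g k) x))\<^sup>2))"
    using y(2)[OF assms(2)] ip_mult_swap[OF gC assms(2)] by simp
  finally have "Re (ip y y) = Re (ip x x) - (\<Sum>k<n. (cmod (ip (g k) x))\<^sup>2)"
    by simp
  then show ?thesis using ip_nonneg[OF y(1)] by simp
qed

text \<open>An orthonormal family of eigenvectors of maximal size exists because its size is bounded
  by \<open>n\<close>. Its orthogonal complement \<open>S\<close> is invariant under
  \<open>T\<close>, so a non-null vector of \<open>S\<close> would yield a further eigenvector. The
  input from matrix theory is the existence of an eigenvalue of a complex matrix of positive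
  size.\<close>

lemma hermitian_eigenbasis:
  assumes e: "onb n e"
    and T: "\<And>x. x \<in> C \<Longrightarrow> T x \<in> C" and herm: "\<And>x y. \<lbrakk>x \<in> C; y \<in> C\<rbrakk> \<Longrightarrow> ip x (T y) = ip (T x) y"
  obtains m f and \<gamma> :: "nat \<Rightarrow> real" where "onb m f"
    "\<And>k x. \<lbrakk>k < m; x \<in> C\<rbrakk> \<Longrightarrow> ip x (T (f k)) = of_real (\<gamma> k) * ip x (f k)"
proof -
  define Q where "Q m f (\<gamma> :: nat \<Rightarrow> real) \<longleftrightarrow> orthonormal m f \<and>
    (\<forall>k<m. \<forall>x\<in>C. ip x (T (f k)) = of_real (\<gamma> k) * ip x (f k))" for m f \<gamma>
  have eC: "e k \<in> C" if "k < n" for k using that e by (rule onb_closed[rotated])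
  \<comment> \<open>Double counting of the squared moduli of \<open>ip (f b) (e k)\<close>: summing
    over \<open>k\<close> is Parseval for \<open>f b\<close>, summing over \<open>b\<close> is
    Bessel for \<open>e k\<close>.\<close>
  have bound: "m \<le> n" if "Q m f \<gamma>" for m f \<gamma>
  proof -
    have f: "orthonormal m f" using that by (simp add: Q_def)
    then have fC: "b < m \<Longrightarrow> f b \<in> C" for b by (simp add: orthonormal_def)
    have "real m = Re (\<Sum>b<m. ip (f b) (f b))" using f by (simp add: orthonormal_def)
    also have "(\<Sum>b<m. ip (f b) (f b)) = (\<Sum>b<m. \<Sum>k<n. ip (f b) (e k) * ip (e k) (f b))"
      using parseval[OF e] fC by simp
    also have "\<dots> = (\<Sum>b<m. \<Sum>k<n. of_real ((cmod (ip (f b) (e k)))\<^sup>2))"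
      using fC eC ip_mult_swap by simp
    also have "\<dots> = (\<Sum>k<n. \<Sum>b<m. of_real ((cmod (ip (f b) (e k)))\<^sup>2))" by (rule sum.swap)
    also have "Re \<dots> \<le> (\<Sum>k<n. Re (ip (e k) (e k)))"
      unfolding Re_sum using bessel[OF f] eC by (intro sum_mono) simp
    also have "\<dots> = real n" using e by (simp add: onb_def orthonormal_def)
    finally show ?thesis by simp
  qed
  have "\<exists>f \<gamma>. Q 0 f \<gamma>" by (simp add: Q_def orthonormal_def)
  then obtain m where "\<exists>f \<gamma>. Q m f \<gamma>" and max: "\<And>m' f \<gamma>. Q m' f \<gamma> \<Longrightarrow> m' \<le> m"
    using GreatestI_ex_nat[of "\<lambda>m. \<exists>f \<gamma>. Q m f \<gamma>" n] Greatest_le_nat[of "\<lambda>m. \<exists>f \<gamma>. Q m f \<gamma>" _ n]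
      bound by (metis (mono_tags, lifting))
  then obtain f \<gamma> where Q: "Q m f \<gamma>" by blast
  have f: "orthonormal m f" and fC: "\<And>b. b < m \<Longrightarrow> f b \<in> C"
    and eig: "\<And>k x. \<lbrakk>k < m; x \<in> C\<rbrakk> \<Longrightarrow> ip x (T (f k)) = of_real (\<gamma> k) * ip x (f k)"
    using Q by (auto simp: Q_def orthonormal_def)
  define S where "S = {x \<in> C. \<forall>b<m. ip (f b) x = 0}"
  have "sm 0 (SOME x. x \<in> C) \<in> S"
    using nonempty fC by (auto simp: S_def ip_smult_right sm_closed some_in_eq)
  then have S: "subspace S"
    unfolding subspace_def using fC by (auto simp: S_def ip_expand)
  \<comment> \<open>The residuals \<open>e'\<close> of the basis \<open>e\<close> generate
    \<open>S\<close>; orthonormalizing them inside \<open>S\<close> gives a basis \<open>g\<close>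
    of \<open>S\<close> with \<open>p\<close> members.\<close>
  have "\<exists>y\<in>S. \<forall>x\<in>C. ip x y = ip x (e k) - (\<Sum>b<m. ip (f b) (e k) * ip x (f b))" if "k < n" for k
  proof -
    obtain y where "y \<in> C" "\<And>x. x \<in> C \<Longrightarrow> ip x y = ip x (e k) - (\<Sum>b<m. ip (f b) (e k) * ip x (f b))"
      "\<And>b. b < m \<Longrightarrow> ip (f b) y = 0"
      using residual[OF f fC subspace_C eC[OF \<open>k < n\<close>]] by blast
    then show ?thesis by (auto simp: S_def intro!: bexI[of _ y])
  qed
  then obtain e' where e': "\<And>k. k < n \<Longrightarrow> e' k \<in> S"
    "\<And>k x. \<lbrakk>k < n; x \<in> C\<rbrakk> \<Longrightarrow> ip x (e' k) = ip x (e k) - (\<Sum>b<m. ip (f b) (e k) * ip x (f b))"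
    by metis
  have "e' ` {..<n} \<subseteq> S" using e' by auto
  then obtain p g where g: "orthonormal p g" "\<And>a. a < p \<Longrightarrow> g a \<in> S"
    "\<And>k. k < n \<Longrightarrow> expands p g (e' k)"
    using gram_schmidt_in[OF S, of "e' ` {..<n}"] by (auto simp del: image_subset_iff)
  have SC: "s \<in> S \<Longrightarrow> s \<in> C" for s by (simp add: S_def)
  have gC: "a < p \<Longrightarrow> g a \<in> C" for a using g(2) SC by blast
  have ee': "ip (e k) s = ip (e' k) s" if "k < n" "s \<in> S" for k s
  proof -
    have "ip s (f b) = 0" if "b < m" for b
      using \<open>s \<in> S\<close> that ip_commute[of "f b" s] fC by (auto simp: S_def)
    then have "ip s (e' k) = ip s (e k)" using e'(2)[of k s] that SC by simp
    then show ?thesis using ip_commute SC eC e' that by metis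
  qed
  have expS: "ip x s = (\<Sum>a<p. ip x (g a) * ip (g a) s)" if "x \<in> C" "s \<in> S" for x s
  proof -
    have eks: "ip (e k) s = (\<Sum>a<p. ip (e k) (g a) * ip (g a) s)" if "k < n" for k
    proof -
      have "ip (e k) s = cnj (ip s (e' k))"
        using ee' that \<open>s \<in> S\<close> ip_commute SC e' by metis
      also have "\<dots> = cnj (\<Sum>a<p. ip s (g a) * ip (g a) (e' k))"
        using g(3)[OF that] SC \<open>s \<in> S\<close> by (simp add: expands_def)
      also have "\<dots> = (\<Sum>a<p. ip (g a) s * ip (e' k) (g a))"
        using gC SC e'(1) \<open>s \<in> S\<close> that by (simp add: cnj_ip mult.commute)
      also have "\<dots> = (\<Sum>a<p. ip (e k) (g a) * ip (g a) s)"
        using ee' that g(2) by (simp add: mult.commute)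
      finally show ?thesis .
    qed
    have "ip x s = (\<Sum>k<n. ip x (e k) * ip (e k) s)" using parseval[OF e] that SC by simp
    also have "\<dots> = (\<Sum>k<n. \<Sum>a<p. ip x (e k) * ip (e k) (g a) * ip (g a) s)"
      using eks by (simp add: sum_distrib_left mult.assoc)
    also have "\<dots> = (\<Sum>a<p. \<Sum>k<n. ip x (e k) * ip (e k) (g a) * ip (g a) s)" by (rule sum.swap)
    also have "\<dots> = (\<Sum>a<p. ip x (g a) * ip (g a) s)"
      using parseval[OF e \<open>x \<in> C\<close> gC] by (simp add: sum_distrib_right)
    finally show ?thesis .
  qed
  have TS: "T s \<in> S" if "s \<in> S" for s
  proof -
    have "ip (f b) (T s) = 0" if "b < m" for b
    proof -
      have "ip (f b) (T s) = cnj (ip s (T (f b)))"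
        using herm ip_commute fC SC T \<open>s \<in> S\<close> that by metis
      also have "ip s (T (f b)) = of_real (\<gamma> b) * cnj (ip (f b) s)"
        using eig[OF that SC] \<open>s \<in> S\<close> ip_commute[OF fC[OF that] SC] by simp
      finally show ?thesis using \<open>s \<in> S\<close> that by (simp add: S_def)
    qed
    then show ?thesis using SC T that by (simp add: S_def)
  qed
  have "p = 0"
  proof (rule ccontr)
    assume p: "p \<noteq> 0"
    \<comment> \<open>\<open>G\<close> is the compression of \<open>T\<close> to \<open>S\<close>.
      Since \<open>T\<close> maps \<open>S\<close> to itself, an eigenvector of \<open>G\<close>
      lifts to an eigenvector of \<open>T\<close> in \<open>S\<close>.\<close>
    define G where "G = mat p p (\<lambda>(a, b). ip (g a) (T (g b)))"
    have G: "G \<in> carrier_mat p p" by (simp add: G_def)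
    obtain \<mu> v where v: "v \<in> carrier_vec p" "v \<noteq> 0\<^sub>v p" "G *\<^sub>v v = \<mu> \<cdot>\<^sub>v v"
      using spectrum_non_empty[OF G] p G
      unfolding spectrum_def eigenvalue_def eigenvector_def by auto
    obtain y where y: "y \<in> S" "\<And>x. x \<in> C \<Longrightarrow> ip x y = (\<Sum>a<p. v $ a * ip x (g a))"
      using lincomb_in[OF S, of "{..<p}" g "\<lambda>a. v $ a"] g(2) by auto
    have yC: "y \<in> C" using y SC by blast
    have gy: "ip (g a) y = v $ a" if "a < p" for a
    proof -
      have "(\<Sum>b<p. v $ b * ip (g a) (g b)) = (\<Sum>b<p. if a = b then v $ b else 0)"
        using that g(1) by (intro sum.cong) (auto simp: orthonormal_def)
      then show ?thesis using y(2)[OF gC[OF that]] that by simp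
    qed
    have gTy: "ip (g a) (T y) = \<mu> * v $ a" if "a < p" for a
    proof -
      have "ip (g a) (T y) = (\<Sum>b<p. v $ b * ip (T (g a)) (g b))"
        using herm[OF gC[OF that] yC] y(2)[OF T[OF gC[OF that]]] by simp
      also have "\<dots> = (\<Sum>b<p. G $$ (a, b) * v $ b)"
        using that herm[OF gC[OF that] gC] by (simp add: G_def mult.commute)
      also have "\<dots> = (G *\<^sub>v v) $ a"
        using that v(1) G by (auto simp: scalar_prod_def atLeast0LessThan)
      also have "\<dots> = \<mu> * v $ a" using v that by simp
      finally show ?thesis .
    qed
    have Ty: "ip x (T y) = \<mu> * ip x y" if "x \<in> C" for x
    proof -
      have "ip x (T y) = (\<Sum>a<p. ip x (g a) * ip (g a) (T y))"
        using expS[OF that TS[OF y(1)]] .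
      also have "\<dots> = \<mu> * (\<Sum>a<p. v $ a * ip x (g a))"
        using gTy by (simp add: sum_distrib_left algebra_simps)
      finally show ?thesis using y(2)[OF that] by simp
    qed
    obtain a where a: "a < p" "v $ a \<noteq> 0" using v(1,2) by (auto simp: vec_eq_iff)
    have pos: "Re (ip y y) \<noteq> 0"
      using gy[OF a(1)] a(2) ip_null(1)[OF gC[OF a(1)] yC] by auto
    \<comment> \<open>Hermitian \<open>T\<close> has real diagonal values, and \<open>y\<close> is
      not null, so the eigenvalue is real.\<close>
    have "\<mu> * ip y y = cnj (\<mu> * ip y y)"
      using Ty[OF yC] herm[OF yC yC] ip_commute[OF T[OF yC] yC]
      by (metis complex_cnj_cnj)
    then have "Im (\<mu> * ip y y) = 0" by (metis Reals_cnj_iff complex_is_Real_iff)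
    then have "Im \<mu> * Re (ip y y) = 0"
      by (subst (asm) ip_self_real[OF yC]) simp
    then have mu: "\<mu> = of_real (Re \<mu>)"
      using pos by (simp add: complex_eq_iff)
    define u where "u = sm (of_real (1 / sqrt (Re (ip y y)))) y"
    have perp: "\<And>k. k < m \<Longrightarrow> ip (f k) y = 0" using y(1) by (simp add: S_def)
    have ext: "orthonormal (Suc m) (f(m := u))" "u \<in> C"
      using orthonormal_extend[OF subspace_C f fC yC perp pos] by (auto simp: u_def)
    have Tu: "ip x (T u) = of_real (Re \<mu>) * ip x u" if "x \<in> C" for x
    proof -
      have "ip x (T u) = ip (T x) u" using herm that ext by blast
      also have "\<dots> = of_real (1 / sqrt (Re (ip y y))) * ip x (T y)"
        using that T yC herm by (simp add: u_def ip_smult_right)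
      also have "\<dots> = of_real (Re \<mu>) * ip x u"
        using Ty[OF that] mu that yC by (simp add: u_def ip_smult_right)
      finally show ?thesis .
    qed
    have "Q (Suc m) (f(m := u)) (\<gamma>(m := Re \<mu>))"
      using ext Tu eig by (auto simp: Q_def less_Suc_eq)
    then show False using max by fastforce
  qed
  \<comment> \<open>An empty basis of \<open>S\<close> makes all residuals null, so \<open>f\<close>
    expands every \<open>e k\<close> and with them every vector.\<close>
  then have e0: "ip x (e' k) = 0" if "k < n" "x \<in> C" for k x
    using g(3)[of k] that by (simp add: expands_def)
  have "ip x y = (\<Sum>b<m. ip x (f b) * ip (f b) y)" if "x \<in> C" "y \<in> C" for x y
  proof -
    have xe: "ip x (e k) = (\<Sum>b<m. ip (f b) (e k) * ip x (f b))" if "k < n" for k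
      using e0[OF that \<open>x \<in> C\<close>] e'(2)[OF that \<open>x \<in> C\<close>] by simp
    have "ip x y = (\<Sum>k<n. \<Sum>b<m. ip x (f b) * (ip (f b) (e k) * ip (e k) y))"
      using parseval[OF e that] xe by (simp add: sum_distrib_left mult_ac)
    also have "\<dots> = (\<Sum>b<m. ip x (f b) * (\<Sum>k<n. ip (f b) (e k) * ip (e k) y))"
      by (subst sum.swap) (simp add: sum_distrib_left)
    also have "\<dots> = (\<Sum>b<m. ip x (f b) * ip (f b) y)"
      using parseval[OF e] fC that by simp
    finally show ?thesis .
  qed
  then have "onb m f" using f by (simp add: onb_def expands_def)
  then show ?thesis using that eig by blast
qed

end

section \<open>Completion of a C*-seminorm\<close>

lemma cring_complex_ring: "cring complex_ring"
proof (rule cringI)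
  show "abelian_group complex_ring"
    by (rule abelian_groupI) (auto simp: complex_ring_def intro: exI[of _ "- _"])
  show "Group.comm_monoid complex_ring"
    by (rule comm_monoidI) (auto simp: complex_ring_def)
qed (auto simp: complex_ring_def algebra_simps)

text \<open>The complex scalars are given by a central embedding \<open>\<kappa>\<close>, so that the module laws are
  instances of the ring laws.\<close>

locale complex_star_ring =
  fixes \<kappa> :: "complex \<Rightarrow> 'r :: ring_1" and st :: "'r \<Rightarrow> 'r"
  assumes \<kappa>_add: "\<kappa> (a + b) = \<kappa> a + \<kappa> b"
    and \<kappa>_mult: "\<kappa> (a * b) = \<kappa> a * \<kappa> b"
    and \<kappa>_one: "\<kappa> 1 = 1"
    and \<kappa>_central: "x * \<kappa> c = \<kappa> c * x"
    and st_st: "st (st x) = x"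
    and st_add: "st (x + y) = st x + st y"
    and st_mult: "st (x * y) = st y * st x"
    and st_\<kappa>: "st (\<kappa> c) = \<kappa> (cnj c)"
begin

lemma \<kappa>_zero: "\<kappa> 0 = 0"
  using \<kappa>_add[of 0 0] by simp

lemma \<kappa>_minus_one: "\<kappa> (- 1) * x = - x"
proof -
  have "\<kappa> (- 1) + \<kappa> 1 = 0" using \<kappa>_add[of "- 1" 1] by (simp add: \<kappa>_zero)
  then show ?thesis by (simp add: \<kappa>_one add_eq_0_iff2)
qed

lemma st_minus: "st (x - y) = st x - st y"
  using st_add[of "x - y" y] by simp

lemma st_one: "st 1 = 1"
  using st_\<kappa>[of 1] by (simp add: \<kappa>_one)

lemma st_zero: "st 0 = 0"
  using st_minus[of 0 0] by simp

lemma st_sum: "st (sum f K) = (\<Sum>k\<in>K. st (f k))"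
  by (induction K rule: infinite_finite_induct) (simp_all add: st_zero st_add)

end

text \<open>\<open>N\<close> may vanish on nonzero elements. Identifying Cauchy sequences at
  distance zero completes the ring and divides by the kernel of \<open>N\<close> at once.\<close>

locale cstar_seminorm = complex_star_ring \<kappa> st
  for \<kappa> :: "complex \<Rightarrow> 'r :: ring_1" and st :: "'r \<Rightarrow> 'r" +
  fixes N :: "'r \<Rightarrow> real"
  assumes N_triangle: "N (x + y) \<le> N x + N y"
    and N_\<kappa>: "N (\<kappa> c * x) = cmod c * N x"
    and N_mult: "N (x * y) \<le> N x * N y"
    and N_star_mult: "N (st x * x) = (N x)\<^sup>2"
begin

lemma N_zero: "N 0 = 0"
  using N_\<kappa>[of 0 0] by (simp add: \<kappa>_zero)

lemma N_minus: "N (- x) = N x"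
  using N_\<kappa>[of "- 1" x] by (simp add: \<kappa>_minus_one)

lemma N_minus_commute: "N (x - y) = N (y - x)"
  using N_minus[of "x - y"] by simp

lemma N_nonneg: "N x \<ge> 0"
  using N_triangle[of x "- x"] by (simp add: N_zero N_minus)

lemma N_triangle_sub: "N (x - z) \<le> N (x - y) + N (y - z)"
  using N_triangle[of "x - y" "y - z"] by simp

lemma N_sub_le: "\<bar>N x - N y\<bar> \<le> N (x - y)"
  using N_triangle[of "x - y" y] N_triangle[of "y - x" x] N_minus_commute[of x y] by simp

lemma N_st: "N (st x) = N x"
proof -
  have le: "N x \<le> N (st x)" for x
  proof (cases "N x = 0")
    case False
    have "N x * N x \<le> N (st x) * N x"
      using N_mult[of "st x" x] by (simp add: N_star_mult power2_eq_square)
    with False N_nonneg[of x] show ?thesis by simp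
  qed (simp add: N_nonneg)
  show ?thesis using le[of x] le[of "st x"] by (simp add: st_st)
qed

definition Cau :: "(nat \<Rightarrow> 'r) \<Rightarrow> bool" where
  "Cau s \<longleftrightarrow> (\<forall>e>0. \<exists>M. \<forall>m\<ge>M. \<forall>n\<ge>M. N (s m - s n) < e)"

definition eqv :: "(nat \<Rightarrow> 'r) \<Rightarrow> (nat \<Rightarrow> 'r) \<Rightarrow> bool" where
  "eqv s t \<longleftrightarrow> (\<lambda>n. N (s n - t n)) \<longlonglongrightarrow> 0"

lemma CauD: "Cau s \<Longrightarrow> e > 0 \<Longrightarrow> \<exists>M. \<forall>m\<ge>M. \<forall>n\<ge>M. N (s m - s n) < e"
  by (simp add: Cau_def)

lemma Cau_const: "Cau (\<lambda>_. r)"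
  by (simp add: Cau_def N_zero)

text \<open>One estimate behind sums, scalar multiples and products. Dividing by
  \<open>K + 1\<close> instead of \<open>K\<close> covers K = 0.\<close>

lemma Cau_dominated:
  assumes s: "Cau s" and t: "Cau t" and K: "K \<ge> 0"
    and le: "\<And>m n. N (u m - u n) \<le> K * (N (s m - s n) + N (t m - t n))"
  shows "Cau u"
  unfolding Cau_def
proof (intro allI impI)
  fix e :: real assume "e > 0"
  then have e: "e / (2 * (K + 1)) > 0" using K by simp
  obtain M1 where M1: "\<And>m n. m \<ge> M1 \<Longrightarrow> n \<ge> M1 \<Longrightarrow> N (s m - s n) < e / (2 * (K + 1))"
    using CauD[OF s e] by blast
  obtain M2 where M2: "\<And>m n. m \<ge> M2 \<Longrightarrow> n \<ge> M2 \<Longrightarrow> N (t m - t n) < e / (2 * (K + 1))"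
    using CauD[OF t e] by blast
  have "N (u m - u n) < e" if "m \<ge> max M1 M2" "n \<ge> max M1 M2" for m n
  proof -
    have "N (s m - s n) + N (t m - t n) < e / (K + 1)"
      using M1[of m n] M2[of m n] that K by (simp add: field_simps)
    then have "(K + 1) * (N (s m - s n) + N (t m - t n)) < e"
      using K by (simp add: field_simps)
    moreover have "N (u m - u n) \<le> (K + 1) * (N (s m - s n) + N (t m - t n))"
      using le[of m n] N_nonneg[of "s m - s n"] N_nonneg[of "t m - t n"]
      by (simp add: distrib_right)
    ultimately show ?thesis by linarith
  qed
  then show "\<exists>M. \<forall>m\<ge>M. \<forall>n\<ge>M. N (u m - u n) < e" by blast
qed

lemma eqv_dominated:
  assumes s: "eqv s s'" and t: "eqv t t'"
    and le: "\<And>n. N (u n - u' n) \<le> K * (N (s n - s' n) + N (t n - t' n))"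
  shows "eqv u u'"
  unfolding eqv_def
proof (rule tendsto_sandwich[OF _ _ tendsto_const])
  show "(\<lambda>n. K * (N (s n - s' n) + N (t n - t' n))) \<longlonglongrightarrow> 0"
    using s t unfolding eqv_def by (auto intro!: tendsto_eq_intros)
qed (auto simp: N_nonneg le)

lemma Cau_N_convergent: "Cau s \<Longrightarrow> convergent (\<lambda>n. N (s n))"
proof (rule real_Cauchy_convergent, rule metric_CauchyI)
  fix e :: real assume "Cau s" "e > 0"
  then obtain M where "\<forall>m\<ge>M. \<forall>n\<ge>M. N (s m - s n) < e" using CauD by blast
  then show "\<exists>M. \<forall>m\<ge>M. \<forall>n\<ge>M. dist (N (s m)) (N (s n)) < e"
    by (metis N_sub_le dist_real_def le_less_trans)
qed

lemma Cau_bounded: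
  assumes "Cau s"
  obtains K where "K \<ge> 0" "\<And>n. N (s n) \<le> K"
proof -
  obtain K where "K > 0" "\<And>n. norm (N (s n)) \<le> K"
    using convergent_imp_Bseq[OF Cau_N_convergent[OF assms]] unfolding Bseq_def by blast
  then show ?thesis using that[of K] by (metis abs_le_D1 less_imp_le real_norm_def)
qed

lemma N_mult_diff: "N (a * b - a' * b') \<le> N a * N (b - b') + N (a - a') * N b'"
proof -
  have "a * b - a' * b' = a * (b - b') + (a - a') * b'" by (simp add: algebra_simps)
  then show ?thesis using N_triangle N_mult by (metis add_mono order_trans)
qed

lemma Cau_add: "Cau s \<Longrightarrow> Cau t \<Longrightarrow> Cau (\<lambda>n. s n + t n)"
  by (rule Cau_dominated[of s t 1]) (auto simp: add_diff_add N_triangle)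

lemma Cau_\<kappa>: "Cau s \<Longrightarrow> Cau (\<lambda>n. \<kappa> c * s n)"
  by (rule Cau_dominated[of s s "cmod c"])
    (auto simp: N_\<kappa> right_diff_distrib[symmetric] N_nonneg mult_left_mono)

lemma Cau_st: "Cau s \<Longrightarrow> Cau (\<lambda>n. st (s n))"
  by (simp add: Cau_def st_minus[symmetric] N_st)

lemma Cau_mult:
  assumes "Cau s" "Cau t"
  shows "Cau (\<lambda>n. s n * t n)"
proof -
  obtain K where K: "K \<ge> 0" "\<And>n. N (s n) \<le> K" using Cau_bounded[OF assms(1)] by blast
  obtain L where L: "L \<ge> 0" "\<And>n. N (t n) \<le> L" using Cau_bounded[OF assms(2)] by blast
  show ?thesis
  proof (rule Cau_dominated[OF assms, of "max K L"])
    fix m n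
    have "N (s m * t m - s n * t n) \<le> N (s m) * N (t m - t n) + N (s m - s n) * N (t n)"
      by (rule N_mult_diff)
    also have "\<dots> \<le> max K L * N (t m - t n) + N (s m - s n) * max K L"
      using K L N_nonneg by (intro add_mono mult_mono) (auto simp: le_max_iff_disj)
    finally show "N (s m * t m - s n * t n) \<le> max K L * (N (s m - s n) + N (t m - t n))"
      by (simp add: algebra_simps)
  qed (use K in simp)
qed

lemma eqv_refl: "eqv s s"
  by (simp add: eqv_def N_zero)

lemma eqv_sym: "eqv s t \<Longrightarrow> eqv t s"
  by (simp add: eqv_def N_minus_commute)

lemma eqv_trans: "eqv s t \<Longrightarrow> eqv t u \<Longrightarrow> eqv s u"
  by (rule eqv_dominated[of s t t u s u 1]) (auto simp: N_triangle_sub)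

lemma eqv_add: "eqv s s' \<Longrightarrow> eqv t t' \<Longrightarrow> eqv (\<lambda>n. s n + t n) (\<lambda>n. s' n + t' n)"
  by (rule eqv_dominated[of s s' t t' _ _ 1]) (auto simp: add_diff_add N_triangle)

lemma eqv_\<kappa>: "eqv s s' \<Longrightarrow> eqv (\<lambda>n. \<kappa> c * s n) (\<lambda>n. \<kappa> c * s' n)"
  by (rule eqv_dominated[of s s' s s' _ _ "cmod c"])
    (auto simp: N_\<kappa> right_diff_distrib[symmetric] N_nonneg mult_left_mono)

lemma eqv_st: "eqv s s' \<Longrightarrow> eqv (\<lambda>n. st (s n)) (\<lambda>n. st (s' n))"
  by (simp add: eqv_def st_minus[symmetric] N_st)

text \<open>\<open>N_mult_diff\<close> multiplies the differences by terms of \<open>s\<close> and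
  of \<open>t'\<close>, so these are the two sequences that have to be bounded, hence
  Cauchy.\<close>

lemma eqv_mult:
  assumes "eqv s s'" "eqv t t'" "Cau s" "Cau t'"
  shows "eqv (\<lambda>n. s n * t n) (\<lambda>n. s' n * t' n)"
proof -
  obtain K where K: "K \<ge> 0" "\<And>n. N (s n) \<le> K" using Cau_bounded[OF assms(3)] by blast
  obtain L where L: "L \<ge> 0" "\<And>n. N (t' n) \<le> L" using Cau_bounded[OF assms(4)] by blast
  show ?thesis
  proof (rule eqv_dominated[OF assms(1,2), of _ _ "max K L"])
    fix n
    have "N (s n * t n - s' n * t' n) \<le> N (s n) * N (t n - t' n) + N (s n - s' n) * N (t' n)"
      by (rule N_mult_diff)
    also have "\<dots> \<le> max K L * N (t n - t' n) + N (s n - s' n) * max K L"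
      using K L N_nonneg by (intro add_mono mult_mono) (auto simp: le_max_iff_disj)
    finally show "N (s n * t n - s' n * t' n) \<le> max K L * (N (s n - s' n) + N (t n - t' n))"
      by (simp add: algebra_simps)
  qed
qed

text \<open>Functions that are 1-Lipschitz for \<open>N\<close> have limits depending only on the
  class of a sequence. It serves for \<open>N\<close> itself, giving the norm, and for \<tau>,
  giving the tracial state.\<close>

lemma eqv_lim:
  fixes f :: "'r \<Rightarrow> 'b :: real_normed_vector"
  assumes f: "\<And>x y. norm (f x - f y) \<le> N (x - y)" and "eqv s t" "(\<lambda>n. f (s n)) \<longlonglongrightarrow> l"
  shows "(\<lambda>n. f (t n)) \<longlonglongrightarrow> l"
proof -
  have "(\<lambda>n. f (t n) - f (s n)) \<longlonglongrightarrow> 0"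
    by (rule tendsto_0_le[OF eqv_sym[OF assms(2), unfolded eqv_def], of _ 1])
      (use f N_nonneg in auto)
  from tendsto_add[OF this assms(3)] show ?thesis by simp
qed

end

locale cstar_completion = cstar_seminorm \<kappa> st N
  for \<kappa> :: "complex \<Rightarrow> 'r :: ring_1" and st :: "'r \<Rightarrow> 'r" and N :: "'r \<Rightarrow> real" +
  fixes J :: "(nat \<Rightarrow> 'r) \<Rightarrow> 'u"
  assumes inj_J: "inj J"
begin

text \<open>Elements of the algebra must have the prescribed type \<open>'u\<close>. A class is
  encoded as the image under \<open>J\<close> of a chosen representative; equivalent sequences have
  the same predicate \<open>eqv s\<close>, hence the same choice.\<close>

definition cls :: "(nat \<Rightarrow> 'r) \<Rightarrow> 'u" where
  "cls s = J (SOME t. eqv s t)"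

lemma cls_eq: "cls s = cls t \<longleftrightarrow> eqv s t"
proof
  assume "cls s = cls t"
  then have "(SOME u. eqv s u) = (SOME u. eqv t u)" using inj_J by (simp add: cls_def inj_eq)
  then show "eqv s t"
    using someI[of "eqv s", OF eqv_refl] someI[of "eqv t", OF eqv_refl] eqv_sym eqv_trans by metis
next
  assume "eqv s t"
  then have "eqv s = eqv t" using eqv_sym eqv_trans by blast
  then show "cls s = cls t" by (simp add: cls_def)
qed

definition dec :: "'u \<Rightarrow> nat \<Rightarrow> 'r" where
  "dec x = (SOME s. Cau s \<and> cls s = x)"

lemma dec: "x \<in> cls ` Collect Cau \<Longrightarrow> Cau (dec x) \<and> cls (dec x) = x"
proof -
  assume "x \<in> cls ` Collect Cau"
  then have ex: "\<exists>s. Cau s \<and> cls s = x" by auto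
  show ?thesis unfolding dec_def by (rule someI_ex[OF ex])
qed

lemma dec_cls: "Cau s \<Longrightarrow> Cau (dec (cls s)) \<and> eqv (dec (cls s)) s"
  using dec[of "cls s"] by (auto simp: cls_eq)

definition A :: "'u star_algebra" where
  "A = \<lparr>carrier = cls ` Collect Cau,
        monoid.mult = (\<lambda>x y. cls (\<lambda>n. dec x n * dec y n)),
        one = cls (\<lambda>_. 1),
        zero = cls (\<lambda>_. 0),
        add = (\<lambda>x y. cls (\<lambda>n. dec x n + dec y n)),
        module.smult = (\<lambda>c x. cls (\<lambda>n. \<kappa> c * dec x n)),
        star = (\<lambda>x. cls (\<lambda>n. st (dec x n))),
        nrm = (\<lambda>x. lim (\<lambda>n. N (dec x n)))\<rparr>"

lemma cls_closed: "Cau s \<Longrightarrow> cls s \<in> carrier A"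
  by (auto simp: A_def)

lemma carrierE:
  assumes "x \<in> carrier A"
  obtains s where "Cau s" "x = cls s"
  using assms by (auto simp: A_def)

lemma one_A: "\<one>\<^bsub>A\<^esub> = cls (\<lambda>_. 1)" and zero_A: "\<zero>\<^bsub>A\<^esub> = cls (\<lambda>_. 0)"
  by (simp_all add: A_def)

lemma add_cls: "Cau s \<Longrightarrow> Cau t \<Longrightarrow> cls s \<oplus>\<^bsub>A\<^esub> cls t = cls (\<lambda>n. s n + t n)"
  by (simp add: A_def cls_eq eqv_add dec_cls)

lemma mult_cls: "Cau s \<Longrightarrow> Cau t \<Longrightarrow> cls s \<otimes>\<^bsub>A\<^esub> cls t = cls (\<lambda>n. s n * t n)"
  by (simp add: A_def cls_eq eqv_mult dec_cls)

lemma smult_cls: "Cau s \<Longrightarrow> c \<odot>\<^bsub>A\<^esub> cls s = cls (\<lambda>n. \<kappa> c * s n)"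
  by (simp add: A_def cls_eq eqv_\<kappa> dec_cls)

lemma star_cls: "Cau s \<Longrightarrow> star A (cls s) = cls (\<lambda>n. st (s n))"
  by (simp add: A_def cls_eq eqv_st dec_cls)

lemma nrm_cls:
  assumes "Cau s"
  shows "(\<lambda>n. N (s n)) \<longlonglongrightarrow> nrm A (cls s)"
proof (rule eqv_lim[where s = "dec (cls s)"])
  show "(\<lambda>n. N (dec (cls s) n)) \<longlonglongrightarrow> nrm A (cls s)"
    using Cau_N_convergent dec_cls[OF assms] by (simp add: A_def convergent_LIMSEQ_iff)
qed (use dec_cls[OF assms] N_sub_le in auto)

lemma nrm_cls_eqI: "Cau s \<Longrightarrow> (\<lambda>n. N (s n)) \<longlonglongrightarrow> l \<Longrightarrow> nrm A (cls s) = l"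
  by (rule LIMSEQ_unique[OF nrm_cls])

lemmas cls_ops = cls_closed one_A zero_A add_cls mult_cls smult_cls star_cls
  Cau_const Cau_add Cau_mult Cau_\<kappa> Cau_st

lemma abelian_group_A: "abelian_group A"
proof (rule abelian_groupI)
  fix x assume "x \<in> carrier A"
  then obtain s where s: "Cau s" "x = cls s" by (rule carrierE)
  then show "\<exists>y\<in>carrier A. y \<oplus>\<^bsub>A\<^esub> x = \<zero>\<^bsub>A\<^esub>"
    using Cau_\<kappa>[of s "- 1"]
    by (intro bexI[of _ "cls (\<lambda>n. - s n)"]) (auto simp: cls_ops \<kappa>_minus_one)
qed (auto elim!: carrierE simp: cls_ops add_ac)

lemma ring_A: "ring A"
proof (rule ringI[OF abelian_group_A])
  show "Group.monoid A"
    by (rule monoidI) (auto elim!: carrierE simp: cls_ops mult_ac mult.assoc)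
qed (auto elim!: carrierE simp: cls_ops algebra_simps)

lemma module_A: "module complex_ring A"
  by (rule moduleI[OF cring_complex_ring abelian_group_A])
    (auto elim!: carrierE simp: cls_ops complex_ring_def \<kappa>_add \<kappa>_mult \<kappa>_one algebra_simps)

lemma minus_cls:
  assumes "Cau s" "Cau t"
  shows "cls s \<ominus>\<^bsub>A\<^esub> cls t = cls (\<lambda>n. s n - t n)" "Cau (\<lambda>n. s n - t n)"
proof -
  interpret ring A by (rule ring_A)
  have mt: "Cau (\<lambda>n. - t n)" using Cau_\<kappa>[OF assms(2), of "- 1"] by (simp add: \<kappa>_minus_one)
  have "\<ominus>\<^bsub>A\<^esub> cls t = cls (\<lambda>n. - t n)"
    using assms mt by (intro minus_equality) (auto simp: cls_ops)
  then show "cls s \<ominus>\<^bsub>A\<^esub> cls t = cls (\<lambda>n. s n - t n)"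
    using assms mt by (simp add: a_minus_def cls_ops)
  show "Cau (\<lambda>n. s n - t n)" using Cau_add[OF assms(1) mt] by simp
qed

text \<open>Diagonal argument: \<open>p n\<close> is a term of the sequence representing
  \<open>s n\<close>, taken so late that later terms differ from it by less than 1 / (n + 1). Then
  \<open>p\<close> is Cauchy and its class is the limit.\<close>

lemma complete_A:
  assumes s: "\<And>n. s n \<in> carrier A"
    and cauchy: "\<And>e. e > 0 \<Longrightarrow> \<exists>M. \<forall>m\<ge>M. \<forall>n\<ge>M. nrm A (s m \<ominus>\<^bsub>A\<^esub> s n) < e"
  shows "\<exists>x\<in>carrier A. (\<lambda>n. nrm A (s n \<ominus>\<^bsub>A\<^esub> x)) \<longlonglongrightarrow> 0"
proof -
  have "\<forall>n. \<exists>t. Cau t \<and> s n = cls t" using s carrierE by metis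
  then obtain \<sigma> where \<sigma>: "\<And>n. Cau (\<sigma> n)" "\<And>n. s n = cls (\<sigma> n)" by metis
  have "\<exists>k. \<forall>i\<ge>k. \<forall>j\<ge>k. N (\<sigma> n i - \<sigma> n j) < 1 / real (Suc n)" for n
    using CauD[OF \<sigma>(1), of "1 / real (Suc n)" n] by simp
  then obtain k where k: "\<And>n i j. i \<ge> k n \<Longrightarrow> j \<ge> k n \<Longrightarrow> N (\<sigma> n i - \<sigma> n j) < 1 / real (Suc n)"
    by metis
  define p where "p n = \<sigma> n (k n)" for n
  have \<sigma>p: "N (\<sigma> n i - p n) < 1 / real (Suc n)" if "i \<ge> k n" for n i
    using k[OF that] by (simp add: p_def)
  have small: "\<exists>M. \<forall>n\<ge>M. 1 / real (Suc n) < e" if "e > 0" for e :: real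
  proof -
    obtain M where "inverse (real (Suc M)) < e" using reals_Archimedean \<open>e > 0\<close> by blast
    moreover have "1 / real (Suc n) \<le> inverse (real (Suc M))" if "n \<ge> M" for n
      using that by (simp add: inverse_eq_divide frac_le)
    ultimately show ?thesis by (meson le_less_trans)
  qed
  have "Cau p"
    unfolding Cau_def
  proof (intro allI impI)
    fix e :: real assume "e > 0"
    then have e3: "e / 3 > 0" by simp
    obtain M1 where M1: "\<And>n. n \<ge> M1 \<Longrightarrow> 1 / real (Suc n) < e / 3" using small[OF e3] by blast
    obtain M2 where M2: "\<And>m n. m \<ge> M2 \<Longrightarrow> n \<ge> M2 \<Longrightarrow> nrm A (s m \<ominus>\<^bsub>A\<^esub> s n) < e / 3"
      using cauchy[OF e3] by blast
    have "N (p m - p n) < e" if mn: "m \<ge> max M1 M2" "n \<ge> max M1 M2" for m n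
    proof -
      \<comment> \<open>The norm of a difference is the limit of \<open>N\<close> along
        representatives, so one late index \<open>i\<close> compares \<open>p m\<close> with
        \<open>p n\<close> through \<open>\<sigma> m i\<close> and
        \<open>\<sigma> n i\<close>.\<close>
      have "(\<lambda>i. N (\<sigma> m i - \<sigma> n i)) \<longlonglongrightarrow> nrm A (s m \<ominus>\<^bsub>A\<^esub> s n)"
        using nrm_cls minus_cls \<sigma> by metis
      then have "eventually (\<lambda>i. N (\<sigma> m i - \<sigma> n i) < e / 3) sequentially"
        using M2 mn by (intro order_tendstoD) auto
      then have "eventually (\<lambda>i. N (\<sigma> m i - \<sigma> n i) < e / 3 \<and> i \<ge> k m \<and> i \<ge> k n) sequentially"
        by (intro eventually_conj eventually_ge_at_top)
      then obtain i where i: "N (\<sigma> m i - \<sigma> n i) < e / 3" "i \<ge> k m" "i \<ge> k n"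
        using eventually_happens' by (metis (mono_tags, lifting) sequentially_bot)
      have "N (p m - p n) \<le> N (p m - \<sigma> m i) + (N (\<sigma> m i - \<sigma> n i) + N (\<sigma> n i - p n))"
        using N_triangle_sub[of "p m" "p n" "\<sigma> m i"] N_triangle_sub[of "\<sigma> m i" "p n" "\<sigma> n i"]
        by linarith
      also have "\<dots> < e"
        using \<sigma>p[OF i(2)] \<sigma>p[OF i(3)] M1[of m] M1[of n] mn i(1) N_minus_commute[of "p m" "\<sigma> m i"]
        by simp
      finally show ?thesis .
    qed
    then show "\<exists>M. \<forall>m\<ge>M. \<forall>n\<ge>M. N (p m - p n) < e" by blast
  qed
  have "(\<lambda>n. nrm A (s n \<ominus>\<^bsub>A\<^esub> cls p)) \<longlonglongrightarrow> 0"
  proof (rule metric_LIMSEQ_I)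
    fix e :: real assume "e > 0"
    then have e2: "e / 3 > 0" by simp
    obtain M1 where M1: "\<And>n. n \<ge> M1 \<Longrightarrow> 1 / real (Suc n) < e / 3" using small[OF e2] by blast
    obtain M2 where M2: "\<And>m n. m \<ge> M2 \<Longrightarrow> n \<ge> M2 \<Longrightarrow> N (p m - p n) < e / 3"
      using CauD[OF \<open>Cau p\<close> e2] by blast
    have "dist (nrm A (s n \<ominus>\<^bsub>A\<^esub> cls p)) 0 < e" if n: "n \<ge> max M1 M2" for n
    proof -
      have lim: "(\<lambda>i. N (\<sigma> n i - p i)) \<longlonglongrightarrow> nrm A (s n \<ominus>\<^bsub>A\<^esub> cls p)"
        using nrm_cls minus_cls \<sigma> \<open>Cau p\<close> by metis
      \<comment> \<open>A strict bound would become weak in the limit over \<open>i\<close>, so 2e/3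
        is aimed at instead of e.\<close>
      have "N (\<sigma> n i - p i) \<le> 2 * e / 3" if "i \<ge> max (k n) M2" for i
      proof -
        have "N (\<sigma> n i - p i) \<le> N (\<sigma> n i - p n) + N (p n - p i)" by (rule N_triangle_sub)
        also have "\<dots> \<le> 2 * e / 3" using \<sigma>p[of n i] M1[of n] M2[of n i] n that by simp
        finally show ?thesis .
      qed
      then have "nrm A (s n \<ominus>\<^bsub>A\<^esub> cls p) \<le> 2 * e / 3"
        by (intro LIMSEQ_le_const2[OF lim] exI[of _ "max (k n) M2"]) blast
      moreover have "nrm A (s n \<ominus>\<^bsub>A\<^esub> cls p) \<ge> 0"
        by (rule LIMSEQ_le_const[OF lim]) (simp add: N_nonneg)
      ultimately show ?thesis using \<open>e > 0\<close> by (simp add: dist_real_def)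
    qed
    then show "\<exists>M. \<forall>n\<ge>M. dist (nrm A (s n \<ominus>\<^bsub>A\<^esub> cls p)) 0 < e" by blast
  qed
  then show ?thesis using cls_closed[OF \<open>Cau p\<close>] by blast
qed

lemma cstar_A: "unital_cstar_algebra A"
proof (rule unital_cstar_algebra.intro[OF ring_A module_A], unfold_locales)
  fix x y c assume "x \<in> carrier A" "y \<in> carrier A"
  then obtain s t where st: "Cau s" "x = cls s" "Cau t" "y = cls t" by (elim carrierE) blast
  show "c \<odot>\<^bsub>A\<^esub> x \<otimes>\<^bsub>A\<^esub> y = c \<odot>\<^bsub>A\<^esub> (x \<otimes>\<^bsub>A\<^esub> y)"
    using st by (simp add: cls_ops mult.assoc)
  show "x \<otimes>\<^bsub>A\<^esub> (c \<odot>\<^bsub>A\<^esub> y) = c \<odot>\<^bsub>A\<^esub> (x \<otimes>\<^bsub>A\<^esub> y)"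
    using st \<kappa>_central by (simp add: cls_ops mult.assoc[symmetric])
  show "star A (x \<oplus>\<^bsub>A\<^esub> y) = star A x \<oplus>\<^bsub>A\<^esub> star A y"
    using st by (simp add: cls_ops st_add)
  show "star A (x \<otimes>\<^bsub>A\<^esub> y) = star A y \<otimes>\<^bsub>A\<^esub> star A x"
    using st by (simp add: cls_ops st_mult)
  show "nrm A (x \<oplus>\<^bsub>A\<^esub> y) \<le> nrm A x + nrm A y"
    using st N_triangle
    by (auto simp: cls_ops intro!: LIMSEQ_le[OF nrm_cls tendsto_add[OF nrm_cls nrm_cls]])
  show "nrm A (x \<otimes>\<^bsub>A\<^esub> y) \<le> nrm A x * nrm A y"
    using st N_mult
    by (auto simp: cls_ops intro!: LIMSEQ_le[OF nrm_cls tendsto_mult[OF nrm_cls nrm_cls]])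
next
  fix x c assume "x \<in> carrier A"
  then obtain s where s: "Cau s" "x = cls s" by (rule carrierE)
  show "star A x \<in> carrier A" using s by (simp add: cls_ops)
  show "star A (star A x) = x" using s by (simp add: cls_ops st_st)
  show "star A (c \<odot>\<^bsub>A\<^esub> x) = cnj c \<odot>\<^bsub>A\<^esub> star A x"
    using s \<kappa>_central by (simp add: cls_ops st_mult st_\<kappa>)
  show "(nrm A x = 0) = (x = \<zero>\<^bsub>A\<^esub>)"
  proof -
    have "nrm A (cls s) = 0 \<longleftrightarrow> (\<lambda>n. N (s n)) \<longlonglongrightarrow> 0"
      using nrm_cls[OF s(1)] nrm_cls_eqI[OF s(1)] by metis
    then show ?thesis by (simp add: s(2) zero_A cls_eq eqv_def)
  qed
  show "nrm A (c \<odot>\<^bsub>A\<^esub> x) = cmod c * nrm A x"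
    unfolding s(2) smult_cls[OF s(1)]
    by (rule nrm_cls_eqI[OF Cau_\<kappa>[OF s(1)]])
      (simp only: N_\<kappa>, rule tendsto_mult_left[OF nrm_cls[OF s(1)]])
  show "nrm A (star A x \<otimes>\<^bsub>A\<^esub> x) = (nrm A x)\<^sup>2"
    unfolding s(2) star_cls[OF s(1)] mult_cls[OF Cau_st[OF s(1)] s(1)]
    by (rule nrm_cls_eqI[OF Cau_mult[OF Cau_st[OF s(1)] s(1)]])
      (simp only: N_star_mult, rule tendsto_power[OF nrm_cls[OF s(1)]])
qed (use complete_A in blast)

end

text \<open>The bound by \<open>N\<close> makes \<tau> continuous, so it extends to classes and its
  properties pass to limits; \<open>\<iota>\<close> sends an element to the constant sequence.
  Elements at \<open>N\<close>-distance zero get the same image, which turns relations valid up to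
  the seminorm into equations.\<close>

theorem (in cstar_seminorm) completion:
  fixes J :: "(nat \<Rightarrow> 'r) \<Rightarrow> 'u" and \<tau> :: "'r \<Rightarrow> complex"
  assumes "inj J"
    and \<tau>_add: "\<And>x y. \<tau> (x + y) = \<tau> x + \<tau> y" and \<tau>_\<kappa>: "\<And>c x. \<tau> (\<kappa> c * x) = c * \<tau> x"
    and \<tau>_le: "\<And>x. cmod (\<tau> x) \<le> N x" and \<tau>_one: "\<tau> 1 = 1"
    and \<tau>_pos: "\<And>x. \<tau> (st x * x) \<in> \<real>\<^sub>\<ge>\<^sub>0" and \<tau>_comm: "\<And>x y. \<tau> (x * y) = \<tau> (y * x)"
  obtains A :: "'u star_algebra" and tr \<iota>
  where "unital_cstar_algebra A" "tracial_state A tr" "\<And>r. \<iota> r \<in> carrier A"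
    "\<And>r. star A (\<iota> r) = \<iota> (st r)" "\<And>r s. \<iota> r \<otimes>\<^bsub>A\<^esub> \<iota> s = \<iota> (r * s)"
    "\<And>r. tr (\<iota> r) = \<tau> r" "\<And>r s. N (r - s) = 0 \<Longrightarrow> \<iota> r = \<iota> s" "\<iota> 0 = \<zero>\<^bsub>A\<^esub>"
proof -
  interpret cstar_completion \<kappa> st N J by unfold_locales (rule assms)
  define tr where "tr x = lim (\<lambda>n. \<tau> (dec x n))" for x
  have \<tau>_diff: "cmod (\<tau> x - \<tau> y) \<le> N (x - y)" for x y
    using \<tau>_le[of "x - y"] \<tau>_add[of "x - y" y] by simp
  have tr_cls: "(\<lambda>n. \<tau> (s n)) \<longlonglongrightarrow> tr (cls s)" if s: "Cau s" for s
  proof (rule eqv_lim[where s = "dec (cls s)"])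
    have "Cauchy (\<lambda>n. \<tau> (dec (cls s) n))"
    proof (rule metric_CauchyI)
      fix e :: real assume "e > 0"
      then obtain M where "\<forall>m\<ge>M. \<forall>n\<ge>M. N (dec (cls s) m - dec (cls s) n) < e"
        using CauD dec_cls[OF s] by blast
      then show "\<exists>M. \<forall>m\<ge>M. \<forall>n\<ge>M. dist (\<tau> (dec (cls s) m)) (\<tau> (dec (cls s) n)) < e"
        by (metis \<tau>_diff dist_norm le_less_trans)
    qed
    then show "(\<lambda>n. \<tau> (dec (cls s) n)) \<longlonglongrightarrow> tr (cls s)"
      by (simp add: tr_def convergent_LIMSEQ_iff[symmetric] Cauchy_convergent_iff)
  qed (use dec_cls[OF s] \<tau>_diff in auto)
  have tr_eqI: "tr (cls s) = l" if "Cau s" "(\<lambda>n. \<tau> (s n)) \<longlonglongrightarrow> l" for s l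
    using tr_cls[OF that(1)] that(2) LIMSEQ_unique by blast
  have closed: "l \<in> \<real>\<^sub>\<ge>\<^sub>0" if lim: "f \<longlonglongrightarrow> l" and f: "\<And>n. f n \<in> \<real>\<^sub>\<ge>\<^sub>0" for f and l :: complex
  proof -
    have "Re l \<ge> 0"
      using LIMSEQ_le_const[OF tendsto_Re[OF lim]] f by (auto simp: complex_nonneg_Reals_iff)
    moreover have "Im l = 0"
      using LIMSEQ_unique[OF tendsto_Im[OF lim], of 0] f by (simp add: complex_nonneg_Reals_iff)
    ultimately show ?thesis by (simp add: complex_nonneg_Reals_iff)
  qed
  have "tracial_state A tr"
    unfolding tracial_state_def
  proof (intro conjI ballI allI)
    fix x y assume "x \<in> carrier A" "y \<in> carrier A"
    then obtain s t where st: "Cau s" "x = cls s" "Cau t" "y = cls t" by (elim carrierE) blast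
    show "tr (x \<oplus>\<^bsub>A\<^esub> y) = tr x + tr y"
      using st by (auto simp: cls_ops \<tau>_add intro!: tr_eqI tendsto_add tr_cls)
    show "tr (x \<otimes>\<^bsub>A\<^esub> y) = tr (y \<otimes>\<^bsub>A\<^esub> x)"
      using st tr_cls[of "\<lambda>n. t n * s n"] \<tau>_comm by (auto simp: cls_ops intro!: tr_eqI)
  next
    fix c x assume "x \<in> carrier A"
    then obtain s where s: "Cau s" "x = cls s" by (rule carrierE)
    show "tr (c \<odot>\<^bsub>A\<^esub> x) = c * tr x"
      using s by (auto simp: cls_ops \<tau>_\<kappa> intro!: tr_eqI tendsto_mult_left tr_cls)
  next
    fix x assume "x \<in> carrier A"
    then obtain s where s: "Cau s" "x = cls s" by (rule carrierE)
    show "tr (star A x \<otimes>\<^bsub>A\<^esub> x) \<in> \<real>\<^sub>\<ge>\<^sub>0"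
      using s closed[OF tr_cls[of "\<lambda>n. st (s n) * s n"]] \<tau>_pos
      by (auto simp: cls_ops)
  next
    show "tr \<one>\<^bsub>A\<^esub> = 1" by (auto simp: cls_ops \<tau>_one intro!: tr_eqI)
  qed
  moreover have "tr (cls (\<lambda>_. r)) = \<tau> r" for r by (auto intro!: tr_eqI Cau_const)
  moreover have "cls (\<lambda>_. r) = cls (\<lambda>_. s)" if "N (r - s) = 0" for r s
    using that by (simp add: cls_eq eqv_def)
  ultimately show ?thesis
    using that[of A tr "\<lambda>r. cls (\<lambda>_. r)"] cstar_A by (simp add: cls_ops)
qed

section \<open>Tracial star-algebras\<close>

text \<open>Input of the GNS construction: \<tau> is positive and tracial, but it may have a kernel
  and \<open>\<tau> 1\<close> may be any nonnegative number.\<close>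

locale tracial_star_algebra = complex_star_ring \<kappa> st
  for \<kappa> :: "complex \<Rightarrow> 'r :: ring_1" and st :: "'r \<Rightarrow> 'r" +
  fixes \<tau> :: "'r \<Rightarrow> complex"
  assumes \<tau>_add: "\<tau> (x + y) = \<tau> x + \<tau> y"
    and \<tau>_\<kappa>: "\<tau> (\<kappa> c * x) = c * \<tau> x"
    and \<tau>_comm: "\<tau> (x * y) = \<tau> (y * x)"
    and \<tau>_st: "\<tau> (st x) = cnj (\<tau> x)"
    and \<tau>_pos: "Re (\<tau> (st x * x)) \<ge> 0"
begin

abbreviation ip :: "'r \<Rightarrow> 'r \<Rightarrow> complex" where
  "ip x y \<equiv> \<tau> (st x * y)"

sublocale gns: semi_inner UNIV "(+)" "\<lambda>c x. \<kappa> c * x" ip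
proof
  fix c x y
  show "ip x (\<kappa> c * y) = c * ip x y"
    using \<tau>_\<kappa>[of c "st x * y"] by (metis \<kappa>_central mult.assoc)
  show "ip y x = cnj (ip x y)"
    using \<tau>_st[of "st x * y"] by (simp add: st_mult st_st)
qed (simp_all add: distrib_left \<tau>_add \<tau>_pos)

lemma ip_mult_left: "ip x (y * z) = ip (st y * x) z"
  by (simp add: st_mult st_st mult.assoc)

lemma ip_cyclic: "ip x (q * x) = \<tau> (q * (x * st x))"
  using \<tau>_comm[of "st x" "q * x"] by (simp add: mult.assoc)

lemma \<tau>_zero: "\<tau> 0 = 0"
  using \<tau>_add[of 0 0] by simp

lemma \<tau>_sum: "\<tau> (sum f K) = (\<Sum>k\<in>K. \<tau> (f k))"
  by (induction K rule: infinite_finite_induct) (simp_all add: \<tau>_zero \<tau>_add)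

lemma parseval: "gns.onb n e \<Longrightarrow> ip x y = (\<Sum>k<n. ip x (e k) * ip (e k) y)"
  by (rule gns.parseval) auto

text \<open>The trace of left multiplication by \<open>q\<close> does not depend on the basis:
  expand in \<open>f\<close>, exchange the sums, contract over \<open>e\<close>.\<close>

lemma ip_sum_in_onb:
  assumes e: "gns.onb n e" and f: "gns.onb m f"
  shows "(\<Sum>k<n. ip (e k) (q * e k)) = (\<Sum>j<m. ip (f j) (q * f j))"
proof -
  have "(\<Sum>k<n. ip (e k) (q * e k)) = (\<Sum>k<n. \<Sum>j<m. ip (e k) (f j) * ip (st q * f j) (e k))"
    by (subst parseval[OF f]) (simp add: ip_mult_left)
  also have "\<dots> = (\<Sum>j<m. \<Sum>k<n. ip (st q * f j) (e k) * ip (e k) (f j))"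
    by (subst sum.swap) (simp add: mult.commute)
  also have "\<dots> = (\<Sum>j<m. ip (f j) (q * f j))"
    by (simp only: parseval[OF e, symmetric] ip_mult_left)
  finally show ?thesis .
qed

text \<open>The element \<open>c = \<Sum>k. e\<^sub>k * e\<^sub>k\<^sup>*\<close> represents the trace of left multiplications. Since it is
  central, the eigenspaces of left multiplication by \<open>c\<close> are invariant under the algebra, and \<open>\<tau>\<close>
  is the trace of left multiplications weighted by the inverse eigenvalues. This replaces the
  decomposition of a finite-dimensional algebra into matrix blocks.\<close>

theorem finite_dimensional_decomposition:
  assumes B: "finite B" and span: "\<And>r. \<exists>c. \<forall>x. ip x r = (\<Sum>b\<in>B. c b * ip x b)"
  obtains n f and z :: "nat \<Rightarrow> real" where "gns.onb n f" "\<And>k. k < n \<Longrightarrow> z k > 0"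
    "\<And>q. \<tau> q = (\<Sum>k<n. of_real (z k) * ip (f k) (q * f k))"
    "\<And>q j k. j < n \<Longrightarrow> k < n \<Longrightarrow> ip (f j) (q * f k) \<noteq> 0 \<Longrightarrow> z j = z k"
proof -
  obtain n e where e': "gns.orthonormal n e" "\<And>b. b \<in> B \<Longrightarrow> gns.expands n e b"
    using gns.gram_schmidt_in[OF gns.subspace_C B] by auto
  have e: "gns.onb n e"
    unfolding gns.onb_def
  proof (intro conjI ballI e'(1))
    fix y
    obtain c where c: "\<And>x. ip x y = (\<Sum>b\<in>B. c b * ip x b)" using span by blast
    have "ip x y = (\<Sum>k<n. ip x (e k) * ip (e k) y)" for x
    proof -
      have eb: "ip x b = (\<Sum>k<n. ip x (e k) * ip (e k) b)" if "b \<in> B" for b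
        using e'(2)[OF that] unfolding gns.expands_def by blast
      have "ip x y = (\<Sum>b\<in>B. c b * (\<Sum>k<n. ip x (e k) * ip (e k) b))"
        unfolding c by (intro sum.cong refl arg_cong2[where f = "(*)"] eb)
      also have "\<dots> = (\<Sum>b\<in>B. \<Sum>k<n. ip x (e k) * (c b * ip (e k) b))"
        by (simp add: sum_distrib_left mult_ac)
      also have "\<dots> = (\<Sum>k<n. ip x (e k) * (\<Sum>b\<in>B. c b * ip (e k) b))"
        by (subst sum.swap) (simp add: sum_distrib_left)
      finally show ?thesis by (simp add: c)
    qed
    then show "gns.expands n e y" unfolding gns.expands_def by blast
  qed
  define c where "c = (\<Sum>k<n. e k * st (e k))"
  have tr_c: "\<tau> (q * c) = (\<Sum>k<n. ip (e k) (q * e k))" for q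
    by (simp add: c_def sum_distrib_left \<tau>_sum ip_cyclic)
  \<comment> \<open>\<open>\<tau> (q * c)\<close> is the trace of left multiplication by
    \<open>q\<close>, and operator traces satisfy this exchange.\<close>
  have tr_swap: "\<tau> (u * v * c) = \<tau> (v * u * c)" for u v
  proof -
    have *: "\<tau> (u * v * c) = (\<Sum>k<n. \<Sum>j<n. ip (e k) (u * e j) * ip (e j) (v * e k))" for u v
    proof -
      have "\<tau> (u * v * c) = (\<Sum>k<n. ip (st u * e k) (v * e k))"
        using tr_c[of "u * v"] by (simp add: st_mult st_st mult.assoc)
      also have "\<dots> = (\<Sum>k<n. \<Sum>j<n. ip (st u * e k) (e j) * ip (e j) (v * e k))"
        by (intro sum.cong refl parseval[OF e])
      finally show ?thesis by (simp add: st_mult st_st mult.assoc)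
    qed
    show ?thesis unfolding * by (subst sum.swap) (simp add: mult.commute)
  qed
  \<comment> \<open>Traciality of \<tau> moves \<open>c\<close> to the end of the word, and
    \<open>tr_swap\<close> then exchanges the other two factors. Centrality thus holds up to null
    vectors.\<close>
  have central: "ip x (c * y) = ip x (y * c)" for x y
    using tr_swap[of y "st x"] \<tau>_comm[of "st x" "c * y"] \<tau>_comm[of c "y * st x"]
    by (simp add: mult.assoc)
  have st_c: "st c = c" by (simp add: c_def st_sum st_mult st_st)
  obtain m f \<gamma> where f: "gns.onb m f"
    and eig: "\<And>k x. k < m \<Longrightarrow> ip x (c * f k) = of_real (\<gamma> k) * ip x (f k)"
    using gns.hermitian_eigenbasis[OF e, of "\<lambda>x. c * x"] ip_mult_left[of _ c] st_c by auto
  have ff: "ip (f k) (f k) = 1" if "k < m" for k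
    using f that by (simp add: gns.onb_def gns.orthonormal_def)
  \<comment> \<open>The eigenvalue is the sum of the squared norms of \<open>st (e j) * f k\<close>.
    If it were zero, pairing these null vectors with 1 would make \<open>f k\<close> orthogonal to
    the whole basis \<open>e\<close>, against its norm 1.\<close>
  have pos: "\<gamma> k > 0" if k: "k < m" for k
  proof -
    have "of_real (\<gamma> k) = ip (f k) (c * f k)" using eig[OF k] ff[OF k] by simp
    also have "\<dots> = (\<Sum>j<n. ip (st (e j) * f k) (st (e j) * f k))"
      by (simp add: c_def sum_distrib_right sum_distrib_left \<tau>_sum st_mult st_st mult.assoc)
    finally have \<gamma>: "\<gamma> k = (\<Sum>j<n. Re (ip (st (e j) * f k) (st (e j) * f k)))"
      by (metis Re_complex_of_real Re_sum)
    have "\<gamma> k \<noteq> 0"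
    proof
      assume "\<gamma> k = 0"
      then have zero: "Re (ip (st (e j) * f k) (st (e j) * f k)) = 0" if "j < n" for j
        using \<gamma> that \<tau>_pos by (simp add: sum_nonneg_eq_0_iff)
      have "ip (e j) (f k) = 0" if "j < n" for j
        using gns.ip_null(1)[of 1 "st (e j) * f k"] zero[OF that] by (simp add: st_one)
      then have "ip (f k) (f k) = 0" using parseval[OF e, of "f k" "f k"] by simp
      then show False using ff[OF k] by simp
    qed
    moreover have "\<gamma> k \<ge> 0" unfolding \<gamma> by (intro sum_nonneg \<tau>_pos)
    ultimately show ?thesis by simp
  qed
  have eig': "ip (c * x) (f k) = of_real (\<gamma> k) * ip x (f k)" if "k < m" for x k
    using eig[OF that, of x] ip_mult_left[of x c "f k"] st_c by simp
  \<comment> \<open>\<open>d\<close> is the inverse of \<open>c\<close> applied to 1: the expansion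
    of 1 in the eigenbasis with coefficients divided by the eigenvalues.\<close>
  obtain d where d: "\<And>x. ip x d = (\<Sum>k<m. ip (f k) 1 / of_real (\<gamma> k) * ip x (f k))"
    using gns.lincomb_in[OF gns.subspace_C, of "{..<m}" f "\<lambda>k. ip (f k) 1 / of_real (\<gamma> k)"] by auto
  have cd: "ip x (c * d) = ip x 1" for x
  proof -
    have "ip x (c * d) = (\<Sum>k<m. ip (f k) 1 / of_real (\<gamma> k) * ip (c * x) (f k))"
      using ip_mult_left[of x c d] d st_c by simp
    also have "\<dots> = (\<Sum>k<m. ip x (f k) * ip (f k) 1)"
      using eig' pos by (intro sum.cong) (auto simp: less_le)
    finally show ?thesis by (simp only: parseval[OF f, symmetric])
  qed
  \<comment> \<open>On \<open>f k\<close>, multiplication by \<open>d\<close> acts as division by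
    the eigenvalue. Traciality brings the product into the form of a pairing with 1, where
    \<open>c * d\<close> can be inserted; centrality then moves \<open>c\<close> next to
    \<open>f k\<close>.\<close>
  have insert_cd: "ip x (q * f k) = of_real (\<gamma> k) * ip x (q * d * f k)" if "k < m" for x q k
  proof -
    have "ip x (q * f k) = ip (st (f k * st x * q)) 1" 
      using \<tau>_comm[of "st x * q" "f k"] by (simp add: st_mult st_st mult.assoc)
    also have "\<dots> = ip (st (f k * st x * q)) (c * d)" by (rule cd[symmetric])
    also have "\<dots> = ip (st q * x) (c * (d * f k))"
      using \<tau>_comm[of "st x * (q * (c * d))" "f k"] by (simp add: st_mult st_st mult.assoc)
    also have "\<dots> = ip (st q * x) (d * (f k * c))"
      using central[of "st q * x" "d * f k"] by (simp add: mult.assoc)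
    also have "\<dots> = ip (st (q * d) * x) (f k * c)"
      by (simp add: st_mult st_st mult.assoc)
    also have "\<dots> = ip (st (q * d) * x) (c * f k)" by (rule central[symmetric])
    also have "\<dots> = of_real (\<gamma> k) * ip (st (q * d) * x) (f k)" by (rule eig[OF that])
    finally show ?thesis by (simp add: st_mult st_st mult.assoc)
  qed
  show ?thesis
  proof (rule that[OF f, of "\<lambda>k. 1 / \<gamma> k"])
    show "1 / \<gamma> k > 0" if "k < m" for k using pos[OF that] by simp
    fix q
    have "\<tau> q = ip (st q) 1" by (simp add: st_st)
    also have "\<dots> = ip (st q) (d * c)" using cd central by metis
    also have "\<dots> = \<tau> (q * d * c)" by (simp add: st_st mult.assoc)
    also have "\<dots> = (\<Sum>k<m. ip (f k) (q * d * f k))"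
      unfolding tr_c by (rule ip_sum_in_onb[OF e f])
    also have "\<dots> = (\<Sum>k<m. of_real (1 / \<gamma> k) * ip (f k) (q * f k))"
    proof (intro sum.cong refl)
      fix k assume "k \<in> {..<m}"
      then have "k < m" by simp
      then show "ip (f k) (q * d * f k) = of_real (1 / \<gamma> k) * ip (f k) (q * f k)"
        using insert_cd[of k "f k" q] pos[of k] by simp
    qed
    finally show "\<tau> q = \<dots>" .
  next
    fix q j k assume jk: "j < m" "k < m" and ne: "ip (f j) (q * f k) \<noteq> 0"
    \<comment> \<open>Two evaluations of one inner product: \<open>c\<close> acts on
      \<open>f j\<close> from the left, or passes through \<open>q\<close> and acts on
      \<open>f k\<close>.\<close>
    have "of_real (\<gamma> j) * ip (f j) (q * f k) = ip (f j) (c * (q * f k))"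
    proof -
      have "ip (f j) (c * (q * f k)) = ip (c * f j) (q * f k)"
        using ip_mult_left[of "f j" c "q * f k"] st_c by simp
      also have "\<dots> = cnj (ip (q * f k) (c * f j))" by (rule gns.ip_commute) auto
      also have "\<dots> = of_real (\<gamma> j) * cnj (ip (q * f k) (f j))"
        by (simp only: eig[OF jk(1)] complex_cnj_mult complex_cnj_complex_of_real)
      also have "cnj (ip (q * f k) (f j)) = ip (f j) (q * f k)"
        by (rule gns.ip_commute[symmetric]) auto
      finally show ?thesis by simp
    qed
    also have "\<dots> = ip (f j) (q * (f k * c))" using central[of "f j" "q * f k"] by (simp add: mult.assoc)
    also have "\<dots> = ip (st q * f j) (f k * c)" by (simp add: st_mult st_st mult.assoc)
    also have "\<dots> = ip (st q * f j) (c * f k)" by (rule central[symmetric])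
    also have "\<dots> = of_real (\<gamma> k) * ip (f j) (q * f k)" 
      using eig[OF jk(2), of "st q * f j"] by (simp add: st_mult st_st mult.assoc)
    finally have "\<gamma> j = \<gamma> k" using ne by simp
    then show "1 / \<gamma> j = 1 / \<gamma> k" by simp
  qed
qed

end

section \<open>Bounded left multiplications and the operator seminorm\<close>

context tracial_star_algebra
begin

definition bounded :: "'r \<Rightarrow> bool" where
  "bounded p \<longleftrightarrow> (\<exists>K\<ge>0. \<forall>q. gns.hn (p * q) \<le> K * gns.hn q)"

text \<open>An infimum of admissible constants instead of a supremum of quotients, because
  \<open>q\<close> may be null.\<close>

definition opnorm :: "'r \<Rightarrow> real" where
  "opnorm p = Inf {K. K \<ge> 0 \<and> (\<forall>q. gns.hn (p * q) \<le> K * gns.hn q)}"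

lemma hn_nonneg: "gns.hn x \<ge> 0"
  by (rule gns.hn_nonneg) simp

lemma hn_power2: "(gns.hn x)\<^sup>2 = Re (ip x x)"
  by (rule gns.hn_power2) simp

lemma hn_add: "gns.hn (x + y) \<le> gns.hn x + gns.hn y"
  by (rule gns.hn_triangle) simp_all

lemma hn_\<kappa>: "gns.hn (\<kappa> c * x) = cmod c * gns.hn x"
  by (rule gns.hn_smult) simp

text \<open>For a projection, the squared norm of \<open>p * q\<close> equals
  \<open>ip q (p * q)\<close>, which Cauchy-Schwarz bounds by the product of the norms of
  \<open>q\<close> and \<open>p * q\<close>. Idempotence under inner products is enough for
  this.\<close>

lemma hn_projection:
  assumes "st p = p" "\<And>x y. ip x (p * (p * y)) = ip x (p * y)"
  shows "gns.hn (p * q) \<le> gns.hn q"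
proof -
  have "ip (p * q) (p * q) = ip q (p * (p * q))" by (simp add: st_mult assms(1) mult.assoc)
  then have "gns.hn (p * q) * gns.hn (p * q) = Re (ip q (p * q))"
    using assms(2) hn_power2[of "p * q"] by (simp add: power2_eq_square)
  also have "\<dots> \<le> gns.hn q * gns.hn (p * q)"
    using gns.cmod_ip_le[of q "p * q"] complex_Re_le_cmod[of "ip q (p * q)"] by simp
  finally show ?thesis
    using hn_nonneg[of "p * q"] hn_nonneg[of q] by (cases "gns.hn (p * q) = 0") auto
qed

lemma bounded_projection:
  assumes "st p = p" "\<And>x y. ip x (p * (p * y)) = ip x (p * y)"
  shows "bounded p"
  unfolding bounded_def using hn_projection[OF assms] by (intro exI[of _ 1]) auto

lemma bounded_\<kappa>: "bounded (\<kappa> c)"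
  unfolding bounded_def by (intro exI[of _ "cmod c"]) (simp add: hn_\<kappa>)

lemma bounded_add:
  assumes "bounded p" "bounded q"
  shows "bounded (p + q)"
proof -
  obtain K where K: "K \<ge> 0" "\<And>x. gns.hn (p * x) \<le> K * gns.hn x"
    using assms(1) by (auto simp: bounded_def)
  obtain L where L: "L \<ge> 0" "\<And>x. gns.hn (q * x) \<le> L * gns.hn x"
    using assms(2) by (auto simp: bounded_def)
  have "gns.hn ((p + q) * x) \<le> (K + L) * gns.hn x" for x
    using hn_add[of "p * x" "q * x"] K(2)[of x] L(2)[of x] by (simp add: distrib_right)
  then show ?thesis using K(1) L(1) unfolding bounded_def by (intro exI[of _ "K + L"]) simp
qed

lemma bounded_mult:
  assumes "bounded p" "bounded q"
  shows "bounded (p * q)"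
proof -
  obtain K where K: "K \<ge> 0" "\<And>x. gns.hn (p * x) \<le> K * gns.hn x"
    using assms(1) by (auto simp: bounded_def)
  obtain L where L: "L \<ge> 0" "\<And>x. gns.hn (q * x) \<le> L * gns.hn x"
    using assms(2) by (auto simp: bounded_def)
  have "gns.hn (p * q * x) \<le> K * L * gns.hn x" for x
    using K(2)[of "q * x"] mult_left_mono[OF L(2)[of x] K(1)] by (simp add: mult.assoc)
  then show ?thesis using K(1) L(1) unfolding bounded_def by (intro exI[of _ "K * L"]) simp
qed

lemma opnorm_le: "K \<ge> 0 \<Longrightarrow> (\<And>q. gns.hn (p * q) \<le> K * gns.hn q) \<Longrightarrow> opnorm p \<le> K"
  unfolding opnorm_def by (rule cInf_lower) (auto intro: bdd_belowI[of _ 0])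

lemma opnorm_nonneg: "bounded p \<Longrightarrow> opnorm p \<ge> 0"
  unfolding opnorm_def by (rule cInf_greatest) (auto simp: bounded_def)

text \<open>The infimum is attained. Null \<open>q\<close> are handled by boundedness, the others by
  dividing by the norm of \<open>q\<close>.\<close>

lemma hn_mult_le:
  assumes "bounded p"
  shows "gns.hn (p * q) \<le> opnorm p * gns.hn q"
proof (cases "gns.hn q = 0")
  case True
  then show ?thesis using assms unfolding bounded_def by (metis mult_zero_right)
next
  case False
  then have pos: "gns.hn q > 0" using hn_nonneg[of q] by simp
  have "gns.hn (p * q) / gns.hn q \<le> opnorm p"
    unfolding opnorm_def using assms pos
    by (intro cInf_greatest) (auto simp: bounded_def field_simps)
  then show ?thesis using pos by (simp add: field_simps)
qed

text \<open>The C*-identity rests on the squared norm of \<open>x * q\<close> being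
  \<open>ip q (st x * x * q)\<close>; Cauchy-Schwarz gives one inequality, and the other follows
  once the star is seen to preserve the seminorm.\<close>

lemma cstar_seminorm_opnorm:
  assumes bdd: "\<And>p. bounded p"
  shows "cstar_seminorm \<kappa> st opnorm"
proof
  note le = hn_mult_le[OF bdd] and nonneg = opnorm_nonneg[OF bdd]
  show "opnorm (x + y) \<le> opnorm x + opnorm y" for x y
  proof (rule opnorm_le)
    show "gns.hn ((x + y) * q) \<le> (opnorm x + opnorm y) * gns.hn q" for q
      using hn_add[of "x * q" "y * q"] le[of x q] le[of y q] by (simp add: distrib_right)
  qed (use nonneg in simp)
  have mult: "opnorm (x * y) \<le> opnorm x * opnorm y" for x y
  proof (rule opnorm_le)
    show "gns.hn (x * y * q) \<le> opnorm x * opnorm y * gns.hn q" for q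
      using le[of x "y * q"] mult_left_mono[OF le[of y q] nonneg[of x]] by (simp add: mult.assoc)
  qed (use nonneg in simp)
  then show "opnorm (x * y) \<le> opnorm x * opnorm y" for x y .
  have \<kappa>_le: "opnorm (\<kappa> c * x) \<le> cmod c * opnorm x" for c x
  proof (rule opnorm_le)
    show "gns.hn (\<kappa> c * x * q) \<le> cmod c * opnorm x * gns.hn q" for q
      using mult_left_mono[OF le[of x q] norm_ge_zero[of c]] by (simp add: hn_\<kappa> mult.assoc)
  qed (use nonneg in simp)
  show "opnorm (\<kappa> c * x) = cmod c * opnorm x" for c x
  proof (cases "c = 0")
    case True
    then show ?thesis using \<kappa>_le[of c x] nonneg[of "\<kappa> c * x"] by simp
  next
    case False
    then have "\<kappa> (1 / c) * (\<kappa> c * x) = x"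
      using \<kappa>_mult[of "1 / c" c] by (simp add: mult.assoc[symmetric] \<kappa>_one)
    then have "opnorm x \<le> cmod (1 / c) * opnorm (\<kappa> c * x)"
      using \<kappa>_le[of "1 / c" "\<kappa> c * x"] by simp
    then show ?thesis
      using False \<kappa>_le[of c x] by (intro antisym) (auto simp: norm_divide field_simps)
  qed
  have star_le: "(opnorm x)\<^sup>2 \<le> opnorm (st x * x)" for x
  proof -
    have "opnorm x \<le> sqrt (opnorm (st x * x))"
    proof (rule opnorm_le)
      fix q
      have "(gns.hn (x * q))\<^sup>2 = Re (ip q (st x * x * q))"
        by (simp add: hn_power2 st_mult mult.assoc)
      also have "\<dots> \<le> gns.hn q * gns.hn (st x * x * q)"
        using gns.cmod_ip_le[of q "st x * x * q"] complex_Re_le_cmod[of "ip q (st x * x * q)"] by simp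
      also have "\<dots> \<le> gns.hn q * (opnorm (st x * x) * gns.hn q)"
        by (rule mult_left_mono[OF le hn_nonneg])
      also have "\<dots> = (sqrt (opnorm (st x * x)) * gns.hn q)\<^sup>2"
        by (simp add: power_mult_distrib nonneg power2_eq_square)
      finally show "gns.hn (x * q) \<le> sqrt (opnorm (st x * x)) * gns.hn q"
        by (rule power2_le_imp_le) (simp add: nonneg hn_nonneg)
    qed (simp add: nonneg)
    then show ?thesis using power_mono[OF _ nonneg[of x], of "sqrt (opnorm (st x * x))" 2] nonneg by simp
  qed
  have st_le: "opnorm x \<le> opnorm (st x)" for x
  proof (cases "opnorm x = 0")
    case False
    have "opnorm x * opnorm x \<le> opnorm (st x) * opnorm x"
      using star_le[of x] mult[of "st x" x] by (simp add: power2_eq_square)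
    then show ?thesis using False nonneg[of x] by simp
  qed (simp add: nonneg)
  show "opnorm (st x * x) = (opnorm x)\<^sup>2" for x
  proof (rule antisym[OF _ star_le])
    have "opnorm (st x) = opnorm x" using st_le[of x] st_le[of "st x"] by (simp add: st_st)
    then show "opnorm (st x * x) \<le> (opnorm x)\<^sup>2" using mult[of "st x" x] by (simp add: power2_eq_square)
  qed
qed

text \<open>Dividing \<tau> by \<open>\<tau> 1\<close> gives a state with value 1 /
  \<open>\<tau> 1\<close> at each \<open>X i\<close>, which is the normalization that
  \<open>xi_tr\<close> asks for with parameter \<open>\<tau> 1\<close>.\<close>

theorem xi_tr_le_trace:
  fixes J :: "(nat \<Rightarrow> 'r) \<Rightarrow> 'u" and X :: "'v \<Rightarrow> 'r"
  assumes bdd: "\<And>p. bounded p" and J: "inj J" and pos: "Re (\<tau> 1) > 0"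
    and herm: "\<And>i. i \<in> V \<Longrightarrow> st (X i) = X i"
    and idem: "\<And>i x y. i \<in> V \<Longrightarrow> ip x (X i * (X i * y)) = ip x (X i * y)"
    and orth: "\<And>i j x y. {i, j} \<in> E \<Longrightarrow> ip x (X i * (X j * y)) = 0"
    and \<tau>X: "\<And>i. i \<in> V \<Longrightarrow> \<tau> (X i) = 1"
  shows "xi_tr TYPE('u) V E \<le> ereal (Re (\<tau> 1))"
proof -
  interpret cstar_seminorm \<kappa> st opnorm by (rule cstar_seminorm_opnorm[OF bdd])
  define l where "l = Re (\<tau> 1)"
  have \<tau>1: "\<tau> 1 = of_real l" using gns.ip_self_real[of 1] by (simp add: st_one l_def)
  have l: "l > 0" using pos by (simp add: l_def)
  define \<tau>' where "\<tau>' x = \<tau> x / of_real l" for x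
  have hn1: "gns.hn 1 * gns.hn 1 = l" using hn_power2[of 1] by (simp add: power2_eq_square st_one l_def)
  have le: "cmod (\<tau>' x) \<le> opnorm x" for x
  proof -
    have "cmod (\<tau> x) \<le> gns.hn 1 * gns.hn (x * 1)"
      using gns.cmod_ip_le[of 1 "x * 1"] by (simp add: st_one)
    also have "\<dots> \<le> gns.hn 1 * (opnorm x * gns.hn 1)"
      by (rule mult_left_mono[OF hn_mult_le[OF bdd] hn_nonneg])
    also have "\<dots> = opnorm x * l" by (simp only: hn1[symmetric] mult_ac)
    finally show ?thesis using l by (simp add: \<tau>'_def norm_divide field_simps)
  qed
  have nonneg: "\<tau>' (st x * x) \<in> \<real>\<^sub>\<ge>\<^sub>0" for x
    using gns.ip_self_real[of x] \<tau>_pos[of x] l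
    by (simp add: \<tau>'_def complex_nonneg_Reals_iff complex_eq_iff)
  obtain A :: "'u star_algebra" and tr \<iota> where A: "unital_cstar_algebra A" "tracial_state A tr"
    "\<And>r. \<iota> r \<in> carrier A" "\<And>r. star A (\<iota> r) = \<iota> (st r)" "\<And>r s. \<iota> r \<otimes>\<^bsub>A\<^esub> \<iota> s = \<iota> (r * s)"
    "\<And>r. tr (\<iota> r) = \<tau>' r" "\<And>r s. opnorm (r - s) = 0 \<Longrightarrow> \<iota> r = \<iota> s" "\<iota> 0 = \<zero>\<^bsub>A\<^esub>"
  proof (rule completion[OF J, of \<tau>'])
    show "\<tau>' (x + y) = \<tau>' x + \<tau>' y" "\<tau>' (\<kappa> c * x) = c * \<tau>' x" "\<tau>' 1 = 1" "\<tau>' (x * y) = \<tau>' (y * x)"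
      for x y c using l \<tau>_comm[of x y] by (simp_all add: \<tau>'_def \<tau>_add \<tau>_\<kappa> \<tau>1 add_divide_distrib)
  qed (use le nonneg in blast)+
  \<comment> \<open>If \<open>r\<close> and \<open>s\<close> have the same matrix coefficients, left
    multiplication by \<open>r - s\<close> has norm zero, and the completion identifies the
    two.\<close>
  have null: "\<iota> r = \<iota> s" if "\<And>x y. ip x (r * y) = ip x (s * y)" for r s
  proof (rule A(7))
    have "ip ((r - s) * q) ((r - s) * q) = 0" for q
      using that[of "(r - s) * q" q] \<tau>_add[of "st ((r - s) * q) * ((r - s) * q)" "st ((r - s) * q) * (s * q)"]
      by (simp add: algebra_simps)
    then have "gns.hn ((r - s) * q) = 0" for q by (simp add: gns.hn_def)
    then have "opnorm (r - s) \<le> 0" by (intro opnorm_le) simp_all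
    then show "opnorm (r - s) = 0" using opnorm_nonneg[OF bdd] antisym by blast
  qed
  have "projector A (\<iota> (X i)) \<and> tr (\<iota> (X i)) = complex_of_real (1 / l)" if "i \<in> V" for i
    using that herm A null[of "X i * X i" "X i"] idem \<tau>X
    by (simp add: projector_def \<tau>'_def mult.assoc)
  moreover have "\<iota> (X i) \<otimes>\<^bsub>A\<^esub> \<iota> (X j) = \<zero>\<^bsub>A\<^esub>" if "{i, j} \<in> E" for i j
    using A null[of "X i * X j" 0] orth[OF that] by (simp add: mult.assoc \<tau>_zero)
  ultimately show ?thesis
    unfolding xi_tr_def l_def[symmetric] using l A(1,2)
    by (intro Inf_lower CollectI exI[of _ l] conjI exI[of _ A] exI[of _ tr]
        exI[of _ "\<lambda>i. \<iota> (X i)"]) auto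
qed

end

section \<open>Projection matrices and the projective rank\<close>

text \<open>For finite \<open>T\<close> this is the space of \<open>T\<close>-indexed complex
  vectors carried by all functions; values outside \<open>T\<close> are null directions.\<close>

lemma semi_inner_functions:
  fixes T :: "'t set"
  shows "semi_inner UNIV (\<lambda>x y i. x i + y i) (\<lambda>c x i. c * x i) (\<lambda>x y. \<Sum>i\<in>T. cnj (x i) * y i)"
proof
  fix x :: "'t \<Rightarrow> complex"
  show "0 \<le> Re (\<Sum>i\<in>T. cnj (x i) * x i)"
    by (auto intro!: sum_nonneg add_nonneg_nonneg)
qed (auto simp: sum.distrib sum_distrib_left algebra_simps)

lemma mat_adjoint_index:
  assumes "i < dim_col A" "j < dim_row A"
  shows "mat_adjoint A $$ (i, j) = conjugate (A $$ (j, i))"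
  using assms by (simp add: mat_adjoint_def mat_of_rows_def)

lemma mat_adjoint_dim [simp]:
  "dim_row (mat_adjoint A) = dim_col A" "dim_col (mat_adjoint A) = dim_row A"
  by (simp_all add: mat_adjoint_def)

lemma mat_adjoint_eq_iff:
  assumes "P \<in> carrier_mat D D"
  shows "mat_adjoint P = P \<longleftrightarrow> (\<forall>i<D. \<forall>j<D. P $$ (i, j) = cnj (P $$ (j, i)))"
proof -
  have "mat_adjoint P = P \<longleftrightarrow> (\<forall>i<D. \<forall>j<D. mat_adjoint P $$ (i, j) = P $$ (i, j))"
    using assms by (auto simp: mat_eq_iff)
  also have "\<dots> \<longleftrightarrow> (\<forall>i<D. \<forall>j<D. cnj (P $$ (j, i)) = P $$ (i, j))"
    using assms by (simp add: mat_adjoint_index)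
  also have "\<dots> \<longleftrightarrow> (\<forall>i<D. \<forall>j<D. P $$ (i, j) = cnj (P $$ (j, i)))"
    by (intro all_cong1 imp_cong refl eq_commute)
  finally show ?thesis .
qed

lemma mat_mult_index:
  assumes "A \<in> carrier_mat D D" "B \<in> carrier_mat D D" "i < D" "j < D"
  shows "(A * B) $$ (i, j) = (\<Sum>k<D. A $$ (i, k) * B $$ (k, j))"
  using assms by (simp add: scalar_prod_def atLeast0LessThan)

text \<open>An orthonormal basis \<open>g\<close> of the range of \<open>P\<close>, obtained from
  its columns, writes \<open>P\<close> as a sum of rank-one projections. Their number is the trace
  of \<open>P\<close>, and \<open>Q\<close> keeps \<open>r\<close> of them.\<close>

lemma subprojection:
  assumes P: "P \<in> carrier_mat D D" and adj: "mat_adjoint P = P" and idem: "P * P = P"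
    and r: "real r \<le> Re (trace_mat P)"
  obtains Q where "Q \<in> carrier_mat D D" "mat_adjoint Q = Q" "Q * Q = Q" "trace_mat Q = of_nat r"
    "P * Q = Q" "Q * P = Q"
proof -
  interpret semi_inner UNIV "\<lambda>x y i. x i + y i" "\<lambda>c x i. c * x i"
    "\<lambda>x y. \<Sum>i<D. cnj (x i) * y i" by (rule semi_inner_functions)
  \<comment> \<open>The range of \<open>P\<close>, described as the vectors fixed by it on the
    coordinates below \<open>D\<close>.\<close>
  define S where "S = {x. \<forall>i<D. (\<Sum>j<D. P $$ (i, j) * x j) = x i}"
  have "(\<lambda>_. 0) \<in> S" by (simp add: S_def)
  then have "S \<noteq> {}" by blast
  moreover have "(\<Sum>j<D. a j * (c * x j)) = c * (\<Sum>j<D. a j * x j)" for a x and c :: complex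
    by (simp add: sum_distrib_left mult_ac)
  ultimately have S: "subspace S"
    unfolding subspace_def by (simp add: S_def distrib_left sum.distrib)
  have PP: "(\<Sum>k<D. P $$ (i, k) * P $$ (k, j)) = P $$ (i, j)" if "i < D" "j < D" for i j
    using mat_mult_index[OF P P that] idem by simp
  have hP: "P $$ (i, j) = cnj (P $$ (j, i))" if "i < D" "j < D" for i j
    using adj that mat_adjoint_eq_iff[OF P] by blast
  define B where "B = (\<lambda>j i. P $$ (i, j)) ` {..<D}"
  have "B \<subseteq> S" using PP by (auto simp: B_def S_def)
  moreover have "finite B" by (simp add: B_def)
  ultimately have "\<exists>n g. orthonormal n g \<and> (\<forall>k<n. g k \<in> S) \<and> (\<forall>b\<in>B. expands n g b)"
    by (intro gram_schmidt_in[OF S])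
  then obtain n g where "orthonormal n g \<and> (\<forall>k<n. g k \<in> S) \<and> (\<forall>b\<in>B. expands n g b)"
    by (elim exE)
  then have g: "orthonormal n g" "\<And>k. k < n \<Longrightarrow> g k \<in> S" "\<And>b. b \<in> B \<Longrightarrow> expands n g b"
    by blast+
  have gg: "(\<Sum>i<D. cnj (g k i) * g l i) = (if k = l then 1 else 0)" if "k < n" "l < n" for k l
    using g(1) that unfolding orthonormal_def by blast
  have Pg: "(\<Sum>j<D. P $$ (i, j) * g k j) = g k i" if "i < D" "k < n" for i k
    using g(2)[OF that(2)] that(1) by (simp add: S_def)
  have P_eq: "P $$ (i, j) = (\<Sum>k<n. g k i * cnj (g k j))" if ij: "i < D" "j < D" for i j
  proof -
    have "expands n g (\<lambda>i. P $$ (i, j))" using g(3) that by (simp add: B_def)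
    \<comment> \<open>The expansion of column \<open>j\<close> is paired with the unit vector at
      \<open>i\<close>; as \<open>P\<close> is Hermitian and fixes \<open>g k\<close>, the
      coefficient of \<open>g k\<close> is \<open>cnj (g k j)\<close>.\<close>
    from bspec[OF this[unfolded expands_def] UNIV_I, of "\<lambda>l. if l = i then 1 else 0"]
    have "(\<Sum>l<D. cnj (if l = i then 1 else 0) * P $$ (l, j))
        = (\<Sum>k<n. (\<Sum>l<D. cnj (if l = i then 1 else 0) * g k l) * (\<Sum>l<D. cnj (g k l) * P $$ (l, j)))" .
    moreover have "(\<Sum>l<D. cnj (if l = i then 1 else 0) * f l) = f i" for f :: "nat \<Rightarrow> complex"
    proof -
      have "(\<Sum>l<D. cnj (if l = i then 1 else 0) * f l) = (\<Sum>l<D. if l = i then f l else 0)"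
        by (intro sum.cong) auto
      then show ?thesis using ij(1) by simp
    qed
    moreover have "(\<Sum>l<D. cnj (g k l) * P $$ (l, j)) = cnj (g k j)" if "k < n" for k
    proof -
      have "(\<Sum>l<D. cnj (g k l) * P $$ (l, j)) = cnj (\<Sum>l<D. P $$ (j, l) * g k l)"
        using hP[of _ j] ij by (simp add: mult.commute)
      then show ?thesis using Pg[OF ij(2) that] by simp
    qed
    ultimately show ?thesis by simp
  qed
  have trace_sum: "(\<Sum>i<D. \<Sum>k<m. g k i * cnj (g k i)) = of_nat m" if "m \<le> n" for m
  proof -
    have "(\<Sum>i<D. \<Sum>k<m. g k i * cnj (g k i)) = (\<Sum>k<m. \<Sum>i<D. cnj (g k i) * g k i)"
      by (subst sum.swap) (simp add: mult.commute)
    also have "\<dots> = (\<Sum>k<m. 1)" using gg that by (intro sum.cong) auto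
    finally show ?thesis by simp
  qed
  have "trace_mat P = of_nat n"
    using P P_eq trace_sum[of n] by (simp add: trace_mat_def)
  then have rn: "r \<le> n" using r by simp
  define Q where "Q = mat D D (\<lambda>(i, j). \<Sum>k<r. g k i * cnj (g k j))"
  have Q: "Q \<in> carrier_mat D D" by (simp add: Q_def)
  have Qij: "Q $$ (i, j) = (\<Sum>k<r. g k i * cnj (g k j))" if "i < D" "j < D" for i j
    using that by (simp add: Q_def)
  have hQ: "Q $$ (i, j) = cnj (Q $$ (j, i))" if "i < D" "j < D" for i j
    using that by (simp add: Qij mult.commute)
  then have adjQ: "mat_adjoint Q = Q" using mat_adjoint_eq_iff[OF Q] by blast
  have PQ: "(P * Q) $$ (i, j) = Q $$ (i, j)" if ij: "i < D" "j < D" for i j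
  proof -
    have "(P * Q) $$ (i, j) = (\<Sum>l<D. \<Sum>k<r. P $$ (i, l) * g k l * cnj (g k j))"
      using ij by (simp add: mat_mult_index[OF P Q] Qij sum_distrib_left mult.assoc)
    also have "\<dots> = (\<Sum>k<r. (\<Sum>l<D. P $$ (i, l) * g k l) * cnj (g k j))"
      by (subst sum.swap) (simp add: sum_distrib_right)
    also have "\<dots> = Q $$ (i, j)" using ij rn Pg by (simp add: Qij)
    finally show ?thesis .
  qed
  have QQ: "(Q * Q) $$ (i, j) = Q $$ (i, j)" if ij: "i < D" "j < D" for i j
  proof -
    have "(Q * Q) $$ (i, j) = (\<Sum>c<D. \<Sum>k<r. \<Sum>l<r. g k i * (cnj (g k c) * g l c) * cnj (g l j))"
      using ij by (simp add: mat_mult_index[OF Q Q] Qij sum_product mult.assoc)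
    also have "\<dots> = (\<Sum>k<r. \<Sum>l<r. \<Sum>c<D. g k i * (cnj (g k c) * g l c) * cnj (g l j))"
      by (subst sum.swap) (intro sum.cong refl sum.swap)
    also have "\<dots> = (\<Sum>k<r. \<Sum>l<r. g k i * (\<Sum>c<D. cnj (g k c) * g l c) * cnj (g l j))"
      by (simp add: sum_distrib_left sum_distrib_right)
    also have "\<dots> = (\<Sum>k<r. \<Sum>l<r. if k = l then g k i * cnj (g l j) else 0)"
      using gg rn by (intro sum.cong refl) auto
    also have "\<dots> = Q $$ (i, j)" using ij by (simp add: Qij)
    finally show ?thesis .
  qed
  have QP: "(Q * P) $$ (i, j) = Q $$ (i, j)" if ij: "i < D" "j < D" for i j
  proof -
    have "(Q * P) $$ (i, j) = (\<Sum>l<D. cnj (P $$ (j, l) * Q $$ (l, i)))"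
      using ij hP[of _ j] hQ[of i] by (simp add: mat_mult_index[OF Q P] mult.commute)
    also have "\<dots> = cnj ((P * Q) $$ (j, i))" using ij by (simp add: mat_mult_index[OF P Q])
    finally show ?thesis using PQ[of j i] hQ[of i j] ij by simp
  qed
  show ?thesis
  proof (rule that[OF Q adjQ])
    show "Q * Q = Q" "P * Q = Q" "Q * P = Q"
      using P Q QQ PQ QP by (intro eq_matI; simp)+
    show "trace_mat Q = of_nat r" using Q Qij trace_sum[OF rn] by (simp add: trace_mat_def)
  qed
qed

text \<open>\<open>xi_f\<close> demands equal traces. Orthogonality survives the cut to trace
  \<open>r\<close>, since \<open>Q i * Q j = Q i * P i * P j * Q j\<close>.\<close>

lemma xi_f_le_of_projections:
  assumes G: "finite_graph V E" and "D \<ge> 1" "r \<ge> 1"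
    and P: "\<And>i. i \<in> V \<Longrightarrow> P i \<in> carrier_mat D D \<and> mat_adjoint (P i) = P i \<and> P i * P i = P i"
    and r: "\<And>i. i \<in> V \<Longrightarrow> real r \<le> Re (trace_mat (P i))"
    and orth: "\<And>i j. {i, j} \<in> E \<Longrightarrow> P i * P j = 0\<^sub>m D D"
  shows "xi_f V E \<le> ereal (real D / real r)"
proof -
  have "\<exists>Q. Q \<in> carrier_mat D D \<and> mat_adjoint Q = Q \<and> Q * Q = Q \<and> trace_mat Q = of_nat r \<and>
      P i * Q = Q \<and> Q * P i = Q" if "i \<in> V" for i
    using subprojection[of "P i" D r] P[OF that] r[OF that] by metis
  then obtain Q where Q: "\<And>i. i \<in> V \<Longrightarrow> Q i \<in> carrier_mat D D \<and> mat_adjoint (Q i) = Q i \<and>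
      Q i * Q i = Q i \<and> trace_mat (Q i) = of_nat r \<and> P i * Q i = Q i \<and> Q i * P i = Q i"
    by metis
  have "Q i * Q j = 0\<^sub>m D D" if e: "{i, j} \<in> E" for i j
  proof -
    have ij: "i \<in> V" "j \<in> V" using G e by (auto simp: finite_graph_def)
    then have c: "Q i \<in> carrier_mat D D" "Q j \<in> carrier_mat D D" "P i \<in> carrier_mat D D" "P j \<in> carrier_mat D D"
      using P Q by auto
    have "Q i * Q j = Q i * P i * (P j * Q j)" using Q ij by simp
    also have "\<dots> = Q i * (P i * (P j * Q j))" by (rule assoc_mult_mat) (use c in auto)
    also have "P i * (P j * Q j) = P i * P j * Q j" by (rule assoc_mult_mat[symmetric]) (use c in auto)
    finally show ?thesis using orth[OF e] c by simp
  qed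
  then show ?thesis
    unfolding xi_f_def using Q assms(2,3)
    by (intro Inf_lower CollectI exI[of _ D] exI[of _ r] conjI exI[of _ Q]) auto
qed

text \<open>For every \<open>N\<close> above the dimension \<open>n\<close>, rounding gives the
  bound N l / (N - n) with l = \<open>\<tau> 1\<close>; the limit over \<open>N\<close>
  finishes.\<close>

theorem (in tracial_star_algebra) xi_f_le_trace:
  fixes X :: "'v \<Rightarrow> 'r"
  assumes G: "finite_graph V E" and V: "V \<noteq> {}"
    and B: "finite B" and span: "\<And>r. \<exists>c. \<forall>x. ip x r = (\<Sum>b\<in>B. c b * ip x b)"
    and herm: "\<And>i. i \<in> V \<Longrightarrow> st (X i) = X i"
    and idem: "\<And>i x y. i \<in> V \<Longrightarrow> ip x (X i * (X i * y)) = ip x (X i * y)"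
    and orth: "\<And>i j x y. {i, j} \<in> E \<Longrightarrow> ip x (X i * (X j * y)) = 0"
    and \<tau>X: "\<And>i. i \<in> V \<Longrightarrow> \<tau> (X i) = 1"
  shows "xi_f V E \<le> ereal (Re (\<tau> 1))"
proof -
  obtain n f and z :: "nat \<Rightarrow> real" where f: "gns.onb n f" and z: "\<And>k. k < n \<Longrightarrow> z k > 0"
    and \<tau>_eq: "\<And>q. \<tau> q = (\<Sum>k<n. of_real (z k) * ip (f k) (q * f k))"
    and block: "\<And>q j k. j < n \<Longrightarrow> k < n \<Longrightarrow> ip (f j) (q * f k) \<noteq> 0 \<Longrightarrow> z j = z k"
    by (rule finite_dimensional_decomposition[OF B span], rule that)
  have ff: "ip (f k) (f k) = 1" if "k < n" for k
    using f that by (simp add: gns.onb_def gns.orthonormal_def)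
  define l where "l = Re (\<tau> 1)"
  have l: "l = (\<Sum>k<n. z k)"
  proof -
    have "\<tau> 1 = (\<Sum>k<n. of_real (z k))" using \<tau>_eq[of 1] ff by simp
    then show ?thesis by (simp add: l_def)
  qed
  \<comment> \<open>The matrix of left multiplication by \<open>X i\<close> in the basis
    \<open>f\<close>. Weak relations between the \<open>X i\<close> become exact relations between
    these matrices.\<close>
  define p where "p i j k = ip (f j) (X i * f k)" for i j k
  have p_mult: "(\<Sum>c<n. p i a c * p j c b) = ip (f a) (X i * (X j * f b))" if "i \<in> V" for i j a b
  proof -
    have "ip (f a) (X i * (X j * f b)) = ip (X i * f a) (X j * f b)"
      using ip_mult_left[of "f a" "X i"] herm[OF that] by simp
    also have "\<dots> = (\<Sum>c<n. ip (X i * f a) (f c) * ip (f c) (X j * f b))" by (rule parseval[OF f])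
    also have "\<dots> = (\<Sum>c<n. p i a c * p j c b)"
      using ip_mult_left[of "f a" "X i"] herm[OF that] by (simp add: p_def)
    finally show ?thesis by simp
  qed
  have p_herm: "p i a b = cnj (p i b a)" if "i \<in> V" for i a b
    using ip_mult_left[of "f a" "X i" "f b"] herm[OF that] gns.ip_commute[of "f b" "X i * f a"]
    by (simp add: p_def)
  have p_diag: "Re (p i k k) \<ge> 0" "Re (p i k k) \<le> 1" if "i \<in> V" "k < n" for i k
  proof -
    have "(gns.hn (X i * f k))\<^sup>2 = Re (p i k k)"
      using idem[OF that(1)] herm[OF that(1)] by (simp add: hn_power2 st_mult mult.assoc p_def)
    moreover have "gns.hn (X i * f k) \<le> 1"
      using hn_projection[OF herm[OF that(1)] idem[OF that(1)], of "f k"] ff[OF that(2)]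
      by (simp add: gns.hn_def)
    ultimately show "Re (p i k k) \<ge> 0" "Re (p i k k) \<le> 1"
      using hn_nonneg[of "X i * f k"] by (metis zero_le_power2, metis power_le_one)
  qed
  have p_trace: "(\<Sum>k<n. z k * Re (p i k k)) = 1" if "i \<in> V" for i
  proof -
    have "Re (\<tau> (X i)) = (\<Sum>k<n. z k * Re (p i k k))" by (subst \<tau>_eq) (simp add: p_def)
    then show ?thesis using \<tau>X[OF that] by simp
  qed
  have bound: "xi_f V E \<le> ereal (real N * l / (real N - real n))" if N: "N > n" for N
  proof -
    \<comment> \<open>The multiplicity \<open>w k\<close> is a function of the weight \<open>z k\<close>, hence constant on invariant blocks,
      and amplifying every block by its multiplicity is multiplicative.\<close>
    define w where "w k = nat \<lfloor>real N * z k\<rfloor>" for k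
    define D where "D = (\<Sum>k<n. w k)"
    \<comment> \<open>Rows and columns of the amplified matrices are pairs of a basis index
      \<open>k\<close> and a copy number below \<open>w k\<close>; \<open>h\<close> enumerates
      them.\<close>
    define K where "K = Sigma {..<n} (\<lambda>k. {..<w k})"
    have "card K = D" by (simp add: K_def D_def)
    then obtain h where h: "bij_betw h {..<D} K"
      using ex_bij_betw_nat_finite[of K] by (auto simp: K_def atLeast0LessThan)
    then have hK: "h a \<in> K" if "a < D" for a using that by (auto simp: bij_betw_def)
    have h_eq: "h a = h b \<longleftrightarrow> a = b" if "a < D" "b < D" for a b
      using h that by (auto simp: bij_betw_def inj_on_def)
    have reindex: "(\<Sum>a<D. F (h a)) = (\<Sum>k<n. \<Sum>m<w k. F (k, m))" for F :: "nat \<times> nat \<Rightarrow> complex"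
    proof -
      have "(\<Sum>a<D. F (h a)) = sum F K" by (rule sum.reindex_bij_betw[OF h])
      also have "\<dots> = (\<Sum>k<n. \<Sum>m<w k. F (k, m))" by (simp add: K_def sum.Sigma)
      finally show ?thesis .
    qed
    define P where "P i = mat D D (\<lambda>(a, b). if snd (h a) = snd (h b) then p i (fst (h a)) (fst (h b)) else 0)" for i
    have Pc: "P i \<in> carrier_mat D D" for i by (simp add: P_def)
    have P_mult: "(P i * P j) $$ (a, b) = (if snd (h a) = snd (h b)
        then ip (f (fst (h a))) (X i * (X j * f (fst (h b)))) else 0)"
      if i: "i \<in> V" and ab: "a < D" "b < D" for i j a b
    proof -
      obtain k m where km: "h a = (k, m)" "k < n" "m < w k" using hK[OF ab(1)] by (auto simp: K_def)
      obtain k' m' where km': "h b = (k', m')" "k' < n" using hK[OF ab(2)] by (auto simp: K_def)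
      \<comment> \<open>A nonzero entry joins indices of equal weight, so copy \<open>m\<close>
        exists at \<open>l\<close> as well as at \<open>k\<close>. Without this, the sum over the
        copies would lose terms of the matrix product.\<close>
      have w: "w l = w k" if "l < n" "p i k l \<noteq> 0" for l
        using block[OF km(2) that(1), of "X i"] that(2) by (simp add: p_def w_def)
      have "(P i * P j) $$ (a, b) = (\<Sum>c<D. P i $$ (a, c) * P j $$ (c, b))"
        by (rule mat_mult_index[OF Pc Pc ab])
      also have "\<dots> = (\<Sum>c<D. (if snd (h c) = m then p i k (fst (h c)) else 0) *
          (if snd (h c) = m' then p j (fst (h c)) k' else 0))"
        using ab km km' by (intro sum.cong) (auto simp: P_def)
      also have "\<dots> = (\<Sum>l<n. \<Sum>q<w l. (if q = m then p i k l else 0) * (if q = m' then p j l k' else 0))"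
        unfolding reindex[of "\<lambda>x. (if snd x = m then p i k (fst x) else 0) *
          (if snd x = m' then p j (fst x) k' else 0)"] fst_conv snd_conv by (rule refl)
      also have "\<dots> = (\<Sum>l<n. if m = m' then p i k l * p j l k' else 0)"
      proof (rule sum.cong[OF refl])
        fix l assume "l \<in> {..<n}"
        then have l: "l < n" by simp
        have "(\<Sum>q<w l. (if q = m then p i k l else 0) * (if q = m' then p j l k' else 0))
            = (\<Sum>q<w l. if q = m then (if m = m' then p i k l * p j l k' else 0) else 0)"
          by (intro sum.cong) auto
        also have "\<dots> = (if m < w l then (if m = m' then p i k l * p j l k' else 0) else 0)" by simp
        also have "\<dots> = (if m = m' then p i k l * p j l k' else 0)"
          using w[OF l] km(3) by (cases "p i k l = 0") auto
        finally show "(\<Sum>q<w l. (if q = m then p i k l else 0) * (if q = m' then p j l k' else 0)) = \<dots>" .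
      qed
      also have "\<dots> = (if m = m' then ip (f k) (X i * (X j * f k')) else 0)"
        using p_mult[OF i, of k j k'] by simp
      finally show ?thesis by (simp add: km km')
    qed
    have adjP: "mat_adjoint (P i) = P i" if "i \<in> V" for i
      unfolding mat_adjoint_eq_iff[OF Pc] by (auto simp: P_def intro: p_herm[OF that])
    have idemP: "P i * P i = P i" if "i \<in> V" for i
      using Pc[of i] P_mult[OF that, of _ _ i] idem[OF that]
      by (intro eq_matI) (simp_all add: P_def p_def)
    have orthP: "P i * P j = 0\<^sub>m D D" if e: "{i, j} \<in> E" for i j
    proof -
      have "i \<in> V" using G e by (auto simp: finite_graph_def)
      then show ?thesis
        using Pc[of i] Pc[of j] P_mult[of i _ _ j] orth[OF e] by (intro eq_matI) simp_all
    qed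
    have trace: "Re (trace_mat (P i)) = (\<Sum>k<n. real (w k) * Re (p i k k))" for i
    proof -
      have "trace_mat (P i) = (\<Sum>a<D. p i (fst (h a)) (fst (h a)))"
        by (simp add: trace_mat_def P_def)
      also have "\<dots> = (\<Sum>k<n. of_nat (w k) * p i k k)"
        using reindex[of "\<lambda>x. p i (fst x) (fst x)"] by simp
      finally show ?thesis by simp
    qed
    have w_le: "real (w k) \<le> real N * z k" "real N * z k - 1 \<le> real (w k)" if "k < n" for k
    proof -
      have "real N * z k \<ge> 0" using z[OF that] by simp
      then have "real (w k) = of_int \<lfloor>real N * z k\<rfloor>" by (simp add: w_def)
      then show "real (w k) \<le> real N * z k" "real N * z k - 1 \<le> real (w k)" by linarith+
    qed
    \<comment> \<open>Each of the \<open>n\<close> weights loses at most 1 by rounding down, and the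
      diagonal entries lie between 0 and 1, so the trace falls short of \<open>N\<close> by at most
      \<open>n\<close>.\<close>
    have trace_ge: "real (N - n) \<le> Re (trace_mat (P i))" if i: "i \<in> V" for i
    proof -
      have "real (N - n) = real N * (\<Sum>k<n. z k * Re (p i k k)) - (\<Sum>k<n. 1)"
        using N p_trace[OF i] by simp
      also have "\<dots> = (\<Sum>k<n. real N * z k * Re (p i k k) - 1)"
        by (simp add: sum_distrib_left sum_subtractf mult.assoc)
      also have "\<dots> \<le> (\<Sum>k<n. real (w k) * Re (p i k k))"
      proof (rule sum_mono)
        fix k assume "k \<in> {..<n}"
        then have k: "k < n" by simp
        have "(real N * z k - real (w k)) * Re (p i k k) \<le> 1 * 1"
          using w_le[OF k] p_diag[OF i k] by (intro mult_mono) auto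
        then show "real N * z k * Re (p i k k) - 1 \<le> real (w k) * Re (p i k k)"
          by (simp add: left_diff_distrib)
      qed
      finally show ?thesis by (simp add: trace)
    qed
    \<comment> \<open>A vertex is needed here: its projection has trace at least 1, which forces a
      positive size.\<close>
    have D_ge: "D \<ge> 1"
    proof -
      obtain i where i: "i \<in> V" using V by blast
      have "1 \<le> real (N - n)" using N by simp
      also have "\<dots> \<le> (\<Sum>k<n. real (w k) * Re (p i k k))" using trace_ge[OF i] trace by simp
      also have "\<dots> \<le> (\<Sum>k<n. real (w k))"
        using p_diag[OF i] by (intro sum_mono mult_left_le) auto
      finally show ?thesis by (simp add: D_def flip: of_nat_sum)
    qed
    have "xi_f V E \<le> ereal (real D / real (N - n))"
      using xi_f_le_of_projections[OF G D_ge, of "N - n" P] N Pc adjP idemP trace_ge orthP by simp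
    also have "real D / real (N - n) \<le> real N * l / (real N - real n)"
    proof -
      have "real D \<le> real N * l"
        unfolding D_def l sum_distrib_left of_nat_sum using w_le by (intro sum_mono) simp
      then show ?thesis using N by (simp add: of_nat_diff divide_right_mono)
    qed
    finally show ?thesis by simp
  qed
  \<comment> \<open>With N = n + m + 1 the quotient N l / (N - n) equals l + n l / (m + 1).\<close>
  have lim: "(\<lambda>m. ereal (l + real n * l * (1 / real (Suc m)))) \<longlonglongrightarrow> ereal (l + real n * l * 0)"
    by (intro tendsto_intros LIMSEQ_inverse_real_of_nat[unfolded inverse_eq_divide])
  have "xi_f V E \<le> ereal (l + real n * l * (1 / real (Suc m)))" for m
  proof -
    have "real (n + Suc m) * l / (real (n + Suc m) - real n) = l + real n * l * (1 / real (Suc m))"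
      by (simp add: field_simps)
    then show ?thesis using bound[of "n + Suc m"] by simp
  qed
  then have "xi_f V E \<le> ereal (l + real n * l * 0)"
    by (intro LIMSEQ_le_const[OF lim]) blast
  then show ?thesis by (simp add: l_def)
qed

section \<open>The free algebra\<close>

lemma sum_monomials: "(\<Sum>w\<in>Poly_Mapping.keys p. Poly_Mapping.single w (Poly_Mapping.lookup p w)) = p"
proof (rule poly_mapping_eqI)
  fix v
  have "(\<Sum>w\<in>Poly_Mapping.keys p. Poly_Mapping.lookup (Poly_Mapping.single w (Poly_Mapping.lookup p w)) v)
      = (\<Sum>w\<in>Poly_Mapping.keys p. if w = v then Poly_Mapping.lookup p w else 0)"
    by (intro sum.cong refl) (simp add: lookup_single when_def)
  also have "\<dots> = Poly_Mapping.lookup p v"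
    by (simp add: in_keys_iff)
  finally show "Poly_Mapping.lookup (\<Sum>w\<in>Poly_Mapping.keys p.
      Poly_Mapping.single w (Poly_Mapping.lookup p w)) v = Poly_Mapping.lookup p v"
    by (simp add: lookup_sum)
qed

lemma poly_mapping_monomial_induct:
  fixes p :: "'a \<Rightarrow>\<^sub>0 'b :: comm_monoid_add"
  assumes "P 0" "\<And>w c. P (Poly_Mapping.single w c)" "\<And>p q. P p \<Longrightarrow> P q \<Longrightarrow> P (p + q)"
  shows "P p"
proof -
  have "P (\<Sum>w\<in>K. Poly_Mapping.single w (f w))" if "finite K" for K and f :: "'a \<Rightarrow> 'b"
    using that by (induction K rule: finite_induct) (auto intro: assms)
  from this[of "Poly_Mapping.keys p" "Poly_Mapping.lookup p"] show ?thesis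
    by (simp add: sum_monomials)
qed

text \<open>Linear extension from words to polynomials. With real scalars it builds feasible
  functionals, with complex scalars the trace \<tau> of the free algebra.\<close>

definition ext :: "('a \<Rightarrow> 'b :: comm_ring_1) \<Rightarrow> ('a \<Rightarrow>\<^sub>0 'b) \<Rightarrow> 'b" where
  "ext l p = (\<Sum>w\<in>Poly_Mapping.keys p. Poly_Mapping.lookup p w * l w)"

lemma ext_superset:
  "finite K \<Longrightarrow> Poly_Mapping.keys p \<subseteq> K \<Longrightarrow> ext l p = (\<Sum>w\<in>K. Poly_Mapping.lookup p w * l w)"
  unfolding ext_def by (rule sum.mono_neutral_left) (auto simp: in_keys_iff)

lemma ext_zero [simp]: "ext l 0 = 0"
  by (simp add: ext_def)

lemma ext_single [simp]: "ext l (Poly_Mapping.single w c) = c * l w"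
  using ext_superset[of "{w}" "Poly_Mapping.single w c" l] by simp

lemma ext_add: "ext l (p + q) = ext l p + ext l q"
proof -
  let ?K = "Poly_Mapping.keys p \<union> Poly_Mapping.keys q"
  have "Poly_Mapping.keys (p + q) \<subseteq> ?K" by (rule Poly_Mapping.keys_add)
  then show ?thesis
    by (simp add: ext_superset[of ?K] lookup_add distrib_right sum.distrib)
qed

lemma ext_sum: "ext l (sum f K) = (\<Sum>k\<in>K. ext l (f k))"
  by (induction K rule: infinite_finite_induct) (simp_all add: ext_add)

lemma ext_uminus: "ext l (- p) = - ext l p"
  using ext_add[of l p "- p"] by (simp add: add_eq_0_iff)

lemma ext_diff: "ext l (p - q) = ext l p - ext l q"
  using ext_add[of l p "- q"] by (simp add: ext_uminus)

lemma ext_mult: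
  fixes l :: "'a :: monoid_add \<Rightarrow> 'b :: comm_ring_1"
  shows "ext l (p * q) = (\<Sum>u\<in>Poly_Mapping.keys p. \<Sum>w\<in>Poly_Mapping.keys q.
    Poly_Mapping.lookup p u * Poly_Mapping.lookup q w * l (u + w))"
proof -
  have "p * q = (\<Sum>u\<in>Poly_Mapping.keys p. Poly_Mapping.single u (Poly_Mapping.lookup p u)) *
      (\<Sum>w\<in>Poly_Mapping.keys q. Poly_Mapping.single w (Poly_Mapping.lookup q w))"
    by (simp add: sum_monomials)
  also have "\<dots> = (\<Sum>u\<in>Poly_Mapping.keys p. \<Sum>w\<in>Poly_Mapping.keys q.
      Poly_Mapping.single (u + w) (Poly_Mapping.lookup p u * Poly_Mapping.lookup q w))"
    by (simp add: sum_product mult_single)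
  finally show ?thesis by (simp add: ext_sum)
qed

lemma letters_plus [simp]: "letters (u + w) = letters u @ letters w"
  by (simp add: plus_nc_word_def)

lemma letters_zero [simp]: "letters 0 = []"
  by (simp add: zero_nc_word_def)

lemma letters_word_rev [simp]: "letters (word_rev w) = rev (letters w)"
  by (simp add: word_rev_def)

lemma word_rev_plus: "word_rev (u + w) = word_rev w + word_rev u"
  by (simp add: word_rev_def plus_nc_word_def)

lemma word_rev_zero [simp]: "word_rev 0 = 0"
  by (simp add: word_rev_def zero_nc_word_def)

text \<open>Conjugate-linear counterpart of \<open>nc_star\<close>: the GNS construction takes place
  over the complex free algebra although the functionals are real.\<close>

definition cstar :: "('v nc_word \<Rightarrow>\<^sub>0 complex) \<Rightarrow> ('v nc_word \<Rightarrow>\<^sub>0 complex)" where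
  "cstar p = Poly_Mapping.map cnj (Poly_Mapping.map_key word_rev p)"

lemma lookup_cstar: "Poly_Mapping.lookup (cstar p) w = cnj (Poly_Mapping.lookup p (word_rev w))"
  by (simp add: cstar_def map.rep_eq map_key.rep_eq inj_word_rev when_def)

lemma cstar_cstar: "cstar (cstar p) = p"
  by (rule poly_mapping_eqI) (simp add: lookup_cstar)

lemma cstar_add: "cstar (p + q) = cstar p + cstar q"
  by (rule poly_mapping_eqI) (simp add: lookup_cstar lookup_add)

lemma cstar_zero: "cstar 0 = 0"
  by (rule poly_mapping_eqI) (simp add: lookup_cstar)

lemma word_rev_eq_iff: "word_rev u = w \<longleftrightarrow> u = word_rev w"
  by (metis word_rev_word_rev)

lemma cstar_single: "cstar (Poly_Mapping.single w c) = Poly_Mapping.single (word_rev w) (cnj c)"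
  by (rule poly_mapping_eqI) (auto simp: lookup_cstar lookup_single when_def word_rev_eq_iff)

lemma in_image_word_rev: "w \<in> word_rev ` K \<longleftrightarrow> word_rev w \<in> K"
  by (auto intro: image_eqI[of _ _ "word_rev w"])

lemma keys_cstar: "Poly_Mapping.keys (cstar p) = word_rev ` Poly_Mapping.keys p"
proof -
  have "w \<in> Poly_Mapping.keys (cstar p) \<longleftrightarrow> word_rev w \<in> Poly_Mapping.keys p" for w
    by (simp add: in_keys_iff lookup_cstar)
  then show ?thesis by (simp add: set_eq_iff in_image_word_rev)
qed

lemma cstar_mult: "cstar (p * q) = cstar q * cstar p"
proof (induction p rule: poly_mapping_monomial_induct)
  case (2 u c)
  show ?case
    by (induction q rule: poly_mapping_monomial_induct)
      (simp_all add: cstar_zero cstar_single cstar_add mult_single word_rev_plus distrib_left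
        distrib_right mult.commute)
qed (simp_all add: cstar_zero cstar_add distrib_left distrib_right)

lemma nc_star_add: "nc_star (p + q) = nc_star p + nc_star q"
  by (rule poly_mapping_eqI) (simp add: lookup_nc_star lookup_add)

lemma nc_star_zero: "nc_star 0 = 0"
  by (rule poly_mapping_eqI) (simp add: lookup_nc_star)

lemma nc_star_sum: "nc_star (sum f K) = (\<Sum>k\<in>K. nc_star (f k))"
  by (induction K rule: infinite_finite_induct) (simp_all add: nc_star_zero nc_star_add)

lemma nc_star_single: "nc_star (Poly_Mapping.single w c) = Poly_Mapping.single (word_rev w) c"
  by (rule poly_mapping_eqI) (auto simp: lookup_nc_star lookup_single when_def word_rev_eq_iff)

lemma keys_nc_star: "Poly_Mapping.keys (nc_star p) = word_rev ` Poly_Mapping.keys p"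
proof -
  have "w \<in> Poly_Mapping.keys (nc_star p) \<longleftrightarrow> word_rev w \<in> Poly_Mapping.keys p" for w
    by (simp add: in_keys_iff lookup_nc_star)
  then show ?thesis by (simp add: set_eq_iff in_image_word_rev)
qed

lemma inj_on_word_rev: "inj_on word_rev K"
  using inj_word_rev inj_on_subset by blast

section \<open>Tracial moments of words\<close>

text \<open>A functional stripped to its values on words. The last clause is positivity on hermitian
  squares, that is, positive semidefiniteness of all finite sections of the moment matrix.\<close>

definition tracial_moments :: "'v set \<Rightarrow> ('v list \<Rightarrow> real) \<Rightarrow> bool" where
  "tracial_moments V l \<longleftrightarrow>
     (\<forall>u\<in>lists V. \<forall>w\<in>lists V. l (u @ w) = l (w @ u)) \<and> (\<forall>w\<in>lists V. l (rev w) = l w) \<and>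
     (\<forall>K c. finite K \<and> K \<subseteq> lists V \<longrightarrow> 0 \<le> (\<Sum>u\<in>K. \<Sum>w\<in>K. c u * c w * l (rev u @ w)))"

text \<open>The relations stand at the end of the word because \<open>I_H\<close> consists of left
  multiples; the cyclic invariance in \<open>tracial_moments\<close> spreads them to all
  positions.\<close>

definition col_moments :: "'v set \<Rightarrow> 'v set set \<Rightarrow> ('v list \<Rightarrow> real) \<Rightarrow> bool" where
  "col_moments V E l \<longleftrightarrow> tracial_moments V l \<and> (\<forall>i\<in>V. l [i] = 1) \<and>
     (\<forall>w\<in>lists V. \<forall>i\<in>V. l (w @ [i, i]) = l (w @ [i])) \<and>
     (\<forall>w\<in>lists V. \<forall>i j. {i, j} \<in> E \<longrightarrow> l (w @ [i, j]) = 0)"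

lemma words_iff: "w \<in> words V \<longleftrightarrow> letters w \<in> lists V"
  by (auto simp: words_def)

lemma nc_const_mult: "nc_const c * nc_mono w = Poly_Mapping.single w c"
  by (simp add: nc_const_def nc_mono_def mult_single)

lemma nc_const_mult_ext: "ext l (nc_const c * p) = c * ext l p"
  by (induction p rule: poly_mapping_monomial_induct)
    (simp_all add: nc_const_def mult_single distrib_left ext_add)

lemma nc_polys_single: "w \<in> words V \<Longrightarrow> Poly_Mapping.single w c \<in> nc_polys V"
  by (simp add: nc_polys_def)

lemma nc_polys_add: "p \<in> nc_polys V \<Longrightarrow> q \<in> nc_polys V \<Longrightarrow> p + q \<in> nc_polys V"
  unfolding nc_polys_def using Poly_Mapping.keys_add[of p q] by blast

lemma nc_polys_sum: "(\<And>k. k \<in> K \<Longrightarrow> f k \<in> nc_polys V) \<Longrightarrow> sum f K \<in> nc_polys V"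
  by (induction K rule: infinite_finite_induct) (auto simp: nc_polys_add, auto simp: nc_polys_def)

text \<open>Together with \<open>col_moments_of_feasible\<close> this replaces functionals on
  polynomials by functions on words, the form in which every model delivers its data.\<close>

lemma col_feasible_ext:
  fixes V :: "'v set"
  assumes G: "finite_graph V E" and l: "col_moments V E l"
  defines "L \<equiv> ext (\<lambda>w. l (letters w))"
  shows "col_feasible V E L" "L 1 = l []" "moment_matrix L u w = l (rev (letters u) @ letters w)"
proof -
  have mono: "L (nc_mono w) = l (letters w)" for w by (simp add: L_def nc_mono_def)
  show "moment_matrix L u w = l (rev (letters u) @ letters w)"
    by (simp add: moment_matrix_def mono)
  have "L 1 = L (nc_mono 0)" by (simp add: nc_mono_def)
  then show "L 1 = l []" by (simp add: mono)
  have tm: "tracial_moments V l" using l by (simp add: col_moments_def)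
  have "nc_functional V L"
    by (simp add: nc_functional_def L_def ext_add nc_const_mult_ext)
  moreover have "tracial_functional V L" "symmetric_functional V L"
    using tm by (auto simp: tracial_functional_def symmetric_functional_def mono words_iff
        tracial_moments_def simp del: lists_eq_set)
  moreover have "positive_functional V L"
    unfolding positive_functional_def
  proof
    fix p assume p: "p \<in> nc_polys V"
    let ?K = "Poly_Mapping.keys p"
    have "L (nc_star p * p) = (\<Sum>u\<in>?K. \<Sum>w\<in>?K. Poly_Mapping.lookup p u *
        Poly_Mapping.lookup p w * l (rev (letters u) @ letters w))"
      by (simp add: L_def ext_mult keys_nc_star sum.reindex[OF inj_on_word_rev] lookup_nc_star)
    also have "\<dots> = (\<Sum>u\<in>letters ` ?K. \<Sum>w\<in>letters ` ?K. Poly_Mapping.lookup p (NC_Word u) *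
        Poly_Mapping.lookup p (NC_Word w) * l (rev u @ w))"
    proof -
      have "inj_on letters ?K" by (auto intro: inj_onI nc_word.expand)
      then show ?thesis by (simp add: sum.reindex)
    qed
    also have "\<dots> \<ge> 0"
    proof -
      have "finite (letters ` ?K)" "letters ` ?K \<subseteq> lists V"
        using p by (auto simp: nc_polys_def words_def)
      then show ?thesis
        using tm[unfolded tracial_moments_def, THEN conjunct2, THEN conjunct2, rule_format,
            of "letters ` ?K" "\<lambda>u. Poly_Mapping.lookup p (NC_Word u)"] by simp
    qed
    finally show "L (nc_star p * p) \<ge> 0" .
  qed
  moreover have "\<forall>i\<in>V. L (nc_var i) = 1"
    using l by (simp add: nc_var_def mono col_moments_def)
  moreover have "\<forall>p\<in>I_H V E. L p = 0"
  proof
    fix q assume "q \<in> I_H V E"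
    then obtain p h where q: "q = p * h" "p \<in> nc_polys V" "h \<in> H_G V E" by (auto simp: I_H_def)
    have monomial: "L (p * nc_mono v) = (\<Sum>w\<in>Poly_Mapping.keys p.
        Poly_Mapping.lookup p w * l (letters w @ letters v))" for v
      by (simp add: L_def ext_mult nc_mono_def)
    have keys: "letters w \<in> lists V" if "w \<in> Poly_Mapping.keys p" for w
      using q(2) that words_iff[of w V] unfolding nc_polys_def by blast
    have var2: "nc_var i * nc_var j = nc_mono (NC_Word [i, j])" for i j :: 'v
      by (simp add: nc_var_def nc_mono_def mult_single plus_nc_word_def)
    from q(3) consider i where "i \<in> V" "h = nc_var i - nc_var i * nc_var i"
      | i j where "{i, j} \<in> E" "h = nc_var i * nc_var j" by (auto simp: H_G_def)
    then show "L q = 0"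
    proof cases
      case 1
      have "L (p * nc_mono (NC_Word [i])) = L (p * nc_mono (NC_Word [i, i]))"
        using l keys 1(1) unfolding monomial
        by (intro sum.cong) (auto simp: col_moments_def simp del: lists_eq_set)
      moreover have "q = p * nc_mono (NC_Word [i]) - p * nc_mono (NC_Word [i, i])"
        using 1(2) q(1) by (simp add: right_diff_distrib var2) (simp add: nc_var_def)
      ultimately show ?thesis by (simp add: L_def ext_diff)
    next
      case 2
      have "L (p * nc_mono (NC_Word [i, j])) = 0"
        using l keys 2(1) unfolding monomial
        by (intro sum.neutral) (auto simp: col_moments_def simp del: lists_eq_set)
      then show ?thesis using 2(2) q(1) by (simp add: var2)
    qed
  qed
  ultimately show "col_feasible V E L" by (simp add: col_feasible_def)
qed

lemma col_moments_of_feasible: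
  fixes V :: "'v set"
  assumes G: "finite_graph V E" and L: "col_feasible V E L"
  shows "col_moments V E (\<lambda>w. L (nc_mono (NC_Word w)))"
proof -
  have add: "L (p + q) = L p + L q" if "p \<in> nc_polys V" "q \<in> nc_polys V" for p q
    using L that by (simp add: col_feasible_def nc_functional_def)
  have single: "L (Poly_Mapping.single w c) = c * L (nc_mono w)" if "w \<in> words V" for w c
  proof -
    have "nc_mono w \<in> nc_polys V" using nc_polys_single[OF that, of 1] by (simp add: nc_mono_def)
    then have "L (nc_const c * nc_mono w) = c * L (nc_mono w)"
      using L by (simp add: col_feasible_def nc_functional_def)
    then show ?thesis by (simp add: nc_const_mult)
  qed
  have L0: "L 0 = 0" using add[of 0 0] by (simp add: nc_polys_def)
  have sum: "L (sum f K) = (\<Sum>k\<in>K. L (f k))" if "\<And>k. k \<in> K \<Longrightarrow> f k \<in> nc_polys V" for f and K :: "'k set"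
    using that
    by (induction K rule: infinite_finite_induct) (auto simp: L0 add nc_polys_sum)
  have plus: "NC_Word u + NC_Word w = NC_Word (u @ w)" for u w :: "'v list"
    by (simp add: plus_nc_word_def)
  have ideal: "L (p * h) = 0" if "p \<in> nc_polys V" "h \<in> H_G V E" for p h
    using L that by (auto simp: col_feasible_def I_H_def)
  have var2: "nc_var i * nc_var j = nc_mono (NC_Word [i, j])" for i j :: 'v
    by (simp add: nc_var_def nc_mono_def mult_single plus_nc_word_def)
  have mono_mult: "nc_mono (NC_Word u) * nc_mono (NC_Word w) = nc_mono (NC_Word (u @ w))" for u w :: "'v list"
    by (simp add: nc_mono_def mult_single plus_nc_word_def)
  have mono_in: "nc_mono (NC_Word w) \<in> nc_polys V" if "w \<in> lists V" for w
    using that by (auto simp: nc_mono_def words_iff intro!: nc_polys_single)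
  show ?thesis
    unfolding col_moments_def tracial_moments_def
  proof (intro conjI ballI allI impI)
    fix u w assume "u \<in> lists V" "w \<in> lists V"
    then show "L (nc_mono (NC_Word (u @ w))) = L (nc_mono (NC_Word (w @ u)))"
      using L by (simp add: col_feasible_def tracial_functional_def plus[symmetric] words_iff)
  next
    fix w assume "w \<in> lists V"
    then have "NC_Word w \<in> words V" by (simp add: words_iff)
    then have "L (nc_mono (NC_Word w)) = L (nc_mono (word_rev (NC_Word w)))"
      using L unfolding col_feasible_def symmetric_functional_def by blast
    then show "L (nc_mono (NC_Word (rev w))) = L (nc_mono (NC_Word w))"
      by (simp add: word_rev_def)
  next
    fix K and c :: "'v list \<Rightarrow> real" assume K: "finite K \<and> K \<subseteq> lists V"
    define p where "p = (\<Sum>w\<in>K. Poly_Mapping.single (NC_Word w) (c w))"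
    have "p \<in> nc_polys V"
      unfolding p_def using K by (intro nc_polys_sum nc_polys_single) (auto simp: words_iff)
    then have "L (nc_star p * p) \<ge> 0"
      using L by (simp add: col_feasible_def positive_functional_def)
    also have "nc_star p * p
        = (\<Sum>u\<in>K. \<Sum>w\<in>K. Poly_Mapping.single (NC_Word (rev u @ w)) (c u * c w))"
      by (simp add: p_def nc_star_sum nc_star_single sum_product mult_single word_rev_def plus_nc_word_def)
    also have "L \<dots> = (\<Sum>u\<in>K. L (\<Sum>w\<in>K. Poly_Mapping.single (NC_Word (rev u @ w)) (c u * c w)))"
      using K by (intro sum nc_polys_sum nc_polys_single) (auto simp: words_iff)
    also have "\<dots> = (\<Sum>u\<in>K. \<Sum>w\<in>K. L (Poly_Mapping.single (NC_Word (rev u @ w)) (c u * c w)))"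
      using K by (intro sum.cong refl sum nc_polys_single) (auto simp: words_iff)
    also have "\<dots> = (\<Sum>u\<in>K. \<Sum>w\<in>K. c u * c w * L (nc_mono (NC_Word (rev u @ w))))"
      using K by (intro sum.cong refl single) (auto simp: words_iff)
    finally show "0 \<le> \<dots>" .
  next
    fix i assume "i \<in> V"
    then show "L (nc_mono (NC_Word [i])) = 1"
      using L by (simp add: col_feasible_def nc_var_def)
  next
    fix w i assume w: "w \<in> lists V" and i: "i \<in> V"
    let ?d = "nc_mono (NC_Word w) * (nc_var i - nc_var i * nc_var i)"
    have d: "?d = nc_mono (NC_Word (w @ [i])) - nc_mono (NC_Word (w @ [i, i]))"
      by (simp add: right_diff_distrib var2 mono_mult) (simp add: nc_var_def mono_mult)
    have "L ?d = 0" using ideal[OF mono_in[OF w]] i by (auto simp: H_G_def)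
    moreover have "L (?d + nc_mono (NC_Word (w @ [i, i]))) = L ?d + L (nc_mono (NC_Word (w @ [i, i])))"
    proof (rule add)
      have "?d = nc_mono (NC_Word (w @ [i])) + Poly_Mapping.single (NC_Word (w @ [i, i])) (- 1)"
        unfolding d by (simp add: nc_mono_def single_uminus)
      then show "?d \<in> nc_polys V"
        using w i by (simp only:) (intro nc_polys_add mono_in nc_polys_single, auto simp: words_iff)
    qed (use w i in \<open>auto intro!: mono_in\<close>)
    ultimately show "L (nc_mono (NC_Word (w @ [i, i]))) = L (nc_mono (NC_Word (w @ [i])))"
      unfolding d by simp
  next
    fix w i j assume "w \<in> lists V" "{i, j} \<in> E"
    then show "L (nc_mono (NC_Word (w @ [i, j]))) = 0"
      using ideal[OF mono_in, of w "nc_var i * nc_var j"]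
      by (auto simp: H_G_def var2 mono_mult)
  qed
qed

text \<open>\<open>finite_rank\<close> of the moment matrix, transcribed to lists:
  \<open>l (rev u @ w)\<close> is its entry at \<open>u\<close> and \<open>w\<close>.\<close>

definition finite_columns :: "'v set \<Rightarrow> ('v list \<Rightarrow> real) \<Rightarrow> bool" where
  "finite_columns V l \<longleftrightarrow> (\<exists>B. finite B \<and> B \<subseteq> lists V \<and>
     (\<forall>w\<in>lists V. \<exists>c. \<forall>u\<in>lists V. l (rev u @ w) = (\<Sum>b\<in>B. c b * l (rev u @ b))))"

lemma finite_columns_of_finite_rank:
  assumes "finite_rank (words V) (moment_matrix L)"
  shows "finite_columns V (\<lambda>w. L (nc_mono (NC_Word w)))"
proof -
  obtain B where B: "finite B" "B \<subseteq> words V"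
    "\<And>w. w \<in> words V \<Longrightarrow> \<exists>c. \<forall>u\<in>words V. moment_matrix L u w = (\<Sum>b\<in>B. c b * moment_matrix L u b)"
    using assms unfolding finite_rank_def by blast
  have M: "moment_matrix L u w = L (nc_mono (NC_Word (rev (letters u) @ letters w)))" for u w
    by (simp add: moment_matrix_def word_rev_def plus_nc_word_def)
  have inj: "inj_on letters B" by (auto intro: inj_onI nc_word.expand)
  show ?thesis
    unfolding finite_columns_def
  proof (intro exI[of _ "letters ` B"] conjI ballI)
    show "finite (letters ` B)" "letters ` B \<subseteq> lists V"
      using B by (auto simp: words_def)
    fix w assume "w \<in> lists V"
    then obtain c where c: "\<And>u. u \<in> words V \<Longrightarrow>
        moment_matrix L u (NC_Word w) = (\<Sum>b\<in>B. c b * moment_matrix L u b)"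
      using B(3)[of "NC_Word w"] by (auto simp: words_iff)
    have "L (nc_mono (NC_Word (rev u @ w)))
        = (\<Sum>b\<in>letters ` B. c (NC_Word b) * L (nc_mono (NC_Word (rev u @ b))))" if "u \<in> lists V" for u
      using c[of "NC_Word u"] that by (simp add: words_iff M sum.reindex[OF inj])
    then show "\<exists>c. \<forall>u\<in>lists V. L (nc_mono (NC_Word (rev u @ w)))
        = (\<Sum>b\<in>letters ` B. c b * L (nc_mono (NC_Word (rev u @ b))))"
      by (intro exI[of _ "\<lambda>b. c (NC_Word b)"]) blast
  qed
qed

text \<open>Letters become natural numbers, so that the free algebra has the cardinality of the
  continuum. Letters not coming from \<open>V\<close> are given moment zero.\<close>

lemma col_moments_reindex:
  fixes V :: "'v set"
  assumes V: "finite V" and l: "col_moments V E l"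
  obtains l' :: "nat list \<Rightarrow> real" and g :: "'v \<Rightarrow> nat" where "tracial_moments UNIV l'" "l' [] = l []"
    "\<And>w a. l' (w @ [a, a]) = l' (w @ [a])" "\<And>i. i \<in> V \<Longrightarrow> l' [g i] = 1"
    "\<And>w i j. i \<in> V \<Longrightarrow> j \<in> V \<Longrightarrow> {i, j} \<in> E \<Longrightarrow> l' (w @ [g i, g j]) = 0"
    "finite_columns V l \<Longrightarrow> finite_columns UNIV l'"
proof -
  obtain e :: "nat \<Rightarrow> 'v" where e: "bij_betw e {..<card V} V"
    using ex_bij_betw_nat_finite[OF V] by (auto simp: atLeast0LessThan)
  define N where "N = {..<card V}"
  have eV: "a \<in> N \<Longrightarrow> e a \<in> V" for a using e by (auto simp: N_def bij_betw_def)
  define g where "g = inv_into N e"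
  have eN: "inj_on e N" "e ` N = V" using e by (auto simp: N_def bij_betw_def)
  have eg: "e (g i) = i" "g i \<in> N" if "i \<in> V" for i
    using that eN f_inv_into_f[of i e N] inv_into_into[of i e N] by (simp_all add: g_def)
  define l' where "l' w = (if set w \<subseteq> N then l (map e w) else 0)" for w
  have map_in: "map e w \<in> lists V" if "set w \<subseteq> N" for w using that eV by (auto simp: subset_iff)
  have tm: "tracial_moments V l" using l by (simp add: col_moments_def)
  have swap: "l (u @ w) = l (w @ u)" if "u \<in> lists V" "w \<in> lists V" for u w
    using tm that by (simp only: tracial_moments_def)
  have rev: "l (rev w) = l w" if "w \<in> lists V" for w using tm that by (simp only: tracial_moments_def)
  have "tracial_moments UNIV l'"
    unfolding tracial_moments_def
  proof (intro conjI ballI allI impI)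
    fix u w
    show "l' (u @ w) = l' (w @ u)" using swap[OF map_in map_in, of u w] by (auto simp: l'_def)
    show "l' (rev w) = l' w" using rev[OF map_in, of w] by (simp add: l'_def rev_map)
  next
    fix K :: "nat list set" and c :: "nat list \<Rightarrow> real" assume K: "finite K \<and> K \<subseteq> lists UNIV"
    \<comment> \<open>Words with a letter outside \<open>N\<close> contribute zero, and on the
      remaining ones \<open>map e\<close> is injective, so the form reduces to one over
      \<open>lists V\<close>.\<close>
    define K' where "K' = {w \<in> K. set w \<subseteq> N}"
    have inj: "inj_on (map e) K'"
      by (rule inj_on_mapI, rule inj_on_subset[OF eN(1)]) (auto simp: K'_def)
    have "(\<Sum>u\<in>K. \<Sum>w\<in>K. c u * c w * l' (rev u @ w)) = (\<Sum>u\<in>K'. \<Sum>w\<in>K'. c u * c w * l' (rev u @ w))"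
    proof -
      have "(\<Sum>u\<in>K. \<Sum>w\<in>K. c u * c w * l' (rev u @ w)) = (\<Sum>u\<in>K'. \<Sum>w\<in>K. c u * c w * l' (rev u @ w))"
        using K by (intro sum.mono_neutral_right) (auto simp: K'_def l'_def)
      also have "\<dots> = (\<Sum>u\<in>K'. \<Sum>w\<in>K'. c u * c w * l' (rev u @ w))"
        using K by (intro sum.cong refl sum.mono_neutral_right) (auto simp: K'_def l'_def)
      finally show ?thesis .
    qed
    also have "\<dots> = (\<Sum>u\<in>K'. \<Sum>w\<in>K'. c u * c w * l (rev (map e u) @ map e w))"
      by (intro sum.cong refl) (auto simp: K'_def l'_def rev_map)
    also have "\<dots> = (\<Sum>u\<in>map e ` K'. \<Sum>w\<in>map e ` K'.
        c (the_inv_into K' (map e) u) * c (the_inv_into K' (map e) w) * l (rev u @ w))"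
      by (simp add: sum.reindex[OF inj] the_inv_into_f_f[OF inj])
    also have "\<dots> \<ge> 0"
    proof -
      have "finite (map e ` K')" "map e ` K' \<subseteq> lists V"
        using K map_in by (auto simp: K'_def simp del: lists_eq_set in_lists_conv_set)
      then show ?thesis
        using tm[unfolded tracial_moments_def, THEN conjunct2, THEN conjunct2, rule_format,
            of "map e ` K'" "\<lambda>u. c (the_inv_into K' (map e) u)"] by simp
    qed
    finally show "0 \<le> (\<Sum>u\<in>K. \<Sum>w\<in>K. c u * c w * l' (rev u @ w))" .
  qed
  moreover have "l' [] = l []" by (simp add: l'_def)
  moreover have "l' (w @ [a, a]) = l' (w @ [a])" for w a
  proof (cases "set w \<subseteq> N \<and> a \<in> N")
    case True
    then have "l (map e w @ [e a, e a]) = l (map e w @ [e a])"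
      using l map_in[of w] eV by (simp only: col_moments_def)
    then show ?thesis using True by (simp add: l'_def)
  qed (auto simp: l'_def)
  moreover have "l' [g i] = 1" if "i \<in> V" for i
    using l that eg[OF that] by (simp add: l'_def col_moments_def)
  moreover have "l' (w @ [g i, g j]) = 0" if "i \<in> V" "j \<in> V" "{i, j} \<in> E" for w i j
  proof (cases "set w \<subseteq> N")
    case True
    have "l (map e w @ [i, j]) = 0"
      using l map_in[OF True] that(3) by (simp only: col_moments_def)
    then show ?thesis using that eg by (simp add: l'_def)
  qed (auto simp: l'_def)
  moreover have "finite_columns UNIV l'" if columns: "finite_columns V l"
  proof -
    from columns obtain B where B': "finite B \<and> B \<subseteq> lists V \<and>
      (\<forall>w\<in>lists V. \<exists>c. \<forall>u\<in>lists V. l (rev u @ w) = (\<Sum>b\<in>B. c b * l (rev u @ b)))"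
      unfolding finite_columns_def by (elim exE)
    note B = conjunct1[OF B'] conjunct1[OF conjunct2[OF B']]
      bspec[OF conjunct2[OF conjunct2[OF B']]]
    have meg: "map e (map g b) = b" if "b \<in> B" for b
      using B(2) that eg by (auto simp: subset_iff intro!: map_idI)
    then have inj: "inj_on (map g) B" by (metis inj_onI)
    have gN: "set (map g b) \<subseteq> N" if "b \<in> B" for b using B(2) that eg by (auto simp: subset_iff)
    show ?thesis
      unfolding finite_columns_def
    proof (intro exI[of _ "map g ` B"] conjI ballI)
      fix w :: "nat list"
      show "\<exists>c. \<forall>u\<in>lists UNIV. l' (rev u @ w) = (\<Sum>b\<in>map g ` B. c b * l' (rev u @ b))"
      proof (cases "set w \<subseteq> N")
        case True
        obtain c where c: "\<And>u. u \<in> lists V \<Longrightarrow> l (rev u @ map e w) = (\<Sum>b\<in>B. c b * l (rev u @ b))"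
          using B(3)[OF map_in[OF True]] by (elim exE) simp
        have "l' (rev u @ w) = (\<Sum>b\<in>map g ` B. c (map e b) * l' (rev u @ b))" for u
        proof (cases "set u \<subseteq> N")
          case u: True
          have "l' (rev u @ w) = (\<Sum>b\<in>B. c b * l (rev (map e u) @ b))"
            using c[OF map_in[OF u]] True u by (simp add: l'_def rev_map)
          also have "\<dots> = (\<Sum>b\<in>B. c (map e (map g b)) * l' (rev u @ map g b))"
          proof (intro sum.cong refl)
            fix b assume "b \<in> B"
            then show "c b * l (rev (map e u) @ b) = c (map e (map g b)) * l' (rev u @ map g b)"
              using meg[of b] gN[of b] u by (simp add: l'_def rev_map)
          qed
          finally show ?thesis by (simp add: sum.reindex[OF inj])
        qed (simp add: l'_def)
        then show ?thesis by (intro exI[of _ "\<lambda>b. c (map e b)"]) blast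
      next
        case False
        then show ?thesis by (intro exI[of _ "\<lambda>_. 0"]) (auto simp: l'_def)
      qed
    qed (use B in auto)
  qed
  ultimately show ?thesis using that by blast
qed

abbreviation word_mono :: "'x list \<Rightarrow> 'x nc_word \<Rightarrow>\<^sub>0 complex" where
  "word_mono w \<equiv> Poly_Mapping.single (NC_Word w) 1"

lemma word_mono_append: "word_mono (u @ w) = word_mono u * word_mono w"
  by (simp add: mult_single plus_nc_word_def)

lemma word_mono_Nil: "word_mono [] = 1"
  by (simp add: zero_nc_word_def[symmetric])

lemma single_eq_const_mult: "Poly_Mapping.single w c = Poly_Mapping.single 0 c * word_mono (letters w)"
  by (simp add: mult_single)

text \<open>Positivity for complex coefficients: the moments are real, so the real part of the form
  splits into the real form at the real parts and at the imaginary parts of the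
  coefficients.\<close>

lemma tracial_star_algebra_of_moments:
  fixes l :: "'x list \<Rightarrow> real"
  assumes l: "tracial_moments UNIV l"
  shows "tracial_star_algebra (Poly_Mapping.single 0) cstar (ext (\<lambda>w. complex_of_real (l (letters w))))"
proof
  have swap: "l (u @ w) = l (w @ u)" and rev: "l (rev w) = l w" for u w
    using l by (auto simp: tracial_moments_def)
  let ?\<tau> = "ext (\<lambda>w. complex_of_real (l (letters w)))"
  fix x y :: "'x nc_word \<Rightarrow>\<^sub>0 complex" and a b c :: complex
  show "x * Poly_Mapping.single 0 c = Poly_Mapping.single 0 c * x"
    by (induction x rule: poly_mapping_monomial_induct)
      (simp_all add: mult_single distrib_left distrib_right mult.commute)
  show "?\<tau> (Poly_Mapping.single 0 c * x) = c * ?\<tau> x"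
    by (induction x rule: poly_mapping_monomial_induct)
      (simp_all add: mult_single distrib_left ext_add)
  show "?\<tau> (x * y) = ?\<tau> (y * x)"
    unfolding ext_mult by (subst sum.swap) (simp add: swap mult.commute)
  show "?\<tau> (cstar x) = cnj (?\<tau> x)"
    by (induction x rule: poly_mapping_monomial_induct)
      (simp_all add: cstar_zero cstar_single cstar_add ext_add rev)
  let ?K = "Poly_Mapping.keys x"
  have pos: "0 \<le> (\<Sum>u\<in>?K. \<Sum>w\<in>?K. f u * f w * l (rev (letters u) @ letters w))" for f :: "'x nc_word \<Rightarrow> real"
  proof -
    have inj: "inj_on letters ?K" by (auto intro: inj_onI nc_word.expand)
    have "0 \<le> (\<Sum>u\<in>letters ` ?K. \<Sum>w\<in>letters ` ?K. f (NC_Word u) * f (NC_Word w) * l (rev u @ w))"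
      using l[unfolded tracial_moments_def, THEN conjunct2, THEN conjunct2, rule_format,
          of "letters ` ?K" "\<lambda>u. f (NC_Word u)"] by simp
    then show ?thesis by (simp add: sum.reindex[OF inj])
  qed
  have "?\<tau> (cstar x * x) = (\<Sum>u\<in>?K. \<Sum>w\<in>?K. cnj (Poly_Mapping.lookup x u) *
      Poly_Mapping.lookup x w * of_real (l (rev (letters u) @ letters w)))"
    by (simp add: ext_mult keys_cstar sum.reindex[OF inj_on_word_rev] lookup_cstar)
  then have "Re (?\<tau> (cstar x * x))
      = (\<Sum>u\<in>?K. \<Sum>w\<in>?K. Re (Poly_Mapping.lookup x u) * Re (Poly_Mapping.lookup x w) *
          l (rev (letters u) @ letters w)) +
        (\<Sum>u\<in>?K. \<Sum>w\<in>?K. Im (Poly_Mapping.lookup x u) * Im (Poly_Mapping.lookup x w) *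
          l (rev (letters u) @ letters w))"
    by (simp add: sum.distrib distrib_right)
  then show "Re (?\<tau> (cstar x * x)) \<ge> 0"
    using pos[of "\<lambda>u. Re (Poly_Mapping.lookup x u)"] pos[of "\<lambda>u. Im (Poly_Mapping.lookup x u)"] by simp
qed (simp_all add: single_add mult_single cstar_cstar cstar_add cstar_mult cstar_single ext_add)

text \<open>A sequence of polynomials in countably many letters is determined by countably many
  reals. Coding each real as a set of naturals merges them into a single set over a countable
  type.\<close>

lemma inj_sequences_of_lepoll:
  assumes "(UNIV :: real set) \<lesssim> (UNIV :: 'u set)"
  obtains J :: "(nat \<Rightarrow> (nat nc_word \<Rightarrow>\<^sub>0 complex)) \<Rightarrow> 'u" where "inj J"
proof -
  obtain r :: "real \<Rightarrow> nat set" where r: "inj r"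
    using nat_sets_eqpoll_reals eqpoll_sym eqpoll_imp_lepoll unfolding lepoll_def by blast
  have "(UNIV :: nat set set) \<lesssim> (UNIV :: 'u set)"
    using nat_sets_eqpoll_reals eqpoll_imp_lepoll assms lepoll_trans by blast
  then obtain h :: "nat set \<Rightarrow> 'u" where h: "inj h" unfolding lepoll_def by blast
  define code :: "(nat \<Rightarrow> (nat nc_word \<Rightarrow>\<^sub>0 complex)) \<Rightarrow> (nat \<times> nat list \<times> bool \<times> nat) set" where
    "code s = {(n, w, b, m). m \<in> r (if b then Re (Poly_Mapping.lookup (s n) (NC_Word w))
       else Im (Poly_Mapping.lookup (s n) (NC_Word w)))}" for s
  have "inj code"
  proof (rule injI)
    fix s t assume eq: "code s = code t"
    have mem: "(n, w, b, m) \<in> code s \<longleftrightarrow> (n, w, b, m) \<in> code t" for n w b m by (simp add: eq)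
    have "r (Re (Poly_Mapping.lookup (s n) (NC_Word w))) = r (Re (Poly_Mapping.lookup (t n) (NC_Word w)))"
      "r (Im (Poly_Mapping.lookup (s n) (NC_Word w))) = r (Im (Poly_Mapping.lookup (t n) (NC_Word w)))" for n w
      using mem[of n w True] mem[of n w False] by (auto simp: code_def)
    then have "Poly_Mapping.lookup (s n) (NC_Word w) = Poly_Mapping.lookup (t n) (NC_Word w)" for n w
      using r by (simp add: inj_eq complex_eq_iff)
    then have "Poly_Mapping.lookup (s n) v = Poly_Mapping.lookup (t n) v" for n v
      by (metis nc_word.exhaust)
    then show "s = t" by (intro ext poly_mapping_eqI)
  qed
  then have "inj (\<lambda>s. h (to_nat ` code s))"
    by (intro injI) (metis h injD inj_image_eq_iff inj_to_nat)
  then show ?thesis using that by blast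
qed

text \<open>GNS for a feasible functional. The alternative \<open>L 1 > 0\<close> covers graphs
  without vertices, where no \<open>X i\<close> is available to make \<tau> nonzero.\<close>

theorem xi_le_col_feasible:
  fixes V :: "'v set"
  assumes G: "finite_graph V E" and V: "V \<noteq> {} \<or> L 1 > 0" and L: "col_feasible V E L"
    and U: "(UNIV :: real set) \<lesssim> (UNIV :: 'u set)"
  shows "xi_tr TYPE('u) V E \<le> ereal (L 1)"
    "V \<noteq> {} \<Longrightarrow> finite_rank (words V) (moment_matrix L) \<Longrightarrow> xi_f V E \<le> ereal (L 1)"
proof -
  have fin: "finite V" using G by (simp add: finite_graph_def)
  have EV: "i \<in> V \<and> j \<in> V" if "{i, j} \<in> E" for i j using G that by (auto simp: finite_graph_def)
  obtain l :: "nat list \<Rightarrow> real" and g :: "'v \<Rightarrow> nat" where l: "tracial_moments UNIV l"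
    "l [] = L (nc_mono (NC_Word []))" "\<And>w a. l (w @ [a, a]) = l (w @ [a])"
    "\<And>i. i \<in> V \<Longrightarrow> l [g i] = 1"
    "\<And>w i j. i \<in> V \<Longrightarrow> j \<in> V \<Longrightarrow> {i, j} \<in> E \<Longrightarrow> l (w @ [g i, g j]) = 0"
    "finite_columns V (\<lambda>w. L (nc_mono (NC_Word w))) \<Longrightarrow> finite_columns UNIV l"
    by (rule col_moments_reindex[OF fin col_moments_of_feasible[OF G L]], rule that)
  define \<tau> where "\<tau> = ext (\<lambda>w. complex_of_real (l (letters w)))"
  interpret tracial_star_algebra "Poly_Mapping.single 0" cstar \<tau>
    unfolding \<tau>_def by (rule tracial_star_algebra_of_moments[OF l(1)])
  have \<tau>_mono: "\<tau> (word_mono w) = of_real (l w)" for w by (simp add: \<tau>_def)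
  have L1: "L 1 = l []" by (simp add: l(2) nc_mono_def zero_nc_word_def[symmetric])
  then have \<tau>1: "Re (\<tau> 1) = L 1" using \<tau>_mono[of "[]"] by (simp add: word_mono_Nil)
  define X where "X i = word_mono [g i]" for i
  have herm: "cstar (word_mono [a]) = word_mono [a]" for a by (simp add: cstar_single word_rev_def)
  have expand: "\<tau> (p * word_mono v) = (\<Sum>w\<in>Poly_Mapping.keys p. Poly_Mapping.lookup p w * of_real (l (letters w @ v)))"
    for p v by (simp add: \<tau>_def ext_mult)
  \<comment> \<open>The moment relations concern ends of words; traciality moves the middle factor
    \<open>p\<close> to the end.\<close>
  have cyc: "ip x (p * y) = \<tau> (y * cstar x * p)" for x y p
    using \<tau>_comm[of "cstar x * p" y] by (simp add: mult.assoc)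
  have idem: "ip x (word_mono [a] * (word_mono [a] * y)) = ip x (word_mono [a] * y)" for x y a
  proof -
    have "ip x (word_mono [a] * (word_mono [a] * y)) = \<tau> (y * cstar x * word_mono [a, a])"
      using cyc[of x "word_mono [a] * word_mono [a]" y] word_mono_append[of "[a]" "[a]"]
      by (simp add: mult.assoc)
    also have "\<dots> = ip x (word_mono [a] * y)" unfolding cyc expand by (simp add: l(3))
    finally show ?thesis .
  qed
  have orth: "ip x (X i * (X j * y)) = 0" if "{i, j} \<in> E" for i j x y
  proof -
    have "ip x (X i * (X j * y)) = \<tau> (y * cstar x * word_mono [g i, g j])"
      using cyc[of x "X i * X j" y] word_mono_append[of "[g i]" "[g j]"]
      by (simp add: mult.assoc X_def)
    also have "\<dots> = 0" unfolding expand using EV[OF that] that by (simp add: l(5))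
    finally show ?thesis .
  qed
  have \<tau>X: "\<tau> (X i) = 1" if "i \<in> V" for i using l(4)[OF that] \<tau>_mono by (simp add: X_def)
  have hermX: "cstar (X i) = X i" for i by (simp only: X_def herm)
  have idemX: "ip x (X i * (X i * y)) = ip x (X i * y)" for i x y by (simp only: X_def idem)
  \<comment> \<open>Every letter acts as a projection, also those that do not come from a vertex, so
    words are bounded and with them all polynomials.\<close>
  have mono_bdd: "bounded (word_mono w)" for w
  proof (induction w)
    case Nil
    show ?case using bounded_\<kappa>[of 1] by (simp add: word_mono_Nil)
  next
    case (Cons a w)
    have "bounded (word_mono [a] * word_mono w)"
      by (intro bounded_mult Cons bounded_projection herm idem)
    then show ?case using word_mono_append[of "[a]" w] by simp
  qed
  have bdd: "bounded p" for p
  proof (induction p rule: poly_mapping_monomial_induct)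
    case 1
    show ?case using bounded_\<kappa>[of 0] by simp
  next
    case (2 w c)
    show ?case unfolding single_eq_const_mult[of w c] by (intro bounded_mult bounded_\<kappa> mono_bdd)
  qed (rule bounded_add)
  \<comment> \<open>If \<open>\<tau> 1\<close> were zero, 1 would be a null vector, contradicting
    \<open>\<tau> (X i) = 1\<close>.\<close>
  have pos: "Re (\<tau> 1) > 0"
  proof (cases "V = {}")
    case True
    then show ?thesis using V \<tau>1 by simp
  next
    case False
    then obtain i where "i \<in> V" by blast
    have "Re (\<tau> 1) \<ge> 0" using \<tau>_pos[of 1] by (simp add: st_one)
    moreover have "Re (\<tau> 1) \<noteq> 0"
    proof
      assume "Re (\<tau> 1) = 0"
      then have "ip 1 (X i) = 0" using gns.ip_null(2)[of "X i" 1] by (simp add: st_one)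
      then show False using \<tau>X[OF \<open>i \<in> V\<close>] by (simp add: st_one)
    qed
    ultimately show ?thesis by simp
  qed
  obtain J :: "(nat \<Rightarrow> (nat nc_word \<Rightarrow>\<^sub>0 complex)) \<Rightarrow> 'u" where J: "inj J"
    by (rule inj_sequences_of_lepoll[OF U])
  show "xi_tr TYPE('u) V E \<le> ereal (L 1)"
    unfolding \<tau>1[symmetric] by (rule xi_tr_le_trace[OF bdd J pos hermX idemX orth \<tau>X])
  assume V: "V \<noteq> {}" and "finite_rank (words V) (moment_matrix L)"
  then have "finite_columns UNIV l" by (intro l(6) finite_columns_of_finite_rank)
  then obtain B where B: "finite B"
    "\<And>w. \<exists>c. \<forall>u. l (rev u @ w) = (\<Sum>b\<in>B. c b * l (rev u @ b))"
    by (auto simp: finite_columns_def)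
  then obtain C where C: "\<And>w u. l (rev u @ w) = (\<Sum>b\<in>B. C w b * l (rev u @ b))" by metis
  have inj: "inj_on word_mono B"
    by (intro inj_onI, drule arg_cong[where f = Poly_Mapping.keys]) simp
  have ip_expand: "ip x r = (\<Sum>w\<in>Poly_Mapping.keys r. Poly_Mapping.lookup r w * ip x (word_mono (letters w)))" for x r
  proof -
    have "ip x r = ip x (\<Sum>w\<in>Poly_Mapping.keys r. Poly_Mapping.single w (Poly_Mapping.lookup r w))"
      by (simp add: sum_monomials)
    also have "\<dots> = (\<Sum>w\<in>Poly_Mapping.keys r. ip x (Poly_Mapping.single 0 (Poly_Mapping.lookup r w) * word_mono (letters w)))"
      by (simp add: sum_distrib_left \<tau>_sum mult_single)
    finally show ?thesis using gns.ip_smult_right[of x] by simp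
  qed
  have ip_mono: "ip x (word_mono w) = (\<Sum>b\<in>B. of_real (C w b) * ip x (word_mono b))" for x w
  proof -
    have *: "ip x (word_mono v) = (\<Sum>u\<in>Poly_Mapping.keys x. cnj (Poly_Mapping.lookup x u) * of_real (l (rev (letters u) @ v)))" for v
      unfolding expand by (simp add: keys_cstar sum.reindex[OF inj_on_word_rev] lookup_cstar)
    have "ip x (word_mono w) = (\<Sum>u\<in>Poly_Mapping.keys x. \<Sum>b\<in>B. of_real (C w b) *
        (cnj (Poly_Mapping.lookup x u) * of_real (l (rev (letters u) @ b))))"
      unfolding * by (subst C) (simp add: sum_distrib_left mult_ac)
    also have "\<dots> = (\<Sum>b\<in>B. of_real (C w b) * ip x (word_mono b))"
      unfolding * by (subst sum.swap) (simp add: sum_distrib_left)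
    finally show ?thesis .
  qed
  \<comment> \<open>The columns that span the moment matrix belong to words spanning the GNS space
    up to null vectors.\<close>
  have span: "\<exists>c. \<forall>x. ip x r = (\<Sum>b\<in>word_mono ` B. c b * ip x b)" for r
  proof -
    define c where "c b = (\<Sum>w\<in>Poly_Mapping.keys r. Poly_Mapping.lookup r w * of_real (C (letters w) b))" for b
    have "ip x r = (\<Sum>b\<in>word_mono ` B. c (the_inv_into B word_mono b) * ip x b)" for x
    proof -
      have "ip x r = (\<Sum>w\<in>Poly_Mapping.keys r. Poly_Mapping.lookup r w *
          (\<Sum>b\<in>B. of_real (C (letters w) b) * ip x (word_mono b)))"
        unfolding ip_expand[of x r] by (intro sum.cong refl arg_cong2[where f = "(*)"] ip_mono)
      also have "\<dots> = (\<Sum>w\<in>Poly_Mapping.keys r. \<Sum>b\<in>B.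
          Poly_Mapping.lookup r w * of_real (C (letters w) b) * ip x (word_mono b))"
        by (simp add: sum_distrib_left mult.assoc)
      also have "\<dots> = (\<Sum>b\<in>B. c b * ip x (word_mono b))"
        by (subst sum.swap) (simp add: c_def sum_distrib_right)
      finally show ?thesis by (simp add: sum.reindex[OF inj] the_inv_into_f_f[OF inj])
    qed
    then show ?thesis by (intro exI[of _ "\<lambda>b. c (the_inv_into B word_mono b)"] allI)
  qed
  show "xi_f V E \<le> ereal (L 1)"
    unfolding \<tau>1[symmetric]
    by (rule xi_f_le_trace[OF G V finite_imageI[OF B(1)] span hermX idemX orth \<tau>X])
qed

section \<open>Moments of matrix and C*-algebra models\<close>

text \<open>Vectors with finitely many coordinates, by induction on the coordinates: the residuals
  modulo \<open>B\<close> live in the new coordinate \<open>s\<close> alone, so they are multiples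
  of the residual of one \<open>w0\<close>.\<close>

lemma finite_spanning_subfamily:
  fixes F :: "'i \<Rightarrow> 's \<Rightarrow> real"
  assumes "finite S"
  shows "\<exists>B. finite B \<and> B \<subseteq> I \<and> (\<forall>w\<in>I. \<exists>c. \<forall>s\<in>S. F w s = (\<Sum>b\<in>B. c b * F b s))"
  using assms
proof (induction S rule: finite_induct)
  case empty
  show ?case by (intro exI[of _ "{}"]) auto
next
  case (insert s S)
  then obtain B c where B: "finite B" "B \<subseteq> I"
    and c: "\<And>w t. w \<in> I \<Longrightarrow> t \<in> S \<Longrightarrow> F w t = (\<Sum>b\<in>B. c w b * F b t)"
    by metis
  define r where "r w t = F w t - (\<Sum>b\<in>B. c w b * F b t)" for w t
  have r0: "r w t = 0" if "w \<in> I" "t \<in> S" for w t using c[OF that] by (simp add: r_def)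
  show ?case
  proof (cases "\<exists>w0\<in>I. r w0 s \<noteq> 0")
    case False
    then have "F w t = (\<Sum>b\<in>B. c w b * F b t)" if "w \<in> I" "t \<in> insert s S" for w t
      using that r0[of w t] by (auto simp: r_def)
    then show ?thesis using B by (intro exI[of _ B]) blast
  next
    case True
    then obtain w0 where w0: "w0 \<in> I" "r w0 s \<noteq> 0" by blast
    \<comment> \<open>Two summands, because \<open>w0\<close> may already belong to
      \<open>B\<close>; its two coefficients then add up.\<close>
    define c' where "c' w b = (if b \<in> B then c w b - r w s / r w0 s * c w0 b else 0) +
      (if b = w0 then r w s / r w0 s else 0)" for w b
    have "F w t = (\<Sum>b\<in>insert w0 B. c' w b * F b t)" if "w \<in> I" "t \<in> insert s S" for w t
    proof -
      let ?q = "r w s / r w0 s"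
      have "(\<Sum>b\<in>insert w0 B. c' w b * F b t)
          = (\<Sum>b\<in>insert w0 B. (if b \<in> B then c w b - ?q * c w0 b else 0) * F b t) +
            (\<Sum>b\<in>insert w0 B. (if b = w0 then ?q else 0) * F b t)"
        by (simp add: c'_def distrib_right sum.distrib)
      also have "(\<Sum>b\<in>insert w0 B. (if b \<in> B then c w b - ?q * c w0 b else 0) * F b t)
          = (\<Sum>b\<in>B. (c w b - ?q * c w0 b) * F b t)"
        using B(1) by (intro sum.mono_neutral_cong_right) auto
      also have "\<dots> = (\<Sum>b\<in>B. c w b * F b t) - ?q * (\<Sum>b\<in>B. c w0 b * F b t)"
        by (simp add: left_diff_distrib sum_subtractf sum_distrib_left mult.assoc)
      also have "(\<Sum>b\<in>insert w0 B. (if b = w0 then ?q else 0) * F b t)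
          = (\<Sum>b\<in>insert w0 B. if b = w0 then ?q * F b t else 0)"
        by (intro sum.cong) auto
      also have "\<dots> = ?q * F w0 t" using B(1) by simp
      also have "(\<Sum>b\<in>B. c w b * F b t) - ?q * (\<Sum>b\<in>B. c w0 b * F b t) + ?q * F w0 t
          = F w t - r w t + ?q * r w0 t"
        unfolding r_def[of w t] r_def[of w0 t] by (simp add: right_diff_distrib)
      also have "\<dots> = F w t" using that r0 w0 by auto
      finally show ?thesis by simp
    qed
    then show ?thesis using B w0(1) by (intro exI[of _ "insert w0 B"]) blast
  qed
qed

text \<open>A Gram matrix of vectors in a fixed finite-dimensional space has finite rank. Real
  coefficients are required, so real and imaginary parts become separate coordinates.\<close>

lemma finite_columns_gram:
  fixes f :: "'v list \<Rightarrow> 't \<Rightarrow> complex"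
  assumes T: "finite T"
    and l: "\<And>u w. u \<in> lists V \<Longrightarrow> w \<in> lists V \<Longrightarrow> l (rev u @ w) = Re (\<Sum>t\<in>T. cnj (f u t) * f w t)"
  shows "finite_columns V l"
proof -
  define F where "F w s = (if snd s then Re (f w (fst s)) else Im (f w (fst s)))" for w and s :: "'t \<times> bool"
  define S where "S = T \<times> (UNIV :: bool set)"
  have S: "finite S" using T by (simp add: S_def)
  have lF: "l (rev u @ w) = (\<Sum>s\<in>S. F u s * F w s)" if "u \<in> lists V" "w \<in> lists V" for u w
  proof -
    have "(\<Sum>s\<in>S. F u s * F w s) = (\<Sum>t\<in>T. \<Sum>b\<in>UNIV. F u (t, b) * F w (t, b))"
      by (simp add: S_def sum.cartesian_product)
    also have "\<dots> = (\<Sum>t\<in>T. Re (f u t) * Re (f w t) + Im (f u t) * Im (f w t))"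
      by (simp add: F_def UNIV_bool add.commute)
    finally show ?thesis using l[OF that] by simp
  qed
  obtain B where B: "finite B" "B \<subseteq> lists V"
    and "\<And>w. w \<in> lists V \<Longrightarrow> \<exists>c. \<forall>s\<in>S. F w s = (\<Sum>b\<in>B. c b * F b s)"
    using finite_spanning_subfamily[OF S, of "lists V" F] by metis
  then obtain c where c: "\<And>w s. w \<in> lists V \<Longrightarrow> s \<in> S \<Longrightarrow> F w s = (\<Sum>b\<in>B. c w b * F b s)"
    by metis
  have "l (rev u @ w) = (\<Sum>b\<in>B. c w b * l (rev u @ b))" if u: "u \<in> lists V" and w: "w \<in> lists V" for u w
  proof -
    have "l (rev u @ w) = (\<Sum>s\<in>S. \<Sum>b\<in>B. c w b * (F u s * F b s))"
      using lF[OF u w] c[OF w] by (simp add: sum_distrib_left mult_ac)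
    also have "\<dots> = (\<Sum>b\<in>B. c w b * (\<Sum>s\<in>S. F u s * F b s))"
      by (subst sum.swap) (simp add: sum_distrib_left)
    also have "\<dots> = (\<Sum>b\<in>B. c w b * l (rev u @ b))"
    proof (intro sum.cong refl)
      fix b assume "b \<in> B"
      then have "b \<in> lists V" using B(2) by blast
      from lF[OF u this] show "c w b * (\<Sum>s\<in>S. F u s * F b s) = c w b * l (rev u @ b)" by simp
    qed
    finally show ?thesis .
  qed
  then show ?thesis
    unfolding finite_columns_def using B by (intro exI[of _ B]) blast
qed

lemma finite_rank_of_finite_columns:
  fixes V :: "'v set"
  assumes "finite_columns V l"
  shows "finite_rank (words V) (\<lambda>u w. l (rev (letters u) @ letters w))"
proof -
  obtain B where B: "finite B" "B \<subseteq> lists V"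
    and "\<forall>w\<in>lists V. \<exists>c. \<forall>u\<in>lists V. l (rev u @ w) = (\<Sum>b\<in>B. c b * l (rev u @ b))"
    using assms unfolding finite_columns_def by (elim exE conjE)
  then obtain c where c: "\<And>u w. w \<in> lists V \<Longrightarrow> u \<in> lists V \<Longrightarrow>
      l (rev u @ w) = (\<Sum>b\<in>B. c w b * l (rev u @ b))"
    by metis
  have inj: "inj_on NC_Word B" by (auto intro: inj_onI)
  show ?thesis
    unfolding finite_rank_def
  proof (intro exI[of _ "NC_Word ` B"] conjI ballI)
    fix w :: "'v nc_word" assume w: "w \<in> words V"
    show "\<exists>c. \<forall>u\<in>words V. l (rev (letters u) @ letters w) =
        (\<Sum>b\<in>NC_Word ` B. c b * l (rev (letters u) @ letters b))"
      using c[of "letters w"] w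
      by (intro exI[of _ "\<lambda>b. c (letters w) (letters b)"] ballI) (simp add: words_iff sum.reindex[OF inj] del: in_lists_conv_set lists_eq_set)
  qed (use B in \<open>auto simp: words_def subset_iff\<close>)
qed

lemma xi_col_inf_le:
  assumes "finite_graph V E" "col_moments V E l"
  shows "xi_col_inf V E \<le> ereal (l [])"
  using col_feasible_ext(1,2)[OF assms] unfolding xi_col_inf_def
  by (intro Inf_lower CollectI exI[of _ "ext (\<lambda>w. l (letters w))"]) simp

lemma xi_col_star_le:
  assumes "finite_graph V E" "col_moments V E l" "finite_columns V l"
  shows "xi_col_star V E \<le> ereal (l [])"
proof -
  define L where "L = ext (\<lambda>w. l (letters w))"
  note L = col_feasible_ext[OF assms(1,2), folded L_def]
  have "moment_matrix L = (\<lambda>u w. l (rev (letters u) @ letters w))" using L(3) by blast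
  then have "finite_rank (words V) (moment_matrix L)"
    using finite_rank_of_finite_columns[OF assms(3)] by simp
  then show ?thesis
    unfolding xi_col_star_def using L(1,2) by (intro Inf_lower CollectI exI[of _ L]) simp
qed

lemma trace_mat_comm:
  assumes "A \<in> carrier_mat d d" "B \<in> carrier_mat d d"
  shows "trace_mat (A * B) = trace_mat (B * A)"
proof -
  have "trace_mat (A * B) = (\<Sum>i<d. \<Sum>k<d. A $$ (i, k) * B $$ (k, i))"
    using assms by (simp add: trace_mat_def mat_mult_index[OF assms] del: index_mult_mat(1))
  also have "\<dots> = (\<Sum>k<d. \<Sum>i<d. B $$ (k, i) * A $$ (i, k))"
    by (subst sum.swap) (simp add: mult.commute)
  also have "\<dots> = trace_mat (B * A)"
    using assms by (simp add: trace_mat_def mat_mult_index[OF assms(2,1)] del: index_mult_mat(1))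
  finally show ?thesis .
qed

text \<open>The moments are traces of words divided by \<open>r\<close>, so that letters have moment
  1 and the empty word has d / r. The moment matrix is a Gram matrix for the Hilbert-Schmidt product
  on d by d matrices, hence of finite rank.\<close>

theorem xi_col_star_le_xi_f:
  assumes G: "finite_graph V E"
  shows "xi_col_star V E \<le> xi_f V E"
  unfolding xi_f_def
proof (rule Inf_greatest, safe)
  fix d r X
  assume d: "1 \<le> d" and r: "1 \<le> r" and X: "\<forall>i\<in>V. X i \<in> carrier_mat d d \<and> mat_adjoint (X i) = X i \<and>
      trace_mat (X i) = of_nat r \<and> X i * X i = X i"
    and orth: "\<forall>i j. {i, j} \<in> E \<longrightarrow> X i * X j = 0\<^sub>m d d"
  define W where "W w = foldr (\<lambda>i M. X i * M) w (1\<^sub>m d)" for w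
  have Xc: "X i \<in> carrier_mat d d" if "i \<in> V" for i using X that by blast
  have Wc: "W w \<in> carrier_mat d d" if "w \<in> lists V" for w
    using that by (induction w) (auto simp: W_def intro: mult_carrier_mat[OF Xc])
  have W_Cons: "W (i # w) = X i * W w" for i w by (simp add: W_def)
  have W_single: "W [i] = X i" if "i \<in> V" for i using Xc[OF that] by (simp add: W_def)
  have W_append: "W (u @ w) = W u * W w" if "u \<in> lists V" "w \<in> lists V" for u w
    using that(1)
  proof (induction u)
    case Nil
    then show ?case using Wc[OF that(2)] by (simp add: W_def)
  next
    case (Cons i u)
    then show ?case
      using assoc_mult_mat[OF Xc Wc Wc[OF that(2)], of i u] by (simp add: W_Cons)
  qed
  have hX: "X i $$ (a, b) = cnj (X i $$ (b, a))" if "i \<in> V" "a < d" "b < d" for i a b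
    using X that mat_adjoint_eq_iff[OF Xc[OF that(1)]] by blast
  have W_rev: "W (rev w) $$ (a, b) = cnj (W w $$ (b, a))" if "w \<in> lists V" "a < d" "b < d" for w a b
    using that
  proof (induction w arbitrary: a b rule: list.induct)
    case Nil
    then show ?case by (simp add: W_def)
  next
    case (Cons i w)
    then have i: "i \<in> V" "w \<in> lists V" "rev w \<in> lists V" "[i] \<in> lists V" by auto
    have "W (rev (i # w)) $$ (a, b) = (W (rev w) * X i) $$ (a, b)"
      using W_append[OF i(3,4)] W_single[OF i(1)] by simp
    also have "\<dots> = (\<Sum>k<d. W (rev w) $$ (a, k) * X i $$ (k, b))"
      by (rule mat_mult_index[OF Wc[OF i(3)] Xc[OF i(1)] Cons.prems(2,3)])
    also have "\<dots> = (\<Sum>k<d. cnj (X i $$ (b, k) * W w $$ (k, a)))"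
    proof (intro sum.cong refl)
      fix k assume "k \<in> {..<d}"
      then show "W (rev w) $$ (a, k) * X i $$ (k, b) = cnj (X i $$ (b, k) * W w $$ (k, a))"
        using Cons.IH[of a k] hX[OF i(1), of k b] Cons.prems i by simp
    qed
    also have "\<dots> = cnj ((X i * W w) $$ (b, a))"
      using mat_mult_index[OF Xc[OF i(1)] Wc[OF i(2)] Cons.prems(3,2)] by simp
    finally show ?case by (simp add: W_Cons)
  qed
  define l where "l w = Re (trace_mat (W w)) / real r" for w
  have gram: "l (rev u @ w) = Re (\<Sum>t\<in>{..<d} \<times> {..<d}. cnj (W u $$ t) * W w $$ t) / real r"
    if u: "u \<in> lists V" and w: "w \<in> lists V" for u w
  proof -
    have ru: "rev u \<in> lists V" using u by auto
    have "trace_mat (W (rev u @ w)) = (\<Sum>b<d. \<Sum>a<d. W (rev u) $$ (b, a) * W w $$ (a, b))"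
      using Wc[OF ru] Wc[OF w] 
      by (simp add: W_append[OF ru w] trace_mat_def mat_mult_index[OF Wc[OF ru] Wc[OF w]] del: index_mult_mat(1))
    also have "\<dots> = (\<Sum>b<d. \<Sum>a<d. cnj (W u $$ (a, b)) * W w $$ (a, b))"
      using W_rev[OF u] by (intro sum.cong refl) simp
    also have "\<dots> = (\<Sum>t\<in>{..<d} \<times> {..<d}. cnj (W u $$ t) * W w $$ t)"
      by (subst sum.swap) (simp add: sum.cartesian_product case_prod_unfold)
    finally show ?thesis by (simp add: l_def)
  qed
  have trace1: "trace_mat (1\<^sub>m d) = of_nat d" by (simp add: trace_mat_def)
  have "col_moments V E l"
    unfolding col_moments_def tracial_moments_def
  proof (intro conjI ballI allI impI)
    fix u w assume uw: "u \<in> lists V" "w \<in> lists V"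
    show "l (u @ w) = l (w @ u)"
      using trace_mat_comm[OF Wc[OF uw(1)] Wc[OF uw(2)]] W_append uw by (simp add: l_def)
  next
    fix w assume w: "w \<in> lists V"
    then have rw: "rev w \<in> lists V" by auto
    have "trace_mat (W (rev w)) = (\<Sum>a<d. cnj (W w $$ (a, a)))"
      using Wc[OF rw] W_rev[OF w] by (simp add: trace_mat_def)
    also have "\<dots> = cnj (trace_mat (W w))" using Wc[OF w] by (simp add: trace_mat_def)
    finally show "l (rev w) = l w" by (simp add: l_def)
  next
    fix K and c :: "'a list \<Rightarrow> real" assume K: "finite K \<and> K \<subseteq> lists V"
    interpret semi_inner UNIV "\<lambda>x y i. x i + y i" "\<lambda>c x i. c * x i"
      "\<lambda>x y. \<Sum>i\<in>{..<d} \<times> {..<d}. cnj (x i) * y i" by (rule semi_inner_functions)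
    have "0 \<le> (\<Sum>u\<in>K. \<Sum>w\<in>K. c u * c w * Re (\<Sum>t\<in>{..<d} \<times> {..<d}. cnj (W u $$ t) * W w $$ t)) / real r"
      using gram_nonneg[of K "\<lambda>w t. W w $$ t" c] K by simp
    also have "\<dots> = (\<Sum>u\<in>K. \<Sum>w\<in>K. c u * c w * l (rev u @ w))"
      unfolding sum_divide_distrib using K by (intro sum.cong refl) (simp add: gram subset_iff)
    finally show "0 \<le> (\<Sum>u\<in>K. \<Sum>w\<in>K. c u * c w * l (rev u @ w))" .
  next
    fix i assume "i \<in> V"
    then show "l [i] = 1" using X r by (simp add: l_def W_single)
  next
    fix w i assume w: "w \<in> lists V" and i: "i \<in> V"
    have "W [i, i] = W [i]" using X i W_single[OF i] W_Cons[of i "[i]"] by simp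
    then show "l (w @ [i, i]) = l (w @ [i])"
      using W_append[OF w, of "[i, i]"] W_append[OF w, of "[i]"] i by (simp add: l_def)
  next
    fix w i j assume w: "w \<in> lists V" and e: "{i, j} \<in> E"
    then have ij: "i \<in> V" "j \<in> V" using G by (auto simp: finite_graph_def)
    have "W [i, j] = 0\<^sub>m d d" using orth e W_single[OF ij(2)] W_Cons[of i "[j]"] by simp
    then have "W (w @ [i, j]) = 0\<^sub>m d d"
      using W_append[OF w, of "[i, j]"] ij right_mult_zero_mat[OF Wc[OF w]] by simp
    then show "l (w @ [i, j]) = 0" by (simp add: l_def trace_mat_def)
  qed
  moreover have "finite_columns V l"
  proof (rule finite_columns_gram)
    fix u w assume "u \<in> lists V" "w \<in> lists V"
    \<comment> \<open>The factor 1 / r is split into two square roots to give the exact Gram form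
      that \<open>finite_columns_gram\<close> expects.\<close>
    have s: "complex_of_real (1 / sqrt (real r)) * of_real (1 / sqrt (real r)) = of_real (1 / real r)"
      unfolding of_real_mult[symmetric] by simp
    show "l (rev u @ w) = Re (\<Sum>t\<in>{..<d} \<times> {..<d}.
        cnj (of_real (1 / sqrt (real r)) * W u $$ t) * (of_real (1 / sqrt (real r)) * W w $$ t))"
    proof -
      have "(\<Sum>t\<in>{..<d} \<times> {..<d}. cnj (of_real (1 / sqrt (real r)) * W u $$ t) *
          (of_real (1 / sqrt (real r)) * W w $$ t)) = (\<Sum>t\<in>{..<d} \<times> {..<d}. of_real (1 / real r) * (cnj (W u $$ t) * W w $$ t))"
        unfolding s[symmetric] by (intro sum.cong refl) simp
      also have "\<dots> = of_real (1 / real r) * (\<Sum>t\<in>{..<d} \<times> {..<d}. cnj (W u $$ t) * W w $$ t)"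
        by (rule sum_distrib_left[symmetric])
      finally show ?thesis
        using gram[OF \<open>u \<in> lists V\<close> \<open>w \<in> lists V\<close>] by (simp del: of_real_divide)
    qed
  qed simp
  ultimately have "xi_col_star V E \<le> ereal (l [])" by (rule xi_col_star_le[OF G])
  also have "l [] = real d / real r" by (simp add: l_def W_def trace1)
  finally show "xi_col_star V E \<le> ereal (real d / real r)" .
qed

text \<open>Scaling the state by \<open>l\<close> gives the letters moment 1 and the empty word
  moment \<open>l\<close>.\<close>

theorem xi_col_inf_le_xi_tr:
  assumes G: "finite_graph V E"
  shows "xi_col_inf V E \<le> xi_tr TYPE('u) V E"
  unfolding xi_tr_def
proof (rule Inf_greatest, safe)
  fix l :: real and A :: "'u star_algebra" and \<tau> X
  assume l: "0 < l" and "unital_cstar_algebra A" and \<tau>: "tracial_state A \<tau>"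
    and X: "\<forall>i\<in>V. projector A (X i) \<and> \<tau> (X i) = complex_of_real (1 / l)"
    and orth: "\<forall>i j. {i, j} \<in> E \<longrightarrow> X i \<otimes>\<^bsub>A\<^esub> X j = \<zero>\<^bsub>A\<^esub>"
  interpret unital_cstar_algebra A by fact
  have "semiring A" "Group.monoid A" by unfold_locales
  note distr = semiring.r_distr[OF this(1)] semiring.l_distr[OF this(1)]
    and mult_assoc = monoid.m_assoc[OF this(2)]
  have \<tau>_add: "\<tau> (x \<oplus>\<^bsub>A\<^esub> y) = \<tau> x + \<tau> y" and \<tau>_comm: "\<tau> (x \<otimes>\<^bsub>A\<^esub> y) = \<tau> (y \<otimes>\<^bsub>A\<^esub> x)"
    if "x \<in> carrier A" "y \<in> carrier A" for x y
    using \<tau> that by (auto simp: tracial_state_def)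
  have \<tau>_smult: "\<tau> (c \<odot>\<^bsub>A\<^esub> x) = c * \<tau> x" and \<tau>_pos: "\<tau> (star A x \<otimes>\<^bsub>A\<^esub> x) \<in> \<real>\<^sub>\<ge>\<^sub>0"
    if "x \<in> carrier A" for x c
    using \<tau> that by (auto simp: tracial_state_def)
  have \<tau>_one: "\<tau> \<one>\<^bsub>A\<^esub> = 1" using \<tau> by (simp add: tracial_state_def)
  have sm: "c \<odot>\<^bsub>A\<^esub> x \<in> carrier A" if "x \<in> carrier A" for c x
    using smult_closed[of c x] that by (simp add: complex_ring_def)
  have star_one: "star A \<one>\<^bsub>A\<^esub> = \<one>\<^bsub>A\<^esub>"
    using star_mult[of "star A \<one>\<^bsub>A\<^esub>" "\<one>\<^bsub>A\<^esub>"] star_closed star_star by simp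
  define ip where "ip x y = \<tau> (star A x \<otimes>\<^bsub>A\<^esub> y)" for x y
  have ip_expand: "ip x (y \<oplus>\<^bsub>A\<^esub> z) = ip x y + ip x z" "ip (y \<oplus>\<^bsub>A\<^esub> z) x = ip y x + ip z x"
    "ip x (c \<odot>\<^bsub>A\<^esub> y) = c * ip x y" "ip (c \<odot>\<^bsub>A\<^esub> x) y = cnj c * ip x y"
    if "x \<in> carrier A" "y \<in> carrier A" "z \<in> carrier A" for x y z c
    using that by (simp_all add: ip_def distr star_add star_closed \<tau>_add star_smult
        smult_mult_left smult_mult_right \<tau>_smult)
  \<comment> \<open>\<open>tracial_state\<close> contains no rule for \<tau> at adjoints; conjugate
    symmetry comes from positivity by polarization.\<close>
  interpret gns: semi_inner "carrier A" "\<lambda>x y. x \<oplus>\<^bsub>A\<^esub> y" "\<lambda>c x. c \<odot>\<^bsub>A\<^esub> x" ip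
  proof
    fix x y assume "x \<in> carrier A" "y \<in> carrier A"
    then show "ip y x = cnj (ip x y)"
      by (rule hermitian_of_real_diagonal[where C = "carrier A" and pl = "\<lambda>x y. x \<oplus>\<^bsub>A\<^esub> y" and sm = "\<lambda>c x. c \<odot>\<^bsub>A\<^esub> x"])
        (use ip_expand sm \<tau>_pos in \<open>auto simp: ip_def complex_nonneg_Reals_iff\<close>)
  qed (use ip_expand sm \<tau>_pos in \<open>auto simp: ip_def complex_nonneg_Reals_iff\<close>)
  define W where "W w = foldr (\<lambda>i y. X i \<otimes>\<^bsub>A\<^esub> y) w \<one>\<^bsub>A\<^esub>" for w
  have Xc: "X i \<in> carrier A" "star A (X i) = X i" "X i \<otimes>\<^bsub>A\<^esub> X i = X i" if "i \<in> V" for i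
    using X that by (auto simp: projector_def)
  have Wc: "W w \<in> carrier A" if "w \<in> lists V" for w
    using that by (induction w) (auto simp: W_def Xc)
  have W_Cons: "W (i # w) = X i \<otimes>\<^bsub>A\<^esub> W w" for i w by (simp add: W_def)
  have W_single: "W [i] = X i" if "i \<in> V" for i using Xc[OF that] by (simp add: W_def)
  have W_append: "W (u @ w) = W u \<otimes>\<^bsub>A\<^esub> W w" if "u \<in> lists V" "w \<in> lists V" for u w
    using that(1)
  proof (induction u)
    case Nil
    then show ?case using Wc[OF that(2)] by (simp add: W_def)
  next
    case (Cons i u)
    then show ?case using Xc Wc that by (simp add: W_Cons mult_assoc)
  qed
  have W_rev: "W (rev w) = star A (W w)" if "w \<in> lists V" for w
    using that
  proof (induction w)
    case Nil
    then show ?case by (simp add: W_def star_one)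
  next
    case (Cons i w)
    then have i: "i \<in> V" "w \<in> lists V" "rev w \<in> lists V" "[i] \<in> lists V" by auto
    show ?case
      using W_append[OF i(3,4)] W_single[OF i(1)] Cons.IH Xc[OF i(1)] Wc[OF i(2)] by (simp add: W_Cons star_mult)
  qed
  define m where "m w = l * Re (\<tau> (W w))" for w
  have gram: "m (rev u @ w) = l * Re (ip (W u) (W w))" if u: "u \<in> lists V" and w: "w \<in> lists V" for u w
  proof -
    have "rev u \<in> lists V" using u by auto
    from W_append[OF this w] show ?thesis by (simp add: m_def ip_def W_rev[OF u])
  qed
  have "col_moments V E m"
    unfolding col_moments_def tracial_moments_def
  proof (intro conjI ballI allI impI)
    fix u w assume uw: "u \<in> lists V" "w \<in> lists V"
    show "m (u @ w) = m (w @ u)"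
      using \<tau>_comm[OF Wc[OF uw(1)] Wc[OF uw(2)]] W_append uw by (simp add: m_def)
  next
    fix w assume w: "w \<in> lists V"
    have "\<tau> (star A (W w)) = cnj (\<tau> (W w))"
      using gns.ip_commute[of "\<one>\<^bsub>A\<^esub>" "W w"] Wc[OF w] star_closed[OF Wc[OF w]]
      by (simp add: ip_def star_one)
    then show "m (rev w) = m w" by (simp add: m_def W_rev[OF w])
  next
    fix K and c :: "'a list \<Rightarrow> real" assume K: "finite K \<and> K \<subseteq> lists V"
    have "0 \<le> l * (\<Sum>u\<in>K. \<Sum>w\<in>K. c u * c w * Re (ip (W u) (W w)))"
      using gns.gram_nonneg[of K W c] K Wc l by (simp add: subset_iff)
    also have "\<dots> = (\<Sum>u\<in>K. \<Sum>w\<in>K. c u * c w * m (rev u @ w))"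
      unfolding sum_distrib_left using K by (intro sum.cong refl) (simp add: gram subset_iff)
    finally show "0 \<le> (\<Sum>u\<in>K. \<Sum>w\<in>K. c u * c w * m (rev u @ w))" .
  next
    fix i assume "i \<in> V"
    then show "m [i] = 1" using X l by (simp add: m_def W_single)
  next
    fix w i assume w: "w \<in> lists V" and i: "i \<in> V"
    have "W [i, i] = W [i]" using Xc[OF i] W_single[OF i] W_Cons[of i "[i]"] by simp
    then show "m (w @ [i, i]) = m (w @ [i])"
      using W_append[OF w, of "[i, i]"] W_append[OF w, of "[i]"] i by (simp add: m_def)
  next
    fix w i j assume w: "w \<in> lists V" and e: "{i, j} \<in> E"
    then have ij: "i \<in> V" "j \<in> V" using G by (auto simp: finite_graph_def)
    have "W [i, j] = \<zero>\<^bsub>A\<^esub>" using orth e W_single[OF ij(2)] W_Cons[of i "[j]"] by simp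
    then have "W (w @ [i, j]) = \<zero>\<^bsub>A\<^esub>"
      using W_append[OF w, of "[i, j]"] ij Wc[OF w] by simp
    moreover have "\<tau> \<zero>\<^bsub>A\<^esub> = 0" using \<tau>_add[of "\<zero>\<^bsub>A\<^esub>" "\<zero>\<^bsub>A\<^esub>"] by simp
    ultimately show "m (w @ [i, j]) = 0" by (simp add: m_def)
  qed
  then have "xi_col_inf V E \<le> ereal (m [])" by (rule xi_col_inf_le[OF G])
  also have "m [] = l" by (simp add: m_def W_def \<tau>_one)
  finally show "xi_col_inf V E \<le> ereal l" .
qed

section \<open>Synchronous correlations\<close>

context semi_inner
begin

definition weq :: "'c \<Rightarrow> 'c \<Rightarrow> bool" where
  "weq x y \<longleftrightarrow> (\<forall>z\<in>C. ip z x = ip z y)"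

definition psd :: "('c \<Rightarrow> 'c) \<Rightarrow> bool" where
  "psd T \<longleftrightarrow> (\<forall>x\<in>C. T x \<in> C) \<and> (\<forall>x\<in>C. \<forall>y\<in>C. weq (T (pl x y)) (pl (T x) (T y))) \<and>
     (\<forall>c. \<forall>x\<in>C. weq (T (sm c x)) (sm c (T x))) \<and> (\<forall>x\<in>C. ip x (T x) \<in> \<real>\<^sub>\<ge>\<^sub>0)"

lemma psd_closed: "psd T \<Longrightarrow> x \<in> C \<Longrightarrow> T x \<in> C"
  by (simp add: psd_def)

lemma weqD: "weq x y \<Longrightarrow> z \<in> C \<Longrightarrow> ip z x = ip z y"
  by (simp add: weq_def)

lemma weq_left: "weq x y \<Longrightarrow> x \<in> C \<Longrightarrow> y \<in> C \<Longrightarrow> z \<in> C \<Longrightarrow> ip x z = ip y z"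
  using ip_commute weqD by metis

text \<open>The form of a positive operator is again a semi-inner product, which gives hermiticity
  and a Cauchy-Schwarz inequality weighted by \<open>T\<close>.\<close>

lemma psd_form:
  assumes T: "psd T"
  shows "semi_inner C pl sm (\<lambda>x y. ip x (T y))"
proof
  note TC = psd_closed[OF T]
  have add: "ip x (T (pl y z)) = ip x (T y) + ip x (T z)" if "x \<in> C" "y \<in> C" "z \<in> C" for x y z
    using T that TC by (simp add: psd_def weq_def ip_add_right)
  have smult: "ip x (T (sm c y)) = c * ip x (T y)" if "x \<in> C" "y \<in> C" for x y c
    using T that TC by (simp add: psd_def weq_def ip_smult_right)
  have real: "Im (ip x (T x)) = 0" "Re (ip x (T x)) \<ge> 0" if "x \<in> C" for x
    using T that by (auto simp: psd_def complex_nonneg_Reals_iff)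
  show "ip y (T x) = cnj (ip x (T y))" if "x \<in> C" "y \<in> C" for x y
    by (rule hermitian_of_real_diagonal[OF that pl_closed sm_closed add _ smult _ real(1)])
      (use that TC in \<open>simp_all add: ip_add_left ip_smult_left\<close>)
qed (use nonempty pl_closed sm_closed T in \<open>auto simp: psd_def weq_def ip_add_right ip_smult_right complex_nonneg_Reals_iff\<close>)

lemma psd_hermitian:
  assumes "psd T" "x \<in> C" "y \<in> C"
  shows "ip x (T y) = ip (T x) y"
proof -
  interpret F: semi_inner C pl sm "\<lambda>x y. ip x (T y)" by (rule psd_form[OF assms(1)])
  show ?thesis using F.ip_commute[of y x] ip_commute[of y "T x"] assms psd_closed by simp
qed

lemma psd_weq: "psd T \<Longrightarrow> x \<in> C \<Longrightarrow> y \<in> C \<Longrightarrow> weq x y \<Longrightarrow> weq (T x) (T y)"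
  using psd_hermitian psd_closed by (simp add: weq_def)

text \<open>If 0 \<le> T \<le> 1, then T squared is below T: the weighted Cauchy-Schwarz inequality
  at \<open>T x\<close> and \<open>x\<close> bounds the fourth power of the norm of
  \<open>T x\<close> by its square times \<open>ip x (T x)\<close>.\<close>

lemma psd_contraction:
  assumes T: "psd T" and le: "\<And>x. x \<in> C \<Longrightarrow> Re (ip x (T x)) \<le> Re (ip x x)" and x: "x \<in> C"
  shows "Re (ip (T x) (T x)) \<le> Re (ip x (T x))"
proof -
  interpret F: semi_inner C pl sm "\<lambda>x y. ip x (T y)" by (rule psd_form[OF T])
  note Tx = psd_closed[OF T x]
  define a where "a = Re (ip (T x) (T x))"
  have a: "a \<ge> 0" using ip_nonneg[OF Tx] by (simp add: a_def)
  have "cmod (ip (T x) (T x)) = a" using ip_self_real[OF Tx] a by (metis a_def norm_of_real abs_of_nonneg)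
  then have "a\<^sup>2 \<le> Re (ip (T x) (T (T x))) * Re (ip x (T x))"
    using F.cauchy_schwarz[OF Tx x] by simp
  also have "\<dots> \<le> a * Re (ip x (T x))"
    using le[OF Tx] F.ip_nonneg[OF x] by (intro mult_right_mono) (auto simp: a_def)
  finally show ?thesis
    using a F.ip_nonneg[OF x] by (cases "a = 0") (auto simp: a_def[symmetric] power2_eq_square)
qed

text \<open>By \<open>psd_contraction\<close>, T minus its square induces a semi-inner product. The
  hypothesis says that \<open>x\<close> is null for it, so its pairing with every vector
  vanishes.\<close>

lemma psd_idempotent_at:
  assumes T: "psd T" and le: "\<And>x. x \<in> C \<Longrightarrow> Re (ip x (T x)) \<le> Re (ip x x)" and x: "x \<in> C"
    and eq: "Re (ip (T x) (T x)) = Re (ip x (T x))"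
  shows "weq (T (T x)) (T x)"
proof -
  interpret F: semi_inner C pl sm "\<lambda>x y. ip x (T y)" by (rule psd_form[OF T])
  note TC = psd_closed[OF T]
  interpret D: semi_inner C pl sm "\<lambda>x y. ip x (T y) - ip (T x) (T y)"
  proof
    fix c x y z assume xyz: "x \<in> C" "y \<in> C"
    show "ip x (T (sm c y)) - ip (T x) (T (sm c y)) = c * (ip x (T y) - ip (T x) (T y))"
      using F.ip_smult_right[OF xyz] F.ip_smult_right[OF TC[OF xyz(1)] xyz(2)] by (simp add: right_diff_distrib)
    show "ip y (T x) - ip (T y) (T x) = cnj (ip x (T y) - ip (T x) (T y))"
      using F.ip_commute[OF xyz] ip_commute[OF TC[OF xyz(1)] TC[OF xyz(2)]] by simp
    assume z: "z \<in> C"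
    show "ip x (T (pl y z)) - ip (T x) (T (pl y z)) = ip x (T y) - ip (T x) (T y) + (ip x (T z) - ip (T x) (T z))"
      using F.ip_add_right[OF xyz z] F.ip_add_right[OF TC[OF xyz(1)] xyz(2) z] by simp
  next
    fix x assume "x \<in> C"
    then show "0 \<le> Re (ip x (T x) - ip (T x) (T x))" using psd_contraction[OF T le] by simp
  qed (use nonempty pl_closed sm_closed in auto)
  have "ip z (T x) - ip (T z) (T x) = 0" if "z \<in> C" for z
    using D.ip_null(1)[OF that x] eq by simp
  then show ?thesis
    using psd_hermitian[OF T _ TC[OF x]] by (simp add: weq_def)
qed

text \<open>The locale has no finite sums of vectors, so summation to the identity is stated through
  inner products.\<close>

definition weak_povm :: "'a set \<Rightarrow> ('a \<Rightarrow> 'c \<Rightarrow> 'c) \<Rightarrow> bool" where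
  "weak_povm A F \<longleftrightarrow> (\<forall>a\<in>A. psd (F a)) \<and> (\<forall>x\<in>C. \<forall>y\<in>C. (\<Sum>a\<in>A. ip y (F a x)) = ip y x)"

lemma weak_povm_le:
  assumes "finite A" "weak_povm A F" "a \<in> A" "x \<in> C"
  shows "Re (ip x (F a x)) \<le> Re (ip x x)"
proof -
  have nonneg: "Re (ip x (F b x)) \<ge> 0" if "b \<in> A" for b
    using assms that by (auto simp: weak_povm_def psd_def complex_nonneg_Reals_iff)
  have "Re (ip x x) = (\<Sum>b\<in>A. Re (ip x (F b x)))"
    using assms by (metis weak_povm_def Re_sum)
  moreover have "Re (ip x (F a x)) \<le> (\<Sum>b\<in>A. Re (ip x (F b x)))"
    using assms nonneg by (intro member_le_sum) auto
  ultimately show ?thesis by simp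
qed

text \<open>Since \<open>\<Sum>a. \<parallel>X a \<psi> - Y a \<psi>\<parallel>\<^sup>2 \<le> 1 + 1 - 2\<close>, synchronicity forces equality throughout.\<close>

lemma synchronous_povms:
  assumes A: "finite A" and \<psi>: "\<psi> \<in> C" "ip \<psi> \<psi> = 1" and X: "weak_povm A X" and Y: "weak_povm A Y"
    and sync: "\<And>a b. a \<in> A \<Longrightarrow> b \<in> A \<Longrightarrow> a \<noteq> b \<Longrightarrow> ip \<psi> (X a (Y b \<psi>)) = 0"
    and a: "a \<in> A"
  shows "weq (X a \<psi>) (Y a \<psi>)" "weq (X a (X a \<psi>)) (X a \<psi>)"
proof -
  have psdX: "psd (X b)" and psdY: "psd (Y b)" if "b \<in> A" for b
    using X Y that by (auto simp: weak_povm_def)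
  note XC = psd_closed[OF psdX] and YC = psd_closed[OF psdY]
  \<comment> \<open>Inserting the sum of all \<open>Y b' \<psi>\<close> for \<psi> leaves only the
    term b' = b, the others vanish by synchronicity.\<close>
  have sum1: "(\<Sum>b\<in>A. ip (X b \<psi>) (Y b \<psi>)) = 1"
  proof -
    have "ip (X b \<psi>) (Y b \<psi>) = ip \<psi> (X b \<psi>)" if b: "b \<in> A" for b
    proof -
      have "ip (X b \<psi>) \<psi> = (\<Sum>b'\<in>A. ip (X b \<psi>) (Y b' \<psi>))"
        using Y \<psi> XC[OF b \<psi>(1)] by (simp add: weak_povm_def)
      also have "\<dots> = (\<Sum>b'\<in>A. if b' = b then ip (X b \<psi>) (Y b \<psi>) else 0)"
        using sync[OF b] psd_hermitian[OF psdX[OF b] \<psi>(1) YC] \<psi> by (intro sum.cong) auto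
      also have "\<dots> = ip (X b \<psi>) (Y b \<psi>)" using A b by simp
      finally show ?thesis using psd_hermitian[OF psdX[OF b] \<psi>(1) \<psi>(1)] by simp
    qed
    then have "(\<Sum>b\<in>A. ip (X b \<psi>) (Y b \<psi>)) = (\<Sum>b\<in>A. ip \<psi> (X b \<psi>))" by simp
    also have "\<dots> = 1" using X \<psi> by (simp add: weak_povm_def)
    finally show ?thesis .
  qed
  have le1: "Re (ip (F b \<psi>) (F b \<psi>)) \<le> Re (ip \<psi> (F b \<psi>))" if "weak_povm A F" "b \<in> A" for F b
    using that psd_contraction[OF _ weak_povm_le[OF A that] \<psi>(1)] by (simp add: weak_povm_def)
  have total: "(\<Sum>b\<in>A. Re (ip \<psi> (F b \<psi>))) = 1" if "weak_povm A F" for F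
    using that \<psi> by (metis weak_povm_def Re_sum one_complex.sel(1))
  define d where "d b = pl (X b \<psi>) (sm (- 1) (Y b \<psi>))" for b
  have dC: "d b \<in> C" if "b \<in> A" for b using that XC YC \<psi> by (simp add: d_def pl_closed sm_closed)
  have dd: "Re (ip (d b) (d b)) = Re (ip (X b \<psi>) (X b \<psi>)) + Re (ip (Y b \<psi>) (Y b \<psi>)) - 2 * Re (ip (X b \<psi>) (Y b \<psi>))"
    if b: "b \<in> A" for b
    using XC[OF b \<psi>(1)] YC[OF b \<psi>(1)] ip_commute[OF XC[OF b \<psi>(1)] YC[OF b \<psi>(1)]]
    by (simp add: d_def ip_expand)
  have sum_dd: "(\<Sum>b\<in>A. Re (ip (d b) (d b)))
      = (\<Sum>b\<in>A. Re (ip (X b \<psi>) (X b \<psi>))) + (\<Sum>b\<in>A. Re (ip (Y b \<psi>) (Y b \<psi>))) - 2"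
  proof -
    have "(\<Sum>b\<in>A. Re (ip (X b \<psi>) (Y b \<psi>))) = 1" using sum1 by (metis Re_sum one_complex.sel(1))
    then show ?thesis using dd by (simp add: sum.distrib sum_subtractf sum_distrib_left[symmetric])
  qed
  have leX: "(\<Sum>b\<in>A. Re (ip (X b \<psi>) (X b \<psi>))) \<le> 1"
    unfolding total[OF X, symmetric] by (intro sum_mono le1[OF X])
  have leY: "(\<Sum>b\<in>A. Re (ip (Y b \<psi>) (Y b \<psi>))) \<le> 1"
    unfolding total[OF Y, symmetric] by (intro sum_mono le1[OF Y])
  have nonneg: "(\<Sum>b\<in>A. Re (ip (d b) (d b))) \<ge> 0"
    using dC ip_nonneg by (intro sum_nonneg) blast
  have "(\<Sum>b\<in>A. Re (ip (d b) (d b))) = 0" using sum_dd leX leY nonneg by linarith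
  then have "Re (ip (d a) (d a)) = 0"
    using A a dC ip_nonneg by (subst (asm) sum_nonneg_eq_0_iff) auto
  then have "ip z (d a) = 0" if "z \<in> C" for z using ip_null(1)[OF that dC[OF a]] by simp
  then show "weq (X a \<psi>) (Y a \<psi>)"
    using XC[OF a \<psi>(1)] YC[OF a \<psi>(1)] by (simp add: weq_def d_def ip_expand)
  \<comment> \<open>Equality in \<open>psd_contraction\<close> at \<psi> holds for the sum, hence
    for each term; this is the criterion of \<open>psd_idempotent_at\<close>.\<close>
  have "(\<Sum>b\<in>A. Re (ip \<psi> (X b \<psi>)) - Re (ip (X b \<psi>) (X b \<psi>))) = 0"
    using sum_dd leX leY nonneg total[OF X] by (simp add: sum_subtractf)
  then have "Re (ip \<psi> (X a \<psi>)) - Re (ip (X a \<psi>) (X a \<psi>)) = 0"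
    using A a le1[OF X] by (subst (asm) sum_nonneg_eq_0_iff) auto
  then show "weq (X a (X a \<psi>)) (X a \<psi>)"
    using psd_idempotent_at[OF psdX[OF a] weak_povm_le[OF A X a] \<psi>(1)] by simp
qed

definition word_op :: "('v \<Rightarrow> 'c \<Rightarrow> 'c) \<Rightarrow> 'v list \<Rightarrow> 'c \<Rightarrow> 'c" where
  "word_op X w x = foldr X w x"

text \<open>The relations are known at \<psi> only, and \<open>col_moments\<close> asks for them at
  the end of words, where the operators act directly on \<psi>. Each output contributes
  \<open>ip \<psi> \<psi> = 1\<close> to the empty word, and for a single letter the outputs sum to
  1.\<close>

theorem synchronous_col_moments:
  fixes X Y :: "'v \<Rightarrow> 'a \<Rightarrow> 'c \<Rightarrow> 'c"
  assumes G: "finite_graph V E" and A: "finite A" and \<psi>: "\<psi> \<in> C" "ip \<psi> \<psi> = 1"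
    and X: "\<And>s. s \<in> V \<Longrightarrow> weak_povm A (X s)" and Y: "\<And>s. s \<in> V \<Longrightarrow> weak_povm A (Y s)"
    and commute: "\<And>a b s t x. a \<in> A \<Longrightarrow> b \<in> A \<Longrightarrow> s \<in> V \<Longrightarrow> t \<in> V \<Longrightarrow> x \<in> C \<Longrightarrow>
      weq (X s a (Y t b x)) (Y t b (X s a x))"
    and sync: "\<And>a b s. a \<in> A \<Longrightarrow> b \<in> A \<Longrightarrow> s \<in> V \<Longrightarrow> a \<noteq> b \<Longrightarrow> ip \<psi> (X s a (Y s b \<psi>)) = 0"
    and proper: "\<And>a i j. a \<in> A \<Longrightarrow> {i, j} \<in> E \<Longrightarrow> ip \<psi> (X i a (Y j a \<psi>)) = 0"
  defines "W a w \<equiv> word_op (\<lambda>i. X i a) w"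
  defines "l w \<equiv> \<Sum>a\<in>A. Re (ip \<psi> (W a w \<psi>))"
  shows "col_moments V E l" "l [] = real (card A)"
    "u \<in> lists V \<Longrightarrow> w \<in> lists V \<Longrightarrow> l (rev u @ w) = (\<Sum>a\<in>A. Re (ip (W a u \<psi>) (W a w \<psi>)))"
proof -
  have psdX: "psd (X s a)" and psdY: "psd (Y s a)" if "s \<in> V" "a \<in> A" for s a
    using X Y that by (auto simp: weak_povm_def)
  note XC = psd_closed[OF psdX] and YC = psd_closed[OF psdY]
  have xy: "weq (X s a \<psi>) (Y s a \<psi>)" "weq (X s a (X s a \<psi>)) (X s a \<psi>)" if "s \<in> V" "a \<in> A" for s a
    using synchronous_povms[OF A \<psi> X[OF that(1)] Y[OF that(1)] sync[OF _ _ that(1)] that(2)] by blast+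
  have W_Nil: "W a [] x = x" and W_Cons: "W a (i # w) x = X i a (W a w x)"
    and W_append: "W a (u @ w) x = W a u (W a w x)" for a i u w x
    by (simp_all add: W_def word_op_def)
  have WC: "W a w x \<in> C" if "a \<in> A" "w \<in> lists V" "x \<in> C" for a w x
    using that(2) by (induction w rule: list.induct) (use that XC in \<open>auto simp: W_Nil W_Cons\<close>)
  have W_adj: "ip x (W a (rev u) y) = ip (W a u x) y" if "a \<in> A" "u \<in> lists V" "x \<in> C" "y \<in> C" for a u x y
    using that(2,4)
  proof (induction u arbitrary: y rule: list.induct)
    case Nil
    then show ?case by (simp add: W_Nil)
  next
    case (Cons i u)
    then have i: "i \<in> V" "u \<in> lists V" by auto
    have "ip x (W a (rev (i # u)) y) = ip x (W a (rev u) (X i a y))" by (simp add: W_append W_Cons W_Nil)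
    also have "\<dots> = ip (W a u x) (X i a y)" using Cons i XC[OF i(1) that(1)] by blast
    also have "\<dots> = ip (W a (i # u) x) y"
      using psd_hermitian[OF psdX[OF i(1) that(1)] WC[OF that(1) i(2) that(3)] Cons.prems(2)] by (simp add: W_Cons)
    finally show ?case .
  qed
  have W_weq: "weq (W a w x) (W a w y)" if "a \<in> A" "w \<in> lists V" "x \<in> C" "y \<in> C" "weq x y" for a w x y
    using that(2)
  proof (induction w rule: list.induct)
    case Nil
    then show ?case using that by (simp add: W_Nil)
  next
    case (Cons i w)
    then show ?case using psd_weq[OF psdX WC WC] that by (simp add: W_Cons)
  qed
  have weq_trans: "weq x z" if "weq x y" "weq y z" for x y z using that by (simp add: weq_def)
  have YW: "weq (Y i a (W a w x)) (W a w (Y i a x))" if "a \<in> A" "w \<in> lists V" "x \<in> C" "i \<in> V" for a w x i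
    using that(2)
  proof (induction w rule: list.induct)
    case Nil
    then show ?case by (simp add: W_Nil weq_def)
  next
    case (Cons j w)
    then have j: "j \<in> V" "w \<in> lists V" by auto
    have "weq (Y i a (X j a (W a w x))) (X j a (Y i a (W a w x)))"
      using commute[OF that(1,1) j(1) that(4) WC[OF that(1) j(2) that(3)]] by (simp add: weq_def)
    moreover have "weq (X j a (Y i a (W a w x))) (X j a (W a w (Y i a x)))"
      using Cons.IH[OF j(2)] j that WC YC by (intro psd_weq[OF psdX]) auto
    ultimately show ?case unfolding W_Cons by (rule weq_trans)
  qed
  define \<phi> where "\<phi> a w = ip \<psi> (W a w \<psi>)" for a w
  \<comment> \<open>The first letter is moved to the left argument, exchanged there for
    \<open>Y\<close>, carried through the word by commutation, and exchanged back at \<psi>.\<close>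
  have rotate1: "\<phi> a (i # w) = \<phi> a (w @ [i])" if a: "a \<in> A" and w: "w \<in> lists V" and i: "i \<in> V" for a w i
  proof -
    note c = XC[OF i a \<psi>(1)] YC[OF i a \<psi>(1)] WC[OF a w \<psi>(1)]
    have rw: "rev w \<in> lists V" using w by auto
    have "\<phi> a (i # w) = ip (X i a \<psi>) (W a w \<psi>)"
      using psd_hermitian[OF psdX[OF i a] \<psi>(1) c(3)] by (simp add: \<phi>_def W_Cons)
    also have "\<dots> = ip (Y i a \<psi>) (W a w \<psi>)" by (rule weq_left[OF xy(1)[OF i a] c])
    also have "\<dots> = ip \<psi> (Y i a (W a w \<psi>))" using psd_hermitian[OF psdY[OF i a] \<psi>(1) c(3)] by simp
    also have "\<dots> = ip \<psi> (W a w (Y i a \<psi>))" by (rule weqD[OF YW[OF a w \<psi>(1) i] \<psi>(1)])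
    also have "\<dots> = ip \<psi> (W a w (X i a \<psi>))"
      using weqD[OF W_weq[OF a w c(1,2) xy(1)[OF i a]] \<psi>(1)] by simp
    finally show ?thesis by (simp add: \<phi>_def W_append W_Cons W_Nil)
  qed
  have tracial: "\<phi> a (u @ w) = \<phi> a (w @ u)" if a: "a \<in> A" and "u \<in> lists V" "w \<in> lists V" for a u w
    using that(2,3)
  proof (induction u arbitrary: w rule: list.induct)
    case (Cons i u)
    then have "i \<in> V" "u @ w \<in> lists V" "u \<in> lists V" "w @ [i] \<in> lists V" by auto
    then show ?case using rotate1[OF a, of "u @ w" i] Cons.IH[of "w @ [i]"] by simp
  qed simp
  have gram: "\<phi> a (rev u @ w) = ip (W a u \<psi>) (W a w \<psi>)" if "a \<in> A" "u \<in> lists V" "w \<in> lists V" for a u w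
    using W_adj[OF that(1,2) \<psi>(1) WC[OF that(1,3) \<psi>(1)]] by (simp add: \<phi>_def W_append)
  have l_\<phi>: "l w = (\<Sum>a\<in>A. Re (\<phi> a w))" for w by (simp add: l_def \<phi>_def)
  show l_gram: "l (rev u @ w) = (\<Sum>a\<in>A. Re (ip (W a u \<psi>) (W a w \<psi>)))" if "u \<in> lists V" "w \<in> lists V" for u w
    using gram that by (simp add: l_\<phi>)
  show "l [] = real (card A)" using \<psi> by (simp add: l_def W_Nil)
  show "col_moments V E l"
    unfolding col_moments_def tracial_moments_def
  proof (intro conjI ballI allI impI)
    fix u w assume "u \<in> lists V" "w \<in> lists V"
    then show "l (u @ w) = l (w @ u)" using tracial by (simp add: l_\<phi>)
  next
    fix w assume w: "w \<in> lists V"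
    have "\<phi> a (rev w) = cnj (\<phi> a w)" if "a \<in> A" for a
      using gram[OF that w, of "[]"] ip_commute[OF \<psi>(1) WC[OF that w \<psi>(1)]] by (simp add: W_Nil \<phi>_def)
    then show "l (rev w) = l w" by (simp add: l_\<phi>)
  next
    fix K and c :: "'v list \<Rightarrow> real" assume K: "finite K \<and> K \<subseteq> lists V"
    have "0 \<le> (\<Sum>a\<in>A. \<Sum>u\<in>K. \<Sum>w\<in>K. c u * c w * Re (ip (W a u \<psi>) (W a w \<psi>)))"
    proof (rule sum_nonneg)
      fix a assume "a \<in> A"
      then show "0 \<le> (\<Sum>u\<in>K. \<Sum>w\<in>K. c u * c w * Re (ip (W a u \<psi>) (W a w \<psi>)))"
        using K WC \<psi> by (intro gram_nonneg) (auto simp: subset_iff)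
    qed
    also have "\<dots> = (\<Sum>u\<in>K. \<Sum>w\<in>K. \<Sum>a\<in>A. c u * c w * Re (ip (W a u \<psi>) (W a w \<psi>)))"
      by (subst sum.swap) (intro sum.cong refl sum.swap)
    also have "\<dots> = (\<Sum>u\<in>K. \<Sum>w\<in>K. c u * c w * l (rev u @ w))"
      using K by (intro sum.cong refl) (simp add: l_gram subset_iff sum_distrib_left)
    finally show "0 \<le> (\<Sum>u\<in>K. \<Sum>w\<in>K. c u * c w * l (rev u @ w))" .
  next
    fix i assume i: "i \<in> V"
    have "(\<Sum>a\<in>A. ip \<psi> (X i a \<psi>)) = 1" using X[OF i] \<psi> by (simp add: weak_povm_def)
    then show "l [i] = 1" by (simp add: l_def W_Cons W_Nil flip: Re_sum)
  next
    fix w i assume w: "w \<in> lists V" and i: "i \<in> V"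
    have "\<phi> a (w @ [i, i]) = \<phi> a (w @ [i])" if "a \<in> A" for a
      using weqD[OF W_weq[OF that w _ _ xy(2)[OF i that]] \<psi>(1)] XC[OF i that] \<psi>
      by (simp add: \<phi>_def W_append W_Cons W_Nil)
    then show "l (w @ [i, i]) = l (w @ [i])" by (simp add: l_\<phi>)
  next
    fix w i j assume w: "w \<in> lists V" and e: "{i, j} \<in> E"
    then have ij: "i \<in> V" "j \<in> V" using G by (auto simp: finite_graph_def)
    \<comment> \<open>Properness gives only that \<open>X i a \<psi>\<close> and
      \<open>X j a \<psi>\<close> are orthogonal. The squared norm of
      \<open>X i a (X j a \<psi>)\<close> is the moment of j i i j; rotated to i i j j and shortened
      by idempotence at \<psi>, it becomes that inner product.\<close>
    have "\<phi> a (w @ [i, j]) = 0" if a: "a \<in> A" for a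
    proof -
      define x where "x = X i a (X j a \<psi>)"
      note c = XC[OF ij(1) a \<psi>(1)] XC[OF ij(2) a \<psi>(1)] YC[OF ij(2) a \<psi>(1)]
      have xC: "x \<in> C" using XC ij a c by (simp add: x_def)
      have "ip x x = \<phi> a (rev [i, j] @ [i, j])"
        using gram[OF a, of "[i, j]" "[i, j]"] ij by (simp add: x_def W_Cons W_Nil)
      also have "\<dots> = \<phi> a ([i, i, j] @ [j])" using tracial[OF a, of "[j]" "[i, i, j]"] ij by simp
      also have "\<dots> = \<phi> a (rev [i, i] @ [j, j])" by simp
      also have "\<dots> = ip (X i a (X i a \<psi>)) (X j a (X j a \<psi>))"
        using gram[OF a, of "[i, i]" "[j, j]"] ij by (simp add: W_Cons W_Nil)
      also have "\<dots> = ip (X i a \<psi>) (X j a (X j a \<psi>))"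
        using xy(2)[OF ij(1) a] XC ij a c by (intro weq_left) auto
      also have "\<dots> = ip (X i a \<psi>) (X j a \<psi>)" by (rule weqD[OF xy(2)[OF ij(2) a] c(1)])
      also have "\<dots> = ip (X i a \<psi>) (Y j a \<psi>)" by (rule weqD[OF xy(1)[OF ij(2) a] c(1)])
      also have "\<dots> = 0" using proper[OF a e] psd_hermitian[OF psdX[OF ij(1) a] \<psi>(1) c(3)] by simp
      finally have "ip z x = 0" if "z \<in> C" for z using ip_null(1)[OF that xC] by simp
      moreover have "rev w \<in> lists V" using w by auto
      ultimately show ?thesis
        using W_adj[OF a _ \<psi>(1) xC, of "rev w"] WC[OF a _ \<psi>(1), of "rev w"]
        by (simp add: \<phi>_def W_append W_Cons W_Nil x_def)
    qed
    then show "l (w @ [i, j]) = 0" by (simp add: l_\<phi>)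
  qed
qed

end

theorem xi_col_inf_le_qc:
  assumes G: "finite_graph V E" and P: "P \<in> C_qcs TYPE('u) {1..k} V" and proper: "proper_correlation k E P"
  shows "xi_col_inf V E \<le> ereal (real k)"
proof -
  have sync: "synchronous {1..k} V P" using P by (simp add: C_qcs_def)
  obtain H :: "'u inner_space" and \<psi> X Y where H: "separable_hilbert_space H"
    and \<psi>: "\<psi> \<in> carrier H" "hnorm H \<psi> = 1"
    and X: "\<forall>s\<in>V. povm_op H {1..k} (X s)" and Y: "\<forall>t\<in>V. povm_op H {1..k} (Y t)"
    and comm: "\<forall>a\<in>{1..k}. \<forall>b\<in>{1..k}. \<forall>s\<in>V. \<forall>t\<in>V. \<forall>x\<in>carrier H. X s a (Y t b x) = Y t b (X s a x)"
    and P_eq: "\<forall>a\<in>{1..k}. \<forall>b\<in>{1..k}. \<forall>s\<in>V. \<forall>t\<in>V. complex_of_real (P a b s t) = ip H \<psi> (X s a (Y t b \<psi>))"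
    using P unfolding C_qcs_def C_qc_def mem_Collect_eq by (elim conjE exE)
  interpret H: separable_hilbert_space H by fact
  have monoid: "abelian_monoid H" by unfold_locales
  interpret semi_inner "carrier H" "\<lambda>x y. x \<oplus>\<^bsub>H\<^esub> y" "\<lambda>c x. c \<odot>\<^bsub>H\<^esub> x" "ip H"
  proof
    show "carrier H \<noteq> {}" using \<psi> by blast
    show "0 \<le> Re (ip H x x)" if "x \<in> carrier H" for x
      using H.ip_nonneg[OF that] by (simp add: complex_nonneg_Reals_iff)
    show "c \<odot>\<^bsub>H\<^esub> x \<in> carrier H" if "x \<in> carrier H" for c x
      using H.smult_closed[of c x] that by (simp add: complex_ring_def)
    show "ip H y x = cnj (ip H x y)" if "x \<in> carrier H" "y \<in> carrier H" for x y
      by (rule H.ip_commute[OF that])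
  qed (use H.ip_add_right H.ip_smult_right abelian_monoid.a_closed[OF monoid] in auto)
  have zero: "\<zero>\<^bsub>H\<^esub> \<in> carrier H" "\<zero>\<^bsub>H\<^esub> \<oplus>\<^bsub>H\<^esub> \<zero>\<^bsub>H\<^esub> = \<zero>\<^bsub>H\<^esub>"
    using monoid by (simp_all add: abelian_monoid.zero_closed abelian_monoid.l_zero)
  have ip_zero: "ip H y \<zero>\<^bsub>H\<^esub> = 0" if "y \<in> carrier H" for y
    using ip_add_right[OF that zero(1) zero(1)] zero(2) by simp
  have ip_finsum: "ip H y (\<Oplus>\<^bsub>H\<^esub>a\<in>A. f a) = (\<Sum>a\<in>A. ip H y (f a))"
    if "finite A" "y \<in> carrier H" "\<And>a. a \<in> A \<Longrightarrow> f a \<in> carrier H" for y A and f :: "nat \<Rightarrow> 'u"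
    using that(1,3)
  proof (induction A rule: finite_induct)
    case empty
    then show ?case using ip_zero[OF that(2)] abelian_monoid.finsum_empty[OF monoid] by simp
  next
    case (insert a A)
    have f: "f \<in> A \<rightarrow> carrier H" "f a \<in> carrier H" using insert.prems by auto
    then show ?case
      using abelian_monoid.finsum_insert[OF monoid insert.hyps f] insert that(2)
        ip_add_right[OF that(2) f(2) abelian_monoid.finsum_closed[OF monoid f(1)]] by simp
  qed
  have povm: "weak_povm {1..k} F" if "povm_op H {1..k} F" for F
    unfolding weak_povm_def
  proof (intro conjI ballI)
    fix a assume "a \<in> {1..k}"
    then have "psd_op H (F a)" using that by (simp add: povm_op_def)
    then show "psd (F a)" by (auto simp: psd_op_def bounded_op_def psd_def weq_def)
  next
    fix x y assume xy: "x \<in> carrier H" "y \<in> carrier H"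
    have "F a x \<in> carrier H" if "a \<in> {1..k}" for a
      using that xy \<open>povm_op H {1..k} F\<close> by (auto simp: povm_op_def psd_op_def bounded_op_def)
    then show "(\<Sum>a\<in>{1..k}. ip H y (F a x)) = ip H y x"
      using ip_finsum[of "{1..k}" y "\<lambda>a. F a x"] that xy by (simp add: povm_op_def)
  qed
  have \<psi>1: "ip H \<psi> \<psi> = 1" using ip_self_real[OF \<psi>(1)] \<psi>(2) by (simp add: hnorm_def)
  have EV: "i \<in> V \<and> j \<in> V" if "{i, j} \<in> E" for i j using G that by (auto simp: finite_graph_def)
  have "ip H \<psi> (X s a (Y s b \<psi>)) = 0" if "a \<in> {1..k}" "b \<in> {1..k}" "s \<in> V" "a \<noteq> b" for a b s
  proof -
    have "P a b s s = 0" using sync that unfolding synchronous_def by blast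
    moreover have "complex_of_real (P a b s s) = ip H \<psi> (X s a (Y s b \<psi>))" using P_eq that by blast
    ultimately show ?thesis by simp
  qed
  moreover have "ip H \<psi> (X i a (Y j a \<psi>)) = 0" if "a \<in> {1..k}" "{i, j} \<in> E" for a i j
  proof -
    have "P a a i j = 0" using proper that unfolding proper_correlation_def by blast
    moreover have "complex_of_real (P a a i j) = ip H \<psi> (X i a (Y j a \<psi>))" using P_eq that EV by blast
    ultimately show ?thesis by simp
  qed
  moreover have "weq (X s a (Y t b x)) (Y t b (X s a x))"
    if "a \<in> {1..k}" "b \<in> {1..k}" "s \<in> V" "t \<in> V" "x \<in> carrier H" for a b s t x
    using comm that by (simp add: weq_def)
  moreover have "weak_povm {1..k} (X s)" "weak_povm {1..k} (Y s)" if "s \<in> V" for s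
    using X Y povm that by blast+
  ultimately have "col_moments V E (\<lambda>w. \<Sum>a\<in>{1..k}. Re (ip H \<psi> (word_op (\<lambda>i. X i a) w \<psi>)))"
    "(\<Sum>a\<in>{1..k}. Re (ip H \<psi> (word_op (\<lambda>i. X i a) [] \<psi>))) = real (card {1..k})"
    using synchronous_col_moments(1,2)[OF G _ \<psi>(1) \<psi>1, of "{1..k}" X Y] by simp_all
  then show ?thesis using xi_col_inf_le[OF G] by fastforce
qed

section \<open>Tensor products as operators on functions of index pairs\<close>

lemma sum_div_mod:
  fixes f :: "nat \<Rightarrow> 'b :: comm_monoid_add"
  shows "(\<Sum>i<d * d. f i) = (\<Sum>t\<in>{..<d} \<times> {..<d}. f (fst t * d + snd t))"
proof (rule sum.reindex_bij_witness[of _ "\<lambda>t. fst t * d + snd t" "\<lambda>i. (i div d, i mod d)"])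
  fix i assume "i \<in> {..<d * d}"
  then have "d > 0" "i < d * d" by (auto intro: gr0I)
  then show "(i div d, i mod d) \<in> {..<d} \<times> {..<d}" by (simp add: less_mult_imp_div_less)
  show "fst (i div d, i mod d) * d + snd (i div d, i mod d) = i" by simp
next
  fix t assume "t \<in> {..<d} \<times> {..<d}"
  then have t: "fst t < d" "snd t < d" by auto
  have "fst t * d + snd t < (fst t + 1) * d" using t by simp
  also have "\<dots> \<le> d * d" using t by (intro mult_right_mono) auto
  finally show "fst t * d + snd t \<in> {..<d * d}" by simp
  show "((fst t * d + snd t) div d, (fst t * d + snd t) mod d) = t"
    using t by (simp add: prod_eq_iff)
qed simp

text \<open>The action of M tensor 1; \<open>op_right\<close> is that of 1 tensor M. Working on
  pairs turns the tensor factorization into the commuting operators of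
  \<open>synchronous_col_moments\<close>.\<close>

definition op_left :: "nat \<Rightarrow> complex mat \<Rightarrow> (nat \<times> nat \<Rightarrow> complex) \<Rightarrow> nat \<times> nat \<Rightarrow> complex" where
  "op_left d M x t = (\<Sum>k<d. M $$ (fst t, k) * x (k, snd t))"

definition op_right :: "nat \<Rightarrow> complex mat \<Rightarrow> (nat \<times> nat \<Rightarrow> complex) \<Rightarrow> nat \<times> nat \<Rightarrow> complex" where
  "op_right d M x t = (\<Sum>k<d. M $$ (snd t, k) * x (fst t, k))"

lemma op_left_right_commute: "op_left d M (op_right d N x) = op_right d N (op_left d M x)"
proof
  fix t
  have "op_left d M (op_right d N x) t = (\<Sum>k<d. \<Sum>l<d. M $$ (fst t, k) * (N $$ (snd t, l) * x (k, l)))"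
    by (simp add: op_left_def op_right_def sum_distrib_left)
  also have "\<dots> = (\<Sum>l<d. \<Sum>k<d. N $$ (snd t, l) * (M $$ (fst t, k) * x (k, l)))"
    by (subst sum.swap) (simp add: mult.left_commute)
  finally show "op_left d M (op_right d N x) t = op_right d N (op_left d M x) t"
    by (simp add: op_left_def op_right_def sum_distrib_left)
qed

lemma tensor_quadratic_form:
  assumes M: "M \<in> carrier_mat d d" and N: "N \<in> carrier_mat d d" and \<psi>: "\<psi> \<in> carrier_vec (d * d)"
  shows "(tensor_mat M N *\<^sub>v \<psi>) \<bullet>c \<psi> = (\<Sum>t\<in>{..<d} \<times> {..<d}. cnj (\<psi> $ (fst t * d + snd t)) *
    op_left d M (op_right d N (\<lambda>t. \<psi> $ (fst t * d + snd t))) t)"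
proof -
  have T: "tensor_mat M N \<in> carrier_mat (d * d) (d * d)" using M N by (simp add: tensor_mat_def)
  have Tij: "tensor_mat M N $$ (i, j) = M $$ (i div d, j div d) * N $$ (i mod d, j mod d)"
    if "i < d * d" "j < d * d" for i j using M N that by (simp add: tensor_mat_def)
  have "(tensor_mat M N *\<^sub>v \<psi>) \<bullet>c \<psi>
      = (\<Sum>i<d * d. (\<Sum>j<d * d. M $$ (i div d, j div d) * N $$ (i mod d, j mod d) * \<psi> $ j) * cnj (\<psi> $ i))"
    using T Tij \<psi> by (simp add: scalar_prod_def atLeast0LessThan)
  also have "\<dots> = (\<Sum>t\<in>{..<d} \<times> {..<d}. (\<Sum>s\<in>{..<d} \<times> {..<d}.
      M $$ (fst t, fst s) * N $$ (snd t, snd s) * \<psi> $ (fst s * d + snd s)) * cnj (\<psi> $ (fst t * d + snd t)))"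
    unfolding sum_div_mod by (intro sum.cong refl arg_cong2[where f = "(*)"]) auto
  also have "\<dots> = (\<Sum>t\<in>{..<d} \<times> {..<d}. cnj (\<psi> $ (fst t * d + snd t)) *
    op_left d M (op_right d N (\<lambda>t. \<psi> $ (fst t * d + snd t))) t)"
    by (intro sum.cong refl)
      (simp add: op_left_def op_right_def sum_distrib_left sum.cartesian_product' mult_ac)
  finally show ?thesis .
qed

theorem xi_col_star_le_q:
  assumes G: "finite_graph V E" and P: "P \<in> C_qs {1..k} V" and proper: "proper_correlation k E P"
  shows "xi_col_star V E \<le> ereal (real k)"
proof -
  have sync: "synchronous {1..k} V P" using P by (simp add: C_qs_def)
  obtain d \<psi> X Y where \<psi>: "\<psi> \<in> carrier_vec (d * d)" "\<psi> \<bullet>c \<psi> = 1"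
    and X: "\<forall>s\<in>V. povm_mat d {1..k} (X s)" and Y: "\<forall>t\<in>V. povm_mat d {1..k} (Y t)"
    and P_eq: "\<forall>a\<in>{1..k}. \<forall>b\<in>{1..k}. \<forall>s\<in>V. \<forall>t\<in>V.
        complex_of_real (P a b s t) = (tensor_mat (X s a) (Y t b) *\<^sub>v \<psi>) \<bullet>c \<psi>"
    using P unfolding C_qs_def C_q_def mem_Collect_eq by (elim conjE exE)
  define T where "T = {..<d} \<times> {..<d}"
  interpret semi_inner UNIV "\<lambda>x y i. x i + y i" "\<lambda>c x i. c * x i"
    "\<lambda>x y. \<Sum>i\<in>T. cnj (x i) * y i" by (rule semi_inner_functions)
  have T_swap: "(\<Sum>t\<in>T. f t) = (\<Sum>j<d. \<Sum>i<d. f (i, j))" for f :: "nat \<times> nat \<Rightarrow> complex"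
    unfolding T_def sum.cartesian_product' by (rule sum.swap)
  have form: "(M *\<^sub>v vec d f) \<bullet>c vec d f = (\<Sum>i<d. cnj (f i) * (\<Sum>k<d. M $$ (i, k) * f k))"
    if "M \<in> carrier_mat d d" for M and f :: "nat \<Rightarrow> complex"
    using that by (simp add: scalar_prod_def atLeast0LessThan mult.commute)
  have lin: "op_left d M (\<lambda>i. x i + y i) = (\<lambda>i. op_left d M x i + op_left d M y i)"
    "op_left d M (\<lambda>i. c * x i) = (\<lambda>i. c * op_left d M x i)"
    "op_right d M (\<lambda>i. x i + y i) = (\<lambda>i. op_right d M x i + op_right d M y i)"
    "op_right d M (\<lambda>i. c * x i) = (\<lambda>i. c * op_right d M x i)" for M x y c
    by (auto simp: op_left_def op_right_def distrib_left sum.distrib sum_distrib_left mult.left_commute)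
  have nonneg_sum: "(\<Sum>i\<in>K. f i) \<in> \<real>\<^sub>\<ge>\<^sub>0" if "\<And>i. i \<in> K \<Longrightarrow> f i \<in> \<real>\<^sub>\<ge>\<^sub>0" for f :: "nat \<Rightarrow> complex" and K
    using that by (auto simp: complex_nonneg_Reals_iff intro: sum_nonneg)
  have psd_left: "psd (op_left d M)" if M: "psd_mat d M" for M
    unfolding psd_def weq_def lin
  proof (intro conjI ballI allI)
    fix x
    have "(\<Sum>t\<in>T. cnj (x t) * op_left d M x t) = (\<Sum>j<d. (M *\<^sub>v vec d (\<lambda>i. x (i, j))) \<bullet>c vec d (\<lambda>i. x (i, j)))"
      using M by (simp add: T_swap form psd_mat_def op_left_def)
    also have "\<dots> \<in> \<real>\<^sub>\<ge>\<^sub>0" using M by (intro nonneg_sum) (simp add: psd_mat_def)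
    finally show "(\<Sum>t\<in>T. cnj (x t) * op_left d M x t) \<in> \<real>\<^sub>\<ge>\<^sub>0" .
  qed auto
  have psd_right: "psd (op_right d M)" if M: "psd_mat d M" for M
    unfolding psd_def weq_def lin
  proof (intro conjI ballI allI)
    fix x
    have "(\<Sum>t\<in>T. cnj (x t) * op_right d M x t) = (\<Sum>i<d. (M *\<^sub>v vec d (\<lambda>j. x (i, j))) \<bullet>c vec d (\<lambda>j. x (i, j)))"
      using M unfolding T_swap by (subst sum.swap) (simp add: form psd_mat_def op_right_def)
    also have "\<dots> \<in> \<real>\<^sub>\<ge>\<^sub>0" using M by (intro nonneg_sum) (simp add: psd_mat_def)
    finally show "(\<Sum>t\<in>T. cnj (x t) * op_right d M x t) \<in> \<real>\<^sub>\<ge>\<^sub>0" .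
  qed auto
  have unit: "(\<Sum>a\<in>{1..k}. F a $$ (i, j)) = (if i = j then 1 else 0)"
    if "povm_mat d {1..k} F" "i < d" "j < d" for F i j
  proof -
    have "mat d d (\<lambda>ij. \<Sum>a\<in>{1..k}. F a $$ ij) $$ (i, j) = 1\<^sub>m d $$ (i, j)"
      using that by (simp add: povm_mat_def)
    then show ?thesis using that by simp
  qed
  have left_sum: "(\<Sum>a\<in>{1..k}. op_left d (F a) x t) = x t" if F: "povm_mat d {1..k} F" and t: "t \<in> T" for F x t
  proof -
    have "(\<Sum>a\<in>{1..k}. op_left d (F a) x t) = (\<Sum>m<d. (\<Sum>a\<in>{1..k}. F a $$ (fst t, m)) * x (m, snd t))"
      unfolding op_left_def by (subst sum.swap) (simp add: sum_distrib_right)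
    also have "\<dots> = (\<Sum>m<d. if m = fst t then x (m, snd t) else 0)"
      using unit[OF F] t by (intro sum.cong refl) (auto simp: T_def)
    finally show ?thesis using t by (auto simp: T_def)
  qed
  have right_sum: "(\<Sum>a\<in>{1..k}. op_right d (F a) x t) = x t" if F: "povm_mat d {1..k} F" and t: "t \<in> T" for F x t
  proof -
    have "(\<Sum>a\<in>{1..k}. op_right d (F a) x t) = (\<Sum>m<d. (\<Sum>a\<in>{1..k}. F a $$ (snd t, m)) * x (fst t, m))"
      unfolding op_right_def by (subst sum.swap) (simp add: sum_distrib_right)
    also have "\<dots> = (\<Sum>m<d. if m = snd t then x (fst t, m) else 0)"
      using unit[OF F] t by (intro sum.cong refl) (auto simp: T_def)
    finally show ?thesis using t by (auto simp: T_def)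
  qed
  have povm_left: "weak_povm {1..k} (\<lambda>a. op_left d (F a))" if F: "povm_mat d {1..k} F" for F
    unfolding weak_povm_def
  proof (intro conjI ballI)
    show "psd (op_left d (F a))" if "a \<in> {1..k}" for a using F that psd_left by (simp add: povm_mat_def)
    show "(\<Sum>a\<in>{1..k}. \<Sum>t\<in>T. cnj (y t) * op_left d (F a) x t) = (\<Sum>t\<in>T. cnj (y t) * x t)" for x y
      by (subst sum.swap) (simp add: sum_distrib_left[symmetric] left_sum[OF F] del: One_nat_def)
  qed
  have povm_right: "weak_povm {1..k} (\<lambda>a. op_right d (F a))" if F: "povm_mat d {1..k} F" for F
    unfolding weak_povm_def
  proof (intro conjI ballI)
    show "psd (op_right d (F a))" if "a \<in> {1..k}" for a using F that psd_right by (simp add: povm_mat_def)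
    show "(\<Sum>a\<in>{1..k}. \<Sum>t\<in>T. cnj (y t) * op_right d (F a) x t) = (\<Sum>t\<in>T. cnj (y t) * x t)" for x y
      by (subst sum.swap) (simp add: sum_distrib_left[symmetric] right_sum[OF F] del: One_nat_def)
  qed
  define \<eta> where "\<eta> t = \<psi> $ (fst t * d + snd t)" for t :: "nat \<times> nat"
  have \<eta>1: "(\<Sum>t\<in>T. cnj (\<eta> t) * \<eta> t) = 1"
  proof -
    have "\<psi> \<bullet>c \<psi> = (\<Sum>i<d * d. cnj (\<psi> $ i) * \<psi> $ i)"
      using \<psi>(1) by (simp add: scalar_prod_def atLeast0LessThan mult.commute)
    also have "\<dots> = (\<Sum>t\<in>T. cnj (\<eta> t) * \<eta> t)" unfolding sum_div_mod T_def \<eta>_def ..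
    finally show ?thesis using \<psi>(2) by simp
  qed
  have corr: "complex_of_real (P a b s t) = (\<Sum>r\<in>T. cnj (\<eta> r) * op_left d (X s a) (op_right d (Y t b) \<eta>) r)"
    if "a \<in> {1..k}" "b \<in> {1..k}" "s \<in> V" "t \<in> V" for a b s t
  proof -
    have "X s a \<in> carrier_mat d d" "Y t b \<in> carrier_mat d d"
      using X Y that by (auto simp: povm_mat_def psd_mat_def)
    from tensor_quadratic_form[OF this \<psi>(1)] show ?thesis
      using P_eq that unfolding T_def \<eta>_def by simp
  qed
  have EV: "i \<in> V \<and> j \<in> V" if "{i, j} \<in> E" for i j using G that by (auto simp: finite_graph_def)
  define W where "W a w = word_op (\<lambda>i. op_left d (X i a)) w" for a w
  define l where "l w = (\<Sum>a\<in>{1..k}. Re (\<Sum>t\<in>T. cnj (\<eta> t) * W a w \<eta> t))" for w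
  have hyp_sync: "(\<Sum>t\<in>T. cnj (\<eta> t) * op_left d (X s a) (op_right d (Y s b) \<eta>) t) = 0"
    if "a \<in> {1..k}" "b \<in> {1..k}" "s \<in> V" "a \<noteq> b" for a b s
  proof -
    have "P a b s s = 0" using sync that unfolding synchronous_def by blast
    then show ?thesis using corr[of a b s s] that by simp
  qed
  have hyp_proper: "(\<Sum>t\<in>T. cnj (\<eta> t) * op_left d (X i a) (op_right d (Y j a) \<eta>) t) = 0"
    if "a \<in> {1..k}" "{i, j} \<in> E" for a i j
  proof -
    have "P a a i j = 0" using proper that unfolding proper_correlation_def by blast
    then show ?thesis using corr[of a a i j] that EV by simp
  qed
  have hyp_comm: "weq (op_left d (X s a) (op_right d (Y t b) x)) (op_right d (Y t b) (op_left d (X s a) x))" for s a t b x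
    by (simp add: weq_def op_left_right_commute)
  have povmX: "weak_povm {1..k} (\<lambda>a. op_left d (X s a))" and povmY: "weak_povm {1..k} (\<lambda>a. op_right d (Y s a))"
    if "s \<in> V" for s using X Y that povm_left povm_right by blast+
  note M = synchronous_col_moments[where X = "\<lambda>s a. op_left d (X s a)"
      and Y = "\<lambda>s a. op_right d (Y s a)", OF G finite_atLeastAtMost UNIV_I \<eta>1 povmX povmY hyp_comm
      hyp_sync hyp_proper, folded W_def, folded l_def]
  have "col_moments V E l" by (rule M(1))
  have "l [] = real (card {1..k})" by (rule M(2))
  have gram: "l (rev u @ w) = (\<Sum>a = 1..k. Re (\<Sum>i\<in>T. cnj (W a u \<eta> i) * W a w \<eta> i))"
    if "u \<in> lists V" "w \<in> lists V" for u w by (rule M(3), use that in auto)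
  \<comment> \<open>The sum over the outputs is one Gram form on vectors with coordinates in the
    finite set \<open>{1..k} \<times> T\<close>.\<close>
  have "finite_columns V l"
  proof (rule finite_columns_gram[of "{1..k} \<times> T"])
    show "finite ({1..k} \<times> T)" by (simp add: T_def)
    fix u w assume "u \<in> lists V" "w \<in> lists V"
    from gram[OF this]
    show "l (rev u @ w) = Re (\<Sum>t\<in>{1..k} \<times> T. cnj (W (fst t) u \<eta> (snd t)) * W (fst t) w \<eta> (snd t))"
      by (simp add: sum.cartesian_product' del: cnj.sel)
  qed
  from xi_col_star_le[OF G \<open>col_moments V E l\<close> this] show ?thesis
    using \<open>l [] = real (card {1..k})\<close> by simp
qed

section \<open>Deterministic correlations\<close>

lemma one_dim_quadratic:
  assumes "M \<in> carrier_mat 1 1" "v \<in> carrier_vec 1"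
  shows "(M *\<^sub>v v) \<bullet>c v = M $$ (0, 0) * (v $ 0 * cnj (v $ 0))"
  using assms by (simp add: scalar_prod_def)

text \<open>A strategy in dimension 1, where both players answer \<open>f\<close>. Its purpose is to
  make the set behind the \<open>LEAST\<close> in \<open>chi_q\<close> nonempty.\<close>

lemma deterministic_C_q:
  fixes f :: "'v \<Rightarrow> nat"
  assumes "\<And>s. s \<in> V \<Longrightarrow> f s \<in> {1..k}"
  shows "(\<lambda>a b s t. of_bool (f s = a \<and> f t = b)) \<in> C_qs {1..k} V"
proof -
  define X where "X s a = mat 1 1 (\<lambda>_. of_bool (f s = a) :: complex)" for s a
  have Xc: "X s a \<in> carrier_mat 1 1" for s a by (simp add: X_def)
  have "povm_mat 1 {1..k} (X s)" if "s \<in> V" for s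
    unfolding povm_mat_def psd_mat_def
  proof (intro conjI ballI)
    fix a
    show "X s a \<in> carrier_mat 1 1" by (rule Xc)
    show "mat_adjoint (X s a) = X s a" unfolding mat_adjoint_eq_iff[OF Xc] by (simp add: X_def)
    show "(X s a *\<^sub>v v) \<bullet>c v \<in> \<real>\<^sub>\<ge>\<^sub>0" if "v \<in> carrier_vec 1" for v
      unfolding one_dim_quadratic[OF Xc that]
      by (simp add: X_def complex_nonneg_Reals_iff)
  next
    have "(\<Sum>a\<in>{1..k}. X s a $$ (0, 0)) = (\<Sum>a\<in>{1..k}. if a = f s then 1 else 0)"
      by (intro sum.cong refl) (auto simp: X_def)
    also have "\<dots> = 1" using assms[OF that] by simp
    finally show "mat 1 1 (\<lambda>ij. \<Sum>a\<in>{1..k}. X s a $$ ij) = 1\<^sub>m 1"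
      by (intro eq_matI) auto
  qed
  moreover have "complex_of_real (of_bool (f s = a \<and> f t = b))
      = (tensor_mat (X s a) (X t b) *\<^sub>v vec (1 * 1) (\<lambda>_. 1)) \<bullet>c vec (1 * 1) (\<lambda>_. 1)" for a b s t
  proof -
    have "tensor_mat (X s a) (X t b) \<in> carrier_mat 1 1" by (simp add: tensor_mat_def X_def)
    from one_dim_quadratic[OF this, of "vec 1 (\<lambda>_. 1)"] show ?thesis
      by (simp add: tensor_mat_def X_def)
  qed
  moreover have "vec (1 * 1) (\<lambda>_. 1 :: complex) \<bullet>c vec (1 * 1) (\<lambda>_. 1) = 1"
    by (simp add: scalar_prod_def)
  ultimately have "(\<lambda>a b s t. of_bool (f s = a \<and> f t = b)) \<in> C_q {1..k} V"
    unfolding C_q_def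
    by (intro CollectI exI[of _ 1] exI[of _ "vec (1 * 1) (\<lambda>_. 1)"] exI[of _ X] conjI ballI) auto
  then show ?thesis by (auto simp: C_qs_def synchronous_def)
qed

lemma complex_countable_dense:
  obtains D :: "complex set" where "countable D" "\<And>z e. e > 0 \<Longrightarrow> \<exists>w\<in>D. cmod (z - w) < e"
proof
  let ?D = "(\<lambda>(a, b). Complex a b) ` (\<rat> \<times> \<rat>)"
  show "countable ?D" by (intro countable_image countable_SIGMA countable_rat)
  fix z :: complex and e :: real assume "e > 0"
  obtain a where a: "a \<in> \<rat>" "Re z < a" "a < Re z + e / 2"
    using Rats_dense_in_real[of "Re z" "Re z + e / 2"] \<open>e > 0\<close> by auto
  obtain b where b: "b \<in> \<rat>" "Im z < b" "b < Im z + e / 2"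
    using Rats_dense_in_real[of "Im z" "Im z + e / 2"] \<open>e > 0\<close> by auto
  have "cmod (z - Complex a b) \<le> \<bar>Re z - a\<bar> + \<bar>Im z - b\<bar>"
    using cmod_le[of "z - Complex a b"] by simp
  also have "\<dots> < e" using a b by simp
  finally show "\<exists>w\<in>?D. cmod (z - w) < e" using a b by (intro bexI[of _ "Complex a b"]) auto
qed

text \<open>A copy of the one-dimensional Hilbert space inside \<open>'u\<close>, for the analogous
  use with \<open>chi_qc\<close>.\<close>

locale complex_copy =
  fixes J :: "complex \<Rightarrow> 'u"
  assumes inj_J: "inj J"
begin

definition K :: "'u \<Rightarrow> complex" where
  "K = inv_into UNIV J"

lemma K_J [simp]: "K (J z) = z"
  by (simp add: K_def inj_J)

definition H :: "'u inner_space" where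
  "H = \<lparr>carrier = range J, monoid.mult = (\<lambda>x y. x), one = J 1, zero = J 0,
        add = (\<lambda>x y. J (K x + K y)), module.smult = (\<lambda>c x. J (c * K x)), ip = (\<lambda>x y. cnj (K x) * K y)\<rparr>"

lemma H_simps [simp]:
  "carrier H = range J" "\<zero>\<^bsub>H\<^esub> = J 0" "J x \<oplus>\<^bsub>H\<^esub> J y = J (x + y)" "c \<odot>\<^bsub>H\<^esub> J x = J (c * x)"
  "ip H (J x) (J y) = cnj x * y"
  by (simp_all add: H_def)

lemma abelian_group_H: "abelian_group H"
proof (rule abelian_groupI)
  fix x assume "x \<in> carrier H"
  then obtain z where "x = J z" by auto
  then show "\<exists>y\<in>carrier H. y \<oplus>\<^bsub>H\<^esub> x = \<zero>\<^bsub>H\<^esub>" by (intro bexI[of _ "J (- z)"]) auto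
qed (auto simp: add_ac)

lemma minus_H: "J x \<ominus>\<^bsub>H\<^esub> J y = J (x - y)"
proof -
  interpret abelian_group H by (rule abelian_group_H)
  have "\<ominus>\<^bsub>H\<^esub> J y = J (- y)" by (rule minus_equality) auto
  then show ?thesis by (simp add: a_minus_def)
qed

lemma hnorm_H: "hnorm H (J z) = cmod z"
  by (simp add: hnorm_def cmod_power2[symmetric] power2_eq_square[symmetric])

lemma separable_hilbert_space_H: "separable_hilbert_space H"
proof -
  have "module complex_ring H"
    by (rule moduleI[OF cring_complex_ring abelian_group_H])
      (auto simp: complex_ring_def algebra_simps)
  moreover have "separable_hilbert_space_axioms H"
  proof
    fix s :: "nat \<Rightarrow> 'u"
    assume s: "\<And>n. s n \<in> carrier H"
      and cauchy: "\<And>e. e > 0 \<Longrightarrow> \<exists>N. \<forall>m\<ge>N. \<forall>n\<ge>N. hnorm H (s m \<ominus>\<^bsub>H\<^esub> s n) < e"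
    have sK: "s n = J (K (s n))" for n using s[of n] by auto
    have norm: "hnorm H (s m \<ominus>\<^bsub>H\<^esub> s n) = dist (K (s m)) (K (s n))" for m n
      using minus_H[of "K (s m)" "K (s n)"] sK hnorm_H by (metis dist_norm)
    have "Cauchy (\<lambda>n. K (s n))" using cauchy unfolding norm by (intro metric_CauchyI)
    then obtain z where z: "(\<lambda>n. K (s n)) \<longlonglongrightarrow> z"
      using Cauchy_convergent_iff convergent_def by blast
    have "hnorm H (s n \<ominus>\<^bsub>H\<^esub> J z) = dist (K (s n)) z" for n
      using minus_H[of "K (s n)" z] sK[of n] hnorm_H by (metis dist_norm)
    then have "(\<lambda>n. hnorm H (s n \<ominus>\<^bsub>H\<^esub> J z)) \<longlonglongrightarrow> 0"
      by (simp only:) (rule iffD1[OF tendsto_dist_iff z])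
    then show "\<exists>x\<in>carrier H. (\<lambda>n. hnorm H (s n \<ominus>\<^bsub>H\<^esub> x)) \<longlonglongrightarrow> 0" by auto
  next
    obtain D :: "complex set" where D: "countable D" "\<And>z e. e > 0 \<Longrightarrow> \<exists>w\<in>D. cmod (z - w) < e"
      by (rule complex_countable_dense, rule that)
    have "\<exists>y\<in>J ` D. hnorm H (x \<ominus>\<^bsub>H\<^esub> y) < e" if x: "x \<in> carrier H" and e: "e > 0" for x e
    proof -
      obtain z where "x = J z" using x by auto
      then show ?thesis using D(2)[OF e, of z] by (auto simp: minus_H hnorm_H)
    qed
    then show "\<exists>D. countable D \<and> D \<subseteq> carrier H \<and> (\<forall>x\<in>carrier H. \<forall>e>0. \<exists>y\<in>D. hnorm H (x \<ominus>\<^bsub>H\<^esub> y) < e)"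
      using D(1) by (intro exI[of _ "J ` D"]) auto
  qed (auto simp: algebra_simps complex_nonneg_Reals_iff)
  ultimately show ?thesis by (rule separable_hilbert_space.intro)
qed

lemma finsum_H: "finite A \<Longrightarrow> (\<Oplus>\<^bsub>H\<^esub>a\<in>A. J (g a)) = J (\<Sum>a\<in>A. g a)"
proof (induction A rule: finite_induct)
  interpret abelian_group H by (rule abelian_group_H)
  case empty
  show ?case by simp
next
  interpret abelian_group H by (rule abelian_group_H)
  case (insert a A)
  then show ?case by (subst finsum_insert) auto
qed

lemma deterministic_C_qc:
  fixes f :: "'v \<Rightarrow> nat"
  assumes "\<And>s. s \<in> V \<Longrightarrow> f s \<in> {1..k}"
  shows "(\<lambda>a b s t. of_bool (f s = a \<and> f t = b)) \<in> C_qcs TYPE('u) {1..k} V"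
proof -
  define X where "X s a x = J (of_bool (f s = a) * K x)" for s :: 'v and a x
  have XJ: "X s a (J z) = J (of_bool (f s = a) * z)" for s a z by (simp add: X_def)
  have "psd_op H (X s a)" for s a
    unfolding psd_op_def bounded_op_def
    by (auto simp: XJ hnorm_H algebra_simps norm_mult complex_nonneg_Reals_iff X_def intro!: exI[of _ 1])
  moreover have "(\<Oplus>\<^bsub>H\<^esub>a\<in>{1..k}. X s a x) = x" if s: "s \<in> V" and xH: "x \<in> carrier H" for s x
  proof -
    obtain z where x: "x = J z" using xH by auto
    have "(\<Sum>a\<in>{1..k}. of_bool (f s = a) * z) = (\<Sum>a\<in>{1..k}. if a = f s then z else 0)"
      by (intro sum.cong refl) auto
    also have "\<dots> = z" using assms[OF s] by simp
    finally have "(\<Sum>a\<in>{1..k}. of_bool (f s = a) * z) = z" .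
    then show ?thesis unfolding x XJ finsum_H[OF finite_atLeastAtMost] by (simp only:)
  qed
  ultimately have "(\<lambda>a b s t. of_bool (f s = a \<and> f t = b)) \<in> C_qc TYPE('u) {1..k} V"
    unfolding C_qc_def
    by (intro CollectI exI[of _ H] exI[of _ "J 1"] exI[of _ X] conjI ballI separable_hilbert_space_H)
      (auto simp: povm_op_def hnorm_H XJ)
  then show ?thesis by (auto simp: C_qcs_def synchronous_def)
qed

end

lemma proper_deterministic:
  assumes "finite_graph V E" "inj_on f V"
  shows "proper_correlation k E (\<lambda>a b s t. of_bool (f s = a \<and> f t = b))"
  unfolding proper_correlation_def
proof (intro ballI allI impI)
  fix a i j assume "{i, j} \<in> E"
  then have "i \<in> V" "j \<in> V" "i \<noteq> j" using assms(1) by (auto simp: finite_graph_def)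
  then have "f i \<noteq> f j" using assms(2) by (auto simp: inj_on_def)
  then show "of_bool (f i = a \<and> f j = a) = (0 :: real)" by auto
qed

lemma inj_complex_of_lepoll:
  assumes "(UNIV :: real set) \<lesssim> (UNIV :: 'u set)"
  obtains J :: "complex \<Rightarrow> 'u" where "inj J"
proof -
  obtain J :: "(nat \<Rightarrow> (nat nc_word \<Rightarrow>\<^sub>0 complex)) \<Rightarrow> 'u" where J: "inj J"
    by (rule inj_sequences_of_lepoll[OF assms])
  have "inj (\<lambda>z. J (\<lambda>_. Poly_Mapping.single 0 z))"
  proof (rule injI)
    fix x y :: complex
    assume "J (\<lambda>_. Poly_Mapping.single 0 x) = J (\<lambda>_. Poly_Mapping.single 0 y)"
    then have "(\<lambda>_. Poly_Mapping.single 0 x) = (\<lambda>_ :: nat. Poly_Mapping.single (0 :: nat nc_word) y)"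
      using J by (simp only: inj_eq)
    then have "Poly_Mapping.single (0 :: nat nc_word) x = Poly_Mapping.single 0 y" by (rule fun_cong)
    then show "x = y" by (metis lookup_single_eq)
  qed
  then show ?thesis by (rule that)
qed

text \<open>With no vertices nothing ties the parameter to an operator, so arbitrarily small values
  are feasible. For \<open>xi_tr\<close> a C*-algebra with a tracial state on a subset of
  \<open>'u\<close> must still be exhibited; it comes from the moments supported at the empty
  word.\<close>

lemma xi_empty:
  fixes E :: "'v set set"
  assumes U: "(UNIV :: real set) \<lesssim> (UNIV :: 'u set)" and G: "finite_graph {} E"
  shows "xi_f {} E \<le> 0" "xi_tr TYPE('u) {} E \<le> 0"
proof -
  have E: "E = {}" using G by (auto simp: finite_graph_def)
  have "xi_f {} E \<le> ereal (1 / real (Suc n))" for n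
    unfolding xi_f_def E by (intro Inf_lower CollectI exI[of _ 1] exI[of _ "Suc n"]) auto
  moreover have "(\<lambda>n. ereal (1 / real (Suc n))) \<longlonglongrightarrow> ereal 0"
    by (intro tendsto_intros LIMSEQ_inverse_real_of_nat[unfolded inverse_eq_divide])
  ultimately show "xi_f {} E \<le> 0" using LIMSEQ_le_const unfolding zero_ereal_def by blast
  have "xi_tr TYPE('u) {} E \<le> ereal e" if e: "e > 0" for e
  proof -
    define l :: "'v list \<Rightarrow> real" where "l w = (if w = [] then e else 0)" for w
    have "col_moments {} E l"
      unfolding col_moments_def tracial_moments_def E
    proof (intro conjI allI impI ballI)
      fix K :: "'v list set" and c :: "'v list \<Rightarrow> real" assume K: "finite K \<and> K \<subseteq> lists {}"
      then have "K \<subseteq> {[]}" by auto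
      then show "0 \<le> (\<Sum>u\<in>K. \<Sum>w\<in>K. c u * c w * l (rev u @ w))"
        using e by (auto simp: subset_singleton_iff l_def)
    qed (auto simp: l_def)
    note L = col_feasible_ext[OF G this]
    show ?thesis using xi_le_col_feasible(1)[OF G _ L(1) U] L(2) e by (simp add: l_def)
  qed
  then have "xi_tr TYPE('u) {} E \<le> ereal (1 / real (Suc n))" for n by simp
  moreover have "(\<lambda>n. ereal (1 / real (Suc n))) \<longlonglongrightarrow> ereal 0"
    by (intro tendsto_intros LIMSEQ_inverse_real_of_nat[unfolded inverse_eq_divide])
  ultimately show "xi_tr TYPE('u) {} E \<le> 0" using LIMSEQ_le_const unfolding zero_ereal_def by blast
qed

lemma col_feasible_nonneg:
  assumes "col_feasible V E L"
  shows "0 \<le> L 1"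
proof -
  have "(1 :: 'a nc_poly) \<in> nc_polys V" by (simp add: nc_polys_def words_def)
  then have "L (nc_star 1 * 1) \<ge> 0" 
    using assms unfolding col_feasible_def positive_functional_def by blast
  moreover have "nc_star (1 :: 'a nc_poly) = 1" using nc_star_single[of 0 1] by simp
  ultimately show ?thesis by simp
qed

theorem proposition3p6:
  fixes V :: "'v set" and E :: "'v set set"
  assumes "finite_graph V E"
    and "(UNIV :: real set) \<lesssim> (UNIV :: 'u set)"
  shows "xi_col_star V E = xi_f V E \<and> xi_f V E \<le> ereal (real (chi_q V E)) \<and>
         xi_col_inf V E = xi_tr TYPE('u) V E \<and>
         xi_tr TYPE('u) V E \<le> ereal (real (chi_qc TYPE('u) V E))"
proof -
  note G = assms(1) and U = assms(2)
  have "xi_f V E \<le> xi_col_star V E"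
    unfolding xi_col_star_def
  proof (rule Inf_greatest, safe)
    fix L assume L: "col_feasible V E L" "finite_rank (words V) (moment_matrix L)"
    show "xi_f V E \<le> ereal (L 1)"
    proof (cases "V = {}")
      \<comment> \<open>Here \<open>L 1\<close> may be 0, and the GNS trace could not be
        normalized.\<close>
      case True
      then have "xi_f V E \<le> 0" using xi_empty(1)[OF U] G by simp
      also have "0 \<le> ereal (L 1)" using col_feasible_nonneg[OF L(1)] by simp
      finally show ?thesis .
    next
      case False
      then show ?thesis using xi_le_col_feasible(2)[OF G _ L(1) U] L(2) by simp
    qed
  qed
  then have star: "xi_col_star V E = xi_f V E"
    using xi_col_star_le_xi_f[OF G] by simp
  have "xi_tr TYPE('u) V E \<le> xi_col_inf V E"
    unfolding xi_col_inf_def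
  proof (rule Inf_greatest, safe)
    fix L assume L: "col_feasible V E L"
    show "xi_tr TYPE('u) V E \<le> ereal (L 1)"
    proof (cases "V = {}")
      case True
      then have "xi_tr TYPE('u) V E \<le> 0" using xi_empty(2)[OF U] G by simp
      also have "0 \<le> ereal (L 1)" using col_feasible_nonneg[OF L] by simp
      finally show ?thesis .
    next
      case False
      then show ?thesis using xi_le_col_feasible(1)[OF G _ L U] by simp
    qed
  qed
  then have inf: "xi_col_inf V E = xi_tr TYPE('u) V E"
    by (intro antisym xi_col_inf_le_xi_tr[OF G])
  have "finite V" using G by (simp add: finite_graph_def)
  then obtain f where f: "bij_betw f V {1..card V}"
    using ex_bij_betw_finite_nat[of V] bij_betw_trans[OF _ bij_betw_imageI[of Suc "{0..<card V}" "{1..card V}"]]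
    by (metis One_nat_def image_Suc_atLeastLessThan atLeastLessThanSuc_atLeastAtMost inj_Suc inj_on_subset subset_UNIV)
  then have fV: "f s \<in> {1..card V}" if "s \<in> V" for s using that by (auto simp: bij_betw_def)
  have proper: "proper_correlation (card V) E (\<lambda>a b s t. of_bool (f s = a \<and> f t = b))"
    using proper_deterministic[OF G] f by (simp add: bij_betw_def)
  \<comment> \<open>Giving each vertex its own colour shows that some \<open>k\<close> is feasible,
    so \<open>LEAST\<close> picks a feasible value.\<close>
  have "\<exists>k. \<exists>P\<in>C_qs {1..k} V. proper_correlation k E P"
    by (rule exI[of _ "card V"], rule bexI[where x = "\<lambda>a b s t. of_bool (f s = a \<and> f t = b)"])
      (rule proper, rule deterministic_C_q, rule fV)
  from LeastI_ex[OF this] obtain P where "P \<in> C_qs {1..chi_q V E} V" "proper_correlation (chi_q V E) E P"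
    unfolding chi_q_def by (elim bexE)
  then have q: "xi_col_star V E \<le> ereal (real (chi_q V E))" by (rule xi_col_star_le_q[OF G])
  obtain J :: "complex \<Rightarrow> 'u" where "inj J" by (rule inj_complex_of_lepoll[OF U])
  then interpret complex_copy J by unfold_locales
  have "\<exists>k. \<exists>P\<in>C_qcs TYPE('u) {1..k} V. proper_correlation k E P"
    by (rule exI[of _ "card V"], rule bexI[where x = "\<lambda>a b s t. of_bool (f s = a \<and> f t = b)"])
      (rule proper, rule deterministic_C_qc, rule fV)
  from LeastI_ex[OF this] obtain P where "P \<in> C_qcs TYPE('u) {1..chi_qc TYPE('u) V E} V"
    "proper_correlation (chi_qc TYPE('u) V E) E P"
    unfolding chi_qc_def by (elim bexE)
  then have qc: "xi_col_inf V E \<le> ereal (real (chi_qc TYPE('u) V E))" by (rule xi_col_inf_le_qc[OF G])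
  show ?thesis using star inf q qc by simp
qed

end
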